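(* The following pairs $f(x),g(x)$ of functions in one variable are admissible ($c_1,c_2$ being constants, not both zero): 1) $f(x)=\sqrt{x^2-1}$, $\ g(x)=\frac{c_1}{\sqrt{x+1}}+\frac{c_2}{\sqrt{x-1}}$; 2) $f(x)=\frac1x$, $\ g(x)=c_1x^{-\frac12}+c_2x^{-\frac32}$; 3) $f(x)=x^{\frac12}$, $\ g(x)=c_1+c_2x^{-\frac12}$; 4) $f(x)=x^2$, $\ g(x)=c_1+c_2x$. Moreover, any admissible pair of functions in one variable is equivalent to one of these under transformations $$x\mapsto\lambda_0+\lambda_1x,\qquad f\mapsto\mu_0f+\mu_1+\mu_2x$$ where $\lambda_0,\lambda_1,\mu_0,\mu_1,\mu_2$ are constants with $\lambda_1,\mu_0\neq0$. In particular, the rank of any admissible pair of functions in one variable is equal to $2$.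
   Context: Functions are germs of analytic functions, or formal germs (power series) with coefficients in a field $\mathbf k$ of characteristic $0$. Let $f(x)$ be a function of one variable with $f''\not\equiv0$ and $g(x)$ another function. At points $t$ with $f''(t)\ne0$ put $R_t(u)=f(t+u)-f(t)-f'(t)u-\frac12f''(t)u^2$, $\Delta_t=-\frac1{2f''(t)}\partial_u^2$ and $$A_k(t)=\sum_{v=0}^{2k}\frac1{v!\,(k+v)!}\Delta_t^{\,k+v}\big[g(t+u)R_t(u)^v\big]\Big|_{u=0},\qquad k\ge0.$$ These are the coefficients of the formal stationary phase expansion $\int g\,e^{(f(x)+xy)/\hbar}dx=(2\pi\hbar)^{1/2}e^{\hat f(y)/\hbar}(-f''(t))^{-1/2}\sum_kA_k(t)\hbar^k$ at the critical point $t$ (with $y=-f'(t)$, $\hat f(y)=f(t)+ty$). The pair $(f,g)$ is *admissible* if $f''\not\equiv0$, $g\not\equiv0$ and $A_k\equiv0$ for all $k\ge1$. The *rank* of $f$, and of the pair $(f,g)$, is the dimension of the vector space $V_f=\{g:(f,g)\text{ admissible or }g=0\}$.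
   Formalization: For formal germs over a field k that is not algebraically closed, the equivalence to a listed pair is stated with constants in an algebraically closed extension of k, since over k itself it fails (e.g. f=√(x²+1) over the reals). *)

theory Defs
  imports
    "HOL-Complex_Analysis.Complex_Analysis"
begin

text \<open>
  Two kinds of functions are considered.  A formal germ at a point \<open>a\<close> of a field is a power
  series in \<open>x - a\<close>, an element of type \<open>'a fps\<close>.  A germ of an analytic function at \<open>a\<close> is
  represented by a function \<open>complex \<Rightarrow> complex\<close> that is analytic at \<open>a\<close>, all identities being
  required only near \<open>a\<close>.
\<close>


section \<open>Formal germs\<close>

text \<open>
  \<open>f(t + u)\<close> as a power series in \<open>u\<close>.  Its coefficients are functions of \<open>t\<close>, expanded at the base
  point.  They are taken in the field of Laurent series because \<open>f''\<close>, which is inverted below, may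
  vanish at the base point itself.
\<close>

definition fps_shift_arg :: "'a::field_char_0 fps \<Rightarrow> 'a fls fps" where
  "fps_shift_arg f = Abs_fps (\<lambda>n. fps_to_fls ((fps_deriv ^^ n) f) / fact n)"

definition fps_R :: "'a::field_char_0 fps \<Rightarrow> 'a fls fps" where
  "fps_R f = fps_shift_arg f - fps_const (fps_to_fls f)
     - fps_const (fps_to_fls (fps_deriv f)) * fps_X
     - fps_const (1/2 * fps_to_fls (fps_deriv (fps_deriv f))) * fps_X ^ 2"

definition fps_Delta :: "'a::field_char_0 fps \<Rightarrow> 'a fls fps \<Rightarrow> 'a fls fps" where
  "fps_Delta f h =
     fps_const (- (1 / (2 * fps_to_fls (fps_deriv (fps_deriv f))))) * fps_deriv (fps_deriv h)"

definition fps_A :: "'a::field_char_0 fps \<Rightarrow> 'a fps \<Rightarrow> nat \<Rightarrow> 'a fls" where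
  "fps_A f g k = (\<Sum>v\<le>2*k. 1 / (fact v * fact (k + v)) *
     fps_nth ((fps_Delta f ^^ (k + v)) (fps_shift_arg g * fps_R f ^ v)) 0)"

definition fps_admissible :: "'a::field_char_0 fps \<Rightarrow> 'a fps \<Rightarrow> bool" where
  "fps_admissible f g \<longleftrightarrow>
     fps_deriv (fps_deriv f) \<noteq> 0 \<and> g \<noteq> 0 \<and> (\<forall>k\<ge>1. fps_A f g k = 0)"

definition fps_V :: "'a::field_char_0 fps \<Rightarrow> 'a fps set" where
  "fps_V f = {g. fps_admissible f g \<or> g = 0}"

abbreviation fps_scale :: "'a::field \<Rightarrow> 'a fps \<Rightarrow> 'a fps" where
  "fps_scale c g \<equiv> fps_const c * g"

definition fps_rank :: "'a::field_char_0 fps \<Rightarrow> nat" where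
  "fps_rank f = vector_space.dim fps_scale (fps_V f)"

text \<open>The function \<open>x\<close>, as a germ at \<open>a\<close>.\<close>

definition fps_coord :: "'a::field \<Rightarrow> 'a fps" where
  "fps_coord a = fps_const a + fps_X"

text \<open>
  The germs at \<open>a\<close> of the four families of pairs.  A square root is any germ with the required
  square, so every choice of branches is allowed.
\<close>

definition fps_pair1 :: "'a::field_char_0 \<Rightarrow> 'a \<Rightarrow> 'a \<Rightarrow> 'a fps \<Rightarrow> 'a fps \<Rightarrow> bool" where
  "fps_pair1 c1 c2 a f g \<longleftrightarrow> f ^ 2 = fps_coord a ^ 2 - 1 \<and>
     (\<exists>p q. p ^ 2 = fps_coord a + 1 \<and> q ^ 2 = fps_coord a - 1 \<and>
        g = fps_const c1 * inverse p + fps_const c2 * inverse q)"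

definition fps_pair2 :: "'a::field_char_0 \<Rightarrow> 'a \<Rightarrow> 'a \<Rightarrow> 'a fps \<Rightarrow> 'a fps \<Rightarrow> bool" where
  "fps_pair2 c1 c2 a f g \<longleftrightarrow> a \<noteq> 0 \<and> f = inverse (fps_coord a) \<and>
     (\<exists>s. s ^ 2 = fps_coord a \<and>
        g = fps_const c1 * inverse s + fps_const c2 * inverse (s ^ 3))"

definition fps_pair3 :: "'a::field_char_0 \<Rightarrow> 'a \<Rightarrow> 'a \<Rightarrow> 'a fps \<Rightarrow> 'a fps \<Rightarrow> bool" where
  "fps_pair3 c1 c2 a f g \<longleftrightarrow>
     f ^ 2 = fps_coord a \<and>
     (\<exists>s. s ^ 2 = fps_coord a \<and> g = fps_const c1 + fps_const c2 * inverse s)"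

definition fps_pair4 :: "'a::field_char_0 \<Rightarrow> 'a \<Rightarrow> 'a \<Rightarrow> 'a fps \<Rightarrow> 'a fps \<Rightarrow> bool" where
  "fps_pair4 c1 c2 a f g \<longleftrightarrow>
     f = fps_coord a ^ 2 \<and> g = fps_const c1 + fps_const c2 * fps_coord a"

definition fps_listed :: "'a::field_char_0 \<Rightarrow> 'a fps \<Rightarrow> 'a fps \<Rightarrow> bool" where
  "fps_listed a f g \<longleftrightarrow> (\<exists>c1 c2. (c1 \<noteq> 0 \<or> c2 \<noteq> 0) \<and>
     (fps_pair1 c1 c2 a f g \<or> fps_pair2 c1 c2 a f g \<or>
      fps_pair3 c1 c2 a f g \<or> fps_pair4 c1 c2 a f g))"

text \<open>
  The pair \<open>(f, g)\<close> of germs at \<open>a\<close> arises from the pair \<open>(F, G)\<close> of germs at \<open>b\<close>: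
  \<open>f(x) = m0 F(l0 + l1 x) + m1 + m2 x\<close> and \<open>g(x) = G(l0 + l1 x)\<close>, where \<open>b = l0 + l1 a\<close>.
  Since \<open>l0 + l1 x - b = l1 (x - a)\<close>, the substitution sends the local parameter \<open>X\<close> to \<open>l1 X\<close>.
\<close>

definition fps_equiv ::
    "'a::field_char_0 \<Rightarrow> 'a fps \<Rightarrow> 'a fps \<Rightarrow> 'a \<Rightarrow> 'a fps \<Rightarrow> 'a fps \<Rightarrow> bool" where
  "fps_equiv a f g b F G \<longleftrightarrow> (\<exists>l0 l1 m0 m1 m2. l1 \<noteq> 0 \<and> m0 \<noteq> 0 \<and> b = l0 + l1 * a \<and>
     f = fps_const m0 * (F oo (fps_const l1 * fps_X)) + fps_const m1 + fps_const m2 * fps_coord a \<and>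
     g = G oo (fps_const l1 * fps_X))"

text \<open>Extension of the coefficient field.\<close>

definition field_embedding :: "('a::field \<Rightarrow> 'b::field) \<Rightarrow> bool" where
  "field_embedding \<phi> \<longleftrightarrow> \<phi> 1 = 1 \<and> (\<forall>x y. \<phi> (x + y) = \<phi> x + \<phi> y) \<and> (\<forall>x y. \<phi> (x * y) = \<phi> x * \<phi> y)"

definition fps_map :: "('a \<Rightarrow> 'b) \<Rightarrow> 'a fps \<Rightarrow> 'b fps" where
  "fps_map \<phi> f = Abs_fps (\<lambda>n. \<phi> (fps_nth f n))"


section \<open>Germs of analytic functions\<close>

definition an_R :: "(complex \<Rightarrow> complex) \<Rightarrow> complex \<Rightarrow> complex \<Rightarrow> complex" where
  "an_R f t u = f (t + u) - f t - deriv f t * u - 1/2 * deriv (deriv f) t * u ^ 2"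

definition an_Delta ::
    "(complex \<Rightarrow> complex) \<Rightarrow> complex \<Rightarrow> (complex \<Rightarrow> complex) \<Rightarrow> complex \<Rightarrow> complex" where
  "an_Delta f t h = (\<lambda>u. - (1 / (2 * deriv (deriv f) t)) * deriv (deriv h) u)"

definition an_A :: "(complex \<Rightarrow> complex) \<Rightarrow> (complex \<Rightarrow> complex) \<Rightarrow> nat \<Rightarrow> complex \<Rightarrow> complex" where
  "an_A f g k t = (\<Sum>v\<le>2*k. 1 / (fact v * fact (k + v)) *
     (an_Delta f t ^^ (k + v)) (\<lambda>u. g (t + u) * an_R f t u ^ v) 0)"

definition an_admissible ::
    "complex \<Rightarrow> (complex \<Rightarrow> complex) \<Rightarrow> (complex \<Rightarrow> complex) \<Rightarrow> bool" where
  "an_admissible a f g \<longleftrightarrow> f analytic_on {a} \<and> g analytic_on {a} \<and>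
     \<not> (\<forall>\<^sub>F t in nhds a. deriv (deriv f) t = 0) \<and>
     \<not> (\<forall>\<^sub>F t in nhds a. g t = 0) \<and>
     (\<forall>k\<ge>1. \<forall>\<^sub>F t in nhds a. deriv (deriv f) t \<noteq> 0 \<longrightarrow> an_A f g k t = 0)"

definition an_V :: "complex \<Rightarrow> (complex \<Rightarrow> complex) \<Rightarrow> (complex \<Rightarrow> complex) set" where
  "an_V a f = {g. an_admissible a f g \<or> (\<forall>\<^sub>F t in nhds a. g t = 0)}"

text \<open>
  Functions that agree near \<open>a\<close> are the same germ.  Hence the dimension is taken after passing to
  Taylor series at \<open>a\<close>, which is linear and identifies exactly such functions.
\<close>

definition an_rank :: "complex \<Rightarrow> (complex \<Rightarrow> complex) \<Rightarrow> nat" where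
  "an_rank a f = vector_space.dim fps_scale ((\<lambda>g. fps_expansion g a) ` an_V a f)"

definition an_pair1 ::
    "complex \<Rightarrow> complex \<Rightarrow> complex \<Rightarrow> (complex \<Rightarrow> complex) \<Rightarrow> (complex \<Rightarrow> complex) \<Rightarrow> bool" where
  "an_pair1 c1 c2 a f g \<longleftrightarrow> f analytic_on {a} \<and> (\<forall>\<^sub>F x in nhds a. f x ^ 2 = x ^ 2 - 1) \<and>
     (\<exists>p q. p analytic_on {a} \<and> q analytic_on {a} \<and>
        (\<forall>\<^sub>F x in nhds a. p x ^ 2 = x + 1 \<and> q x ^ 2 = x - 1 \<and> g x = c1 / p x + c2 / q x))"

definition an_pair2 ::
    "complex \<Rightarrow> complex \<Rightarrow> complex \<Rightarrow> (complex \<Rightarrow> complex) \<Rightarrow> (complex \<Rightarrow> complex) \<Rightarrow> bool" where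
  "an_pair2 c1 c2 a f g \<longleftrightarrow> a \<noteq> 0 \<and> (\<forall>\<^sub>F x in nhds a. f x = 1 / x) \<and>
     (\<exists>s. s analytic_on {a} \<and>
        (\<forall>\<^sub>F x in nhds a. s x ^ 2 = x \<and> g x = c1 / s x + c2 / s x ^ 3))"

definition an_pair3 ::
    "complex \<Rightarrow> complex \<Rightarrow> complex \<Rightarrow> (complex \<Rightarrow> complex) \<Rightarrow> (complex \<Rightarrow> complex) \<Rightarrow> bool" where
  "an_pair3 c1 c2 a f g \<longleftrightarrow> f analytic_on {a} \<and> (\<forall>\<^sub>F x in nhds a. f x ^ 2 = x) \<and>
     (\<exists>s. s analytic_on {a} \<and> (\<forall>\<^sub>F x in nhds a. s x ^ 2 = x \<and> g x = c1 + c2 / s x))"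

definition an_pair4 ::
    "complex \<Rightarrow> complex \<Rightarrow> complex \<Rightarrow> (complex \<Rightarrow> complex) \<Rightarrow> (complex \<Rightarrow> complex) \<Rightarrow> bool" where
  "an_pair4 c1 c2 a f g \<longleftrightarrow> (\<forall>\<^sub>F x in nhds a. f x = x ^ 2 \<and> g x = c1 + c2 * x)"

definition an_listed :: "complex \<Rightarrow> (complex \<Rightarrow> complex) \<Rightarrow> (complex \<Rightarrow> complex) \<Rightarrow> bool" where
  "an_listed a f g \<longleftrightarrow> (\<exists>c1 c2. (c1 \<noteq> 0 \<or> c2 \<noteq> 0) \<and>
     (an_pair1 c1 c2 a f g \<or> an_pair2 c1 c2 a f g \<or>
      an_pair3 c1 c2 a f g \<or> an_pair4 c1 c2 a f g))"

definition an_equiv ::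
    "complex \<Rightarrow> (complex \<Rightarrow> complex) \<Rightarrow> (complex \<Rightarrow> complex) \<Rightarrow>
     complex \<Rightarrow> (complex \<Rightarrow> complex) \<Rightarrow> (complex \<Rightarrow> complex) \<Rightarrow> bool" where
  "an_equiv a f g b F G \<longleftrightarrow> (\<exists>l0 l1 m0 m1 m2. l1 \<noteq> 0 \<and> m0 \<noteq> 0 \<and> b = l0 + l1 * a \<and>
     (\<forall>\<^sub>F x in nhds a. f x = m0 * F (l0 + l1 * x) + m1 + m2 * x \<and> g x = G (l0 + l1 * x)))"


section \<open>\<open>V\<^sub>f\<close> is a vector space\<close>

interpretation fps_vs: vector_space "fps_scale :: 'a::field \<Rightarrow> 'a fps \<Rightarrow> 'a fps"
  by standard (simp_all add: algebra_simps flip: fps_const_add fps_const_mult)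

lemma fps_shift_arg_add: "fps_shift_arg (g + h) = fps_shift_arg g + fps_shift_arg h"
proof -
  have "(fps_deriv ^^ n) (g + h) = (fps_deriv ^^ n) g + (fps_deriv ^^ n) h" for n
    by (induction n) auto
  then show ?thesis
    by (intro fps_ext) (simp add: fps_shift_arg_def add_divide_distrib)
qed

lemma fps_shift_arg_scale:
  "fps_shift_arg (fps_const c * g) = fps_const (fls_const c) * fps_shift_arg g"
proof -
  have "(fps_deriv ^^ n) (fps_const c * g) = fps_const c * (fps_deriv ^^ n) g" for n
    by (induction n) auto
  then show ?thesis
    by (intro fps_ext) (simp add: fps_shift_arg_def fls_times_fps_to_fls)
qed

lemma fps_Delta_add: "(fps_Delta f ^^ n) (g + h) = (fps_Delta f ^^ n) g + (fps_Delta f ^^ n) h"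
  by (induction n) (auto simp: fps_Delta_def algebra_simps)

lemma fps_Delta_scale: "(fps_Delta f ^^ n) (fps_const c * g) = fps_const c * (fps_Delta f ^^ n) g"
  by (induction n) (auto simp: fps_Delta_def algebra_simps)

lemma fps_A_add: "fps_A f (g + h) k = fps_A f g k + fps_A f h k"
  by (simp add: fps_A_def fps_shift_arg_add distrib_right fps_Delta_add distrib_left
      sum.distrib)

lemma fps_A_scale: "fps_A f (fps_const c * g) k = fls_const c * fps_A f g k"
proof -
  have "(fps_Delta f ^^ n) (fps_const (fls_const c) * fps_shift_arg g * h)
      = fps_const (fls_const c) * (fps_Delta f ^^ n) (fps_shift_arg g * h)" for n h
    by (simp only: mult.assoc fps_Delta_scale)
  then show ?thesis
    by (simp add: fps_A_def fps_shift_arg_scale sum_distrib_left del: fps_const_mult)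
qed

lemma fps_A_0: "fps_A f 0 k = 0"
  using fps_A_scale[of f 0 0 k] by simp

lemma subspace_fps_V: "fps_vs.subspace (fps_V f)"
proof (rule fps_vs.subspaceI)
  show "0 \<in> fps_V f"
    by (simp add: fps_V_def)
next
  fix g h assume "g \<in> fps_V f" "h \<in> fps_V f"
  then show "g + h \<in> fps_V f"
    by (auto simp: fps_V_def fps_admissible_def fps_A_add fps_A_0)
next
  fix c g assume "g \<in> fps_V f"
  then show "fps_const c * g \<in> fps_V f"
    by (auto simp: fps_V_def fps_admissible_def fps_A_scale fps_A_0)
qed

end

(*
  By Lagrange inversion A_k is, up to a nonzero factor, the coefficient of u^(2k) in
  g(t + u) Phi^(-k - 1/2), where Phi = 2 (f(t + u) - f(t) - f'(t) u) / (f''(t) u^2).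

  Writing A_1, A_2, A_3 in terms of a = f'' and g, the equation A_1 = 0 is a second order linear
  equation for g; modulo it, A_2 = 0 expresses the derivative of a third order differential
  polynomial nu in a through nu, and then A_3 is a nonzero multiple of nu^2.  So nu = 0, which is
  Monge's equation 9 a^2 a''' - 45 a a' a'' + 40 a'^3 = 0: the graph of f is an arc of a conic, and
  a = c z^(-3) with z^2 = y a polynomial of degree at most 2.  The equation A_1 = 0 becomes
  y g'' + (3/2) y' g' + (3/8) y'' g = 0.

  Conversely, in this situation Psi = 1/Phi is a root of Psi^2 - L Psi + gamma u^2 = 0 with L linear
  in u and gamma constant.  Let Psi' = O(u^2) be the other root and G = g(t + u) Psi^(1/2).  Then
  P_k = G Psi^k + (g(t) - G) Psi'^k satisfies P_(k+2) = L P_(k+1) - gamma u^2 P_k, P_0 is constant,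
  and the equation for g makes P_1 linear.  Hence P_k is a polynomial of degree at most k, and
  G Psi^k = P_k + O(u^(2k+1)) has no term u^(2k).

  The four cases are y constant, y linear, y with a double root, y with distinct roots.
*)

theory Submission
  imports Defs "HOL-Computational_Algebra.Fundamental_Theorem_Algebra"
begin

text \<open>The elimination is homogeneous: give \<open>\<eta>\<close> and \<open>\<rho>\<close>
  weight 1, \<open>\<kappa>\<close> weight 2, \<open>\<nu>\<close> weight 3, and let differentiation
  raise the weight by 1; the coefficient sum for A_k then has weight 2k. Since conic arcs satisfy
  every condition, all terms free of \<open>\<nu>\<close> and its derivative must cancel. So A_2
  leaves a constant combination of \<open>D \<nu>\<close>, \<open>\<nu> * \<eta>\<close> and
  \<open>\<nu> * \<rho>\<close>, an equation that nonzero functions can satisfy; A_3, where the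
  terms linear in \<open>\<nu>\<close> cancel as well, excludes them. The base point may be a zero
  of f'', so the elimination runs over Laurent series; Monge's equation then rules such zeros out.
  Hence f'' divided by its value at the base point has a cube root with constant term 1 over every
  field of characteristic 0, and admissible pairs are characterised without adjoining roots of
  constants. Such roots are needed only to reach the normal forms, which is why the classification
  passes to an algebraically closed extension.\<close>

lemma fps_deriv_funpow_nth_0: "fps_nth ((fps_deriv ^^ n) h) 0 = fact n * fps_nth h n"
  for h :: "'b::field_char_0 fps"
proof (induction n arbitrary: h)
  case (Suc n)
  have "fps_nth ((fps_deriv ^^ Suc n) h) 0 = fps_nth ((fps_deriv ^^ n) (fps_deriv h)) 0"
    by (simp only: funpow_Suc_right o_apply)
  then show ?case
    using Suc[of "fps_deriv h"] by (simp add: algebra_simps)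
qed simp

lemma fps_eqI_deriv:
  fixes g h :: "'b::field_char_0 fps"
  assumes "fps_deriv g = fps_deriv h" "fps_nth g 0 = fps_nth h 0"
  shows "g = h"
  using assms by (simp add: fps_deriv_eq_iff)

lemma fps_deriv_inverse_eq:
  fixes h :: "'b::field_char_0 fps"
  assumes "fps_nth h 0 \<noteq> 0"
  shows "fps_deriv (inverse h) = - fps_deriv h * inverse h ^ 2"
  using assms by (simp add: fps_inverse_deriv)


section \<open>The Taylor shift\<close>

lemma fps_shift_arg_nth: "fps_nth (fps_shift_arg f) n = fps_to_fls ((fps_deriv ^^ n) f) / fact n"
  by (simp add: fps_shift_arg_def)

lemma fps_shift_arg_nth_0 [simp]: "fps_nth (fps_shift_arg f) 0 = fps_to_fls f"
  by (simp add: fps_shift_arg_nth)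

lemma fps_deriv_shift_arg: "fps_deriv (fps_shift_arg f) = fps_shift_arg (fps_deriv f)"
proof (rule fps_ext)
  fix n
  have "of_nat (Suc n) * (F / fact (Suc n)) = F / fact n" for F :: "'a fls"
    by (simp only: fact_Suc of_nat_mult) (simp add: divide_simps del: of_nat_Suc)
  moreover have "fps_nth (fps_deriv (fps_shift_arg f)) n =
      of_nat (Suc n) * (fps_to_fls ((fps_deriv ^^ Suc n) f) / fact (Suc n))"
    by (simp only: fps_deriv_nth fps_shift_arg_nth Suc_eq_plus1)
  ultimately show "fps_nth (fps_deriv (fps_shift_arg f)) n = fps_nth (fps_shift_arg (fps_deriv f)) n"
    by (simp only: fps_shift_arg_nth funpow_Suc_right o_apply)
qed

lemma fps_shift_arg_0 [simp]: "fps_shift_arg 0 = 0"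
  using fps_shift_arg_scale[of 0 0] by simp

lemma fps_shift_arg_const [simp]: "fps_shift_arg (fps_const c) = fps_const (fls_const c)"
  by (rule fps_eqI_deriv) (simp_all add: fps_deriv_shift_arg)

lemma fps_shift_arg_1 [simp]: "fps_shift_arg 1 = 1"
  using fps_shift_arg_const[of 1] by simp

text \<open>Both sides agree at u = 0, and d/du acts on f(t + u) as d/dt acts on f, so the product
  rule holds on both sides. Equality of the n-th coefficients for all pairs thus gives equality of
  the next ones, without the binomial form of Leibniz's rule.\<close>

lemma fps_shift_arg_mult: "fps_shift_arg (f * g) = fps_shift_arg f * fps_shift_arg g"
proof -
  have "fps_nth (fps_shift_arg (f * g)) n = fps_nth (fps_shift_arg f * fps_shift_arg g) n" for n
  proof (induction n arbitrary: f g)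
    case (Suc n)
    let ?T = fps_shift_arg
    have "of_nat (Suc n) * fps_nth (?T (f * g)) (Suc n) = fps_nth (fps_deriv (?T (f * g))) n"
      by simp
    also have "\<dots> = fps_nth (fps_deriv (?T f * ?T g)) n"
      using Suc.IH[of f "fps_deriv g"] Suc.IH[of "fps_deriv f" g]
      by (simp add: fps_deriv_shift_arg fps_shift_arg_add)
    also have "\<dots> = of_nat (Suc n) * fps_nth (?T f * ?T g) (Suc n)"
      by (simp only: fps_deriv_nth Suc_eq_plus1)
    finally show ?case
      by (metis mult_cancel_left of_nat_neq_0)
  qed (simp add: fls_times_fps_to_fls)
  then show ?thesis by (rule fps_ext)
qed

lemma fps_shift_arg_power: "fps_shift_arg (f ^ n) = fps_shift_arg f ^ n"
  by (induction n) (simp_all add: fps_shift_arg_mult)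


section \<open>Closed form of the coefficients\<close>

text \<open>
  \<open>fps_Phi f\<close> is the expansion in \<open>u\<close> of \<open>2 (f(t + u) - f(t) - f'(t) u) / (f''(t) u\<^sup>2)\<close>, and
  \<open>fps_halfpow \<Phi> k\<close> is \<open>\<Phi>\<close> to the power \<open>- k - 1/2\<close> (when \<open>\<Phi>\<close> has constant term \<open>1\<close>).
\<close>

definition fps_Phi :: "'a::field_char_0 fps \<Rightarrow> 'a fls fps" where
  "fps_Phi f = Abs_fps (\<lambda>n. 2 * fps_to_fls ((fps_deriv ^^ (n + 2)) f) /
     (fact (n + 2) * fps_to_fls (fps_deriv (fps_deriv f))))"

definition fps_halfpow :: "'b::field_char_0 fps \<Rightarrow> nat \<Rightarrow> 'b fps" where
  "fps_halfpow \<Phi> k = fps_binomial (- of_nat k - 1/2) oo (\<Phi> - 1)"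

lemma fps_Phi_nth_0:
  assumes "fps_deriv (fps_deriv f) \<noteq> 0"
  shows "fps_nth (fps_Phi f) 0 = 1"
  using assms by (simp add: fps_Phi_def eval_nat_numeral)

lemma fps_R_eq:
  assumes "fps_deriv (fps_deriv f) \<noteq> 0"
  shows "fps_R f = fps_const (fps_to_fls (fps_deriv (fps_deriv f)) / 2) * fps_X ^ 2 * (fps_Phi f - 1)"
proof (rule fps_ext)
  fix n :: nat
  let ?a = "fps_to_fls (fps_deriv (fps_deriv f))"
  have a: "?a \<noteq> 0" using assms by simp
  have "n = 0 \<or> n = 1 \<or> n = 2 \<or> (\<exists>m. n = m + 3)"
    by presburger
  then consider "n = 0" | "n = 1" | "n = 2" | m where "n = m + 3"
    by blast
  then show "fps_nth (fps_R f) n = fps_nth (fps_const (?a / 2) * fps_X ^ 2 * (fps_Phi f - 1)) n"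
  proof cases
    case 4
    have "fps_nth (fps_R f) n = fps_nth (fps_shift_arg f) n"
      using 4 by (simp add: fps_R_def mult.assoc fps_X_power_mult_nth)
    also have "\<dots> = ?a / 2 * (2 * fps_to_fls ((fps_deriv ^^ (m + 1 + 2)) f) / (fact (m + 1 + 2) * ?a))"
      using a 4 by (simp add: fps_shift_arg_nth eval_nat_numeral)
    also have "\<dots> = fps_nth (fps_const (?a / 2) * fps_X ^ 2 * (fps_Phi f - 1)) n"
      using 4 by (simp add: mult.assoc fps_X_power_mult_nth fps_Phi_def)
    finally show ?thesis .
  qed (use assms in \<open>simp_all add: fps_R_def mult.assoc fps_X_power_mult_nth fps_shift_arg_nth
      fps_Phi_nth_0 eval_nat_numeral\<close>)
qed

lemma fps_Delta_funpow_nth_0: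
  "fps_nth ((fps_Delta f ^^ n) h) 0 =
     (- (1 / (2 * fps_to_fls (fps_deriv (fps_deriv f))))) ^ n * fact (2 * n) * fps_nth h (2 * n)"
proof -
  let ?c = "- (1 / (2 * fps_to_fls (fps_deriv (fps_deriv f))))"
  have "(fps_Delta f ^^ n) h = fps_const (?c ^ n) * (fps_deriv ^^ (2 * n)) h"
  proof (induction n)
    case (Suc n)
    have "(fps_deriv ^^ (2 * Suc n)) h = fps_deriv (fps_deriv ((fps_deriv ^^ (2 * n)) h))"
      by simp
    then show ?case
      using Suc by (simp add: fps_Delta_def mult.assoc flip: fps_const_mult del: fps_const_neg fps_const_power)
  qed simp
  then show ?thesis
    by (simp add: fps_deriv_funpow_nth_0 mult.assoc del: fps_const_neg fps_const_power)
qed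

text \<open>This turns the sum over v in A_k into a binomial series with exponent -k - 1/2. Passing
  from v to v + 1 multiplies either side by (-k - 1/2 - v) / (v + 1).\<close>

lemma gbinomial_half_fact:
  "(fact (2 * (k + v)) :: 'b::field_char_0) / (fact v * fact (k + v)) * (- 1) ^ v / 4 ^ v =
     fact (2 * k) / fact k * ((- of_nat k - 1/2) gchoose v)"
proof (induction v)
  case (Suc v)
  define x y w F :: 'b where "x = of_nat (Suc v)" and "y = of_nat (Suc (k + v))"
    and "w = 2 * of_nat k + 2 * of_nat v + 1" and "F = fact (2 * (k + v))"
  have nz: "x \<noteq> 0" "y \<noteq> 0"
    by (simp_all add: x_def y_def del: of_nat_Suc)
  have facts: "fact (2 * (k + Suc v)) = F * (2 * y * w)" "fact (Suc v) = x * fact v"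
    "fact (k + Suc v) = y * fact (k + v)"
    by (simp_all add: x_def y_def w_def F_def algebra_simps)
  have w: "- of_nat k - 1/2 - of_nat v = - w / 2"
    by (simp add: w_def field_simps)
  have "((- of_nat k - 1/2 :: 'b) gchoose Suc v) = (- of_nat k - 1/2 gchoose v) * ((- w / 2) / x)"
    unfolding w[symmetric] x_def by (simp add: gbinomial_prod_rev mult.commute)
  then have "fact (2 * k) / fact k * ((- of_nat k - 1/2 :: 'b) gchoose Suc v) =
      F / (fact v * fact (k + v)) * (- 1) ^ v / 4 ^ v * ((- w / 2) / x)"
    using Suc by (simp add: F_def)
  also have "\<dots> = fact (2 * (k + Suc v)) / (fact (Suc v) * fact (k + Suc v)) * (- 1) ^ Suc v / 4 ^ Suc v"
    unfolding facts using nz by (simp add: field_simps)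
  finally show ?case by simp
qed simp

text \<open>The power \<open>\<Phi> ^ v\<close> starts at degree v, so cutting the composition off
  at v = n loses nothing at degree n. This accounts for the upper limit 2k in A_k.\<close>

lemma fps_mult_compose_nth:
  fixes g h \<Phi> :: "'b::field_char_0 fps"
  assumes "fps_nth \<Phi> 0 = 0"
  shows "fps_nth (g * (h oo \<Phi>)) n = (\<Sum>v\<le>n. fps_nth h v * fps_nth (g * \<Phi> ^ v) n)"
proof -
  have *: "fps_nth (h oo \<Phi>) i = (\<Sum>v\<le>n. fps_nth h v * fps_nth (\<Phi> ^ v) i)" if "i \<le> n" for i
  proof -
    have "(\<Sum>v=0..i. fps_nth h v * fps_nth (\<Phi> ^ v) i) = (\<Sum>v\<le>n. fps_nth h v * fps_nth (\<Phi> ^ v) i)"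
      using that assms by (intro sum.mono_neutral_left) (auto simp: startsby_zero_power_prefix)
    then show ?thesis by (simp add: fps_compose_nth)
  qed
  have "fps_nth (g * (h oo \<Phi>)) n =
      (\<Sum>i=0..n. fps_nth g i * (\<Sum>v\<le>n. fps_nth h v * fps_nth (\<Phi> ^ v) (n - i)))"
    by (simp add: fps_mult_nth *)
  also have "\<dots> = (\<Sum>v\<le>n. fps_nth h v * fps_nth (g * \<Phi> ^ v) n)"
    by (simp add: fps_mult_nth sum_distrib_left sum.swap[of _ _ "{..n}"] mult_ac)
  finally show ?thesis .
qed

text \<open>The powers of f'' that depend on v cancel between Delta^(k + v) and R^v and leave
  (-1/4)^v, while the factor u^(2v) of R^v lowers the index of the extracted coefficient from 2(k +
  v) to 2k.\<close>

lemma fps_A_eq: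
  assumes "fps_deriv (fps_deriv f) \<noteq> 0"
  shows "fps_A f g k = (- (1 / (2 * fps_to_fls (fps_deriv (fps_deriv f))))) ^ k * (fact (2 * k) / fact k) *
    fps_nth (fps_shift_arg g * fps_halfpow (fps_Phi f) k) (2 * k)"
proof -
  let ?a = "fps_to_fls (fps_deriv (fps_deriv f))" and ?\<Phi> = "fps_Phi f - 1" and ?g = "fps_shift_arg g"
  let ?c = "- (1 / (2 * ?a))"
  have a: "?a \<noteq> 0" using assms by simp
  have "1 / (fact v * fact (k + v)) * fps_nth ((fps_Delta f ^^ (k + v)) (?g * fps_R f ^ v)) 0 =
      ?c ^ k * (fact (2 * k) / fact k) *
      (((- of_nat k - 1/2) gchoose v) * fps_nth (?g * ?\<Phi> ^ v) (2 * k))" for v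
  proof -
    have R: "?g * fps_R f ^ v = fps_const ((?a / 2) ^ v) * (fps_X ^ (2 * v) * (?g * ?\<Phi> ^ v))"
      unfolding fps_R_eq[OF assms] by (simp add: power_mult_distrib mult_ac flip: power_mult)
    have coeff: "fps_nth (?g * fps_R f ^ v) (2 * (k + v)) = (?a / 2) ^ v * fps_nth (?g * ?\<Phi> ^ v) (2 * k)"
      unfolding R by (simp only: fps_mult_left_const_nth fps_X_power_mult_nth) simp
    have const: "?c ^ (k + v) * (?a / 2) ^ v = ?c ^ k * ((- 1) ^ v / 4 ^ v)"
    proof -
      have "?c * (?a / 2) = (- 1) / 4" using a by simp
      then have "?c ^ v * (?a / 2) ^ v = (- 1) ^ v / 4 ^ v"
        by (metis power_divide power_mult_distrib)
      then show ?thesis by (simp add: power_add mult.assoc)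
    qed
    have "1 / (fact v * fact (k + v)) * fps_nth ((fps_Delta f ^^ (k + v)) (?g * fps_R f ^ v)) 0
       = (?c ^ (k + v) * (?a / 2) ^ v) * (fact (2 * (k + v)) / (fact v * fact (k + v))) *
         fps_nth (?g * ?\<Phi> ^ v) (2 * k)"
      unfolding fps_Delta_funpow_nth_0 coeff by simp
    also have "\<dots> = ?c ^ k * (fact (2 * (k + v)) / (fact v * fact (k + v)) * (- 1) ^ v / 4 ^ v) *
         fps_nth (?g * ?\<Phi> ^ v) (2 * k)"
      unfolding const by (simp add: field_simps)
    finally have "1 / (fact v * fact (k + v)) * fps_nth ((fps_Delta f ^^ (k + v)) (?g * fps_R f ^ v)) 0
       = ?c ^ k * (fact (2 * (k + v)) / (fact v * fact (k + v)) * (- 1) ^ v / 4 ^ v) *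
         fps_nth (?g * ?\<Phi> ^ v) (2 * k)" .
    then show ?thesis
      unfolding gbinomial_half_fact by (simp add: mult.assoc)
  qed
  then have "fps_A f g k = ?c ^ k * (fact (2 * k) / fact k) *
      (\<Sum>v\<le>2 * k. ((- of_nat k - 1/2) gchoose v) * fps_nth (?g * ?\<Phi> ^ v) (2 * k))"
    by (simp only: fps_A_def sum_distrib_left)
  then show ?thesis
    using fps_mult_compose_nth[of ?\<Phi> ?g "fps_binomial (- of_nat k - 1/2)" "2 * k"]
    by (simp add: fps_halfpow_def fps_Phi_nth_0[OF assms])
qed

lemma fps_A_eq_0_iff:
  assumes "fps_deriv (fps_deriv f) \<noteq> 0"
  shows "fps_A f g k = 0 \<longleftrightarrow> fps_nth (fps_shift_arg g * fps_halfpow (fps_Phi f) k) (2 * k) = 0"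
  using assms by (simp add: fps_A_eq[OF assms])

section \<open>Necessity of Monge's equation\<close>

text \<open>These are the coefficients of the differential equation \<open>\<Phi>\<close>
  \<open>\<Theta>\<close>' = c \<open>\<Phi>\<close>' \<open>\<Theta>\<close> of the power
  \<open>\<Theta>\<close> = \<open>\<Phi>\<close>^c with c = -k - 1/2. The recurrence yields
  explicit coefficients without expanding powers of \<open>\<Phi>\<close> - 1.\<close>

lemma fps_halfpow_recurrence:
  fixes \<Phi> :: "'b::field_char_0 fps" and k :: nat
  assumes "fps_nth \<Phi> 0 = 1"
  defines "\<theta> \<equiv> fps_nth (fps_halfpow \<Phi> k)"
  shows "of_nat (Suc m) * \<theta> (Suc m) = (\<Sum>i\<le>m. ((- of_nat k - 1/2) * of_nat (Suc i) - of_nat (m - i)) * fps_nth \<Phi> (Suc i) * \<theta> (m - i))"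
proof -
  define c :: 'b where "c = - of_nat k - 1/2"
  let ?\<Theta> = "fps_halfpow \<Phi> k"
  have nz: "1 + fps_X \<noteq> (0 :: 'b fps)"
    by (metis add_cancel_left_right fps_X_nth fps_add_nth fps_one_nth fps_zero_nth one_neq_zero zero_neq_one)
  have "(1 + fps_X) * fps_deriv (fps_binomial c) = fps_const c * fps_binomial c"
  proof -
    have "(1 + fps_X :: 'b fps) dvd 1"
      by (simp add: fps_is_unit_iff)
    then have "(1 + fps_X :: 'b fps) dvd fps_const c * fps_binomial c"
      by (meson dvd_trans one_dvd)
    then show ?thesis
      by (simp add: fps_binomial_deriv)
  qed
  from arg_cong[OF this, of "\<lambda>h. (h oo (\<Phi> - 1)) * fps_deriv \<Phi>"]
  have "\<Phi> * fps_deriv ?\<Theta> = fps_const c * ?\<Theta> * fps_deriv \<Phi>"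
    using assms(1)
    by (simp add: fps_halfpow_def c_def fps_compose_mult_distrib fps_compose_add_distrib fps_compose_deriv mult.assoc)
  \<comment> \<open>The operator X d/dX multiplies the n-th coefficient by n and keeps its degree,
    so both sides become plain convolutions.\<close>
  then have "\<Phi> * (fps_X * fps_deriv ?\<Theta>) = fps_const c * ((fps_X * fps_deriv \<Phi>) * ?\<Theta>)"
    by (simp add: mult_ac)
  then have "fps_nth (\<Phi> * (fps_X * fps_deriv ?\<Theta>)) (Suc m) = c * fps_nth ((fps_X * fps_deriv \<Phi>) * ?\<Theta>) (Suc m)"
    by (simp only: fps_mult_left_const_nth)
  then have "(\<Sum>i\<le>Suc m. fps_nth \<Phi> i * (of_nat (Suc m - i) * \<theta> (Suc m - i))) =
     c * (\<Sum>i\<le>Suc m. of_nat i * fps_nth \<Phi> i * \<theta> (Suc m - i))"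
    by (simp only: fps_mult_fps_X_deriv_shift fps_mult_nth fps_nth_Abs_fps atLeast0AtMost \<theta>_def)
  then have "of_nat (Suc m) * \<theta> (Suc m) + (\<Sum>i\<le>m. fps_nth \<Phi> (Suc i) * (of_nat (m - i) * \<theta> (m - i))) =
     c * (\<Sum>i\<le>m. of_nat (Suc i) * fps_nth \<Phi> (Suc i) * \<theta> (m - i))"
    using assms(1) by (simp add: sum.atMost_Suc_shift of_nat_diff del: sum.atMost_Suc of_nat_Suc) simp
  then have "of_nat (Suc m) * \<theta> (Suc m) = c * (\<Sum>i\<le>m. of_nat (Suc i) * fps_nth \<Phi> (Suc i) * \<theta> (m - i))
     - (\<Sum>i\<le>m. fps_nth \<Phi> (Suc i) * (of_nat (m - i) * \<theta> (m - i)))"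
    by (simp only: eq_diff_eq)
  also have "\<dots> = (\<Sum>i\<le>m. (c * of_nat (Suc i) - of_nat (m - i)) * fps_nth \<Phi> (Suc i) * \<theta> (m - i))"
    unfolding sum_distrib_left sum_subtractf[symmetric]
    by (intro sum.cong refl) (simp add: algebra_simps del: of_nat_Suc)
  finally show ?thesis
    by (simp only: c_def)
qed

text \<open>For p = y'/y this is the n-th derivative of y divided by y, a complete Bell polynomial
  in p and its derivatives. Such quotients let f'' and g enter only through their logarithmic
  derivatives.\<close>

primrec logjet :: "'a::field_char_0 fls \<Rightarrow> nat \<Rightarrow> 'a fls" where
  "logjet p 0 = 1"
| "logjet p (Suc n) = fls_deriv (logjet p n) + p * logjet p n"

lemma funpow_fls_deriv_logjet:
  assumes "fls_deriv y = p * y"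
  shows "(fls_deriv ^^ n) y = logjet p n * y"
  by (induction n) (simp_all add: assms algebra_simps)

lemma fls_deriv_funpow_fps_to_fls: "(fls_deriv ^^ n) (fps_to_fls h) = fps_to_fls ((fps_deriv ^^ n) h)"
  by (induction n) (simp_all add: fls_deriv_fps_to_fls)

text \<open>
  In terms of \<open>z\<close> with \<open>f'' = z\<^sup>-\<^sup>3\<close>, the quantities below are \<open>\<eta> = z' / (2 z)\<close>, \<open>\<kappa> = z'' / (4 z)\<close>,
  \<open>\<nu> = (z\<^sup>3 z'')' / (4 z\<^sup>4)\<close>, and \<open>\<rho>\<close> is the logarithmic derivative of \<open>g\<close> times the square root of \<open>z\<close>.
  They are scaled so that \<open>e n = f\<^sup>(\<^sup>n\<^sup>+\<^sup>2\<^sup>) / f''\<close> and \<open>h n = g\<^sup>(\<^sup>n\<^sup>) / g\<close> have integer coefficients. The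
  relations \<open>A\<^sub>1 = 0\<close> and \<open>A\<^sub>2 = 0\<close> give the derivatives of \<open>\<rho>\<close> and \<open>\<nu>\<close>, after which polynomials in
  \<open>\<eta>, \<kappa>, \<nu>, \<rho>\<close> are closed under differentiation. The suffix \<open>raw\<close> marks formulas in which the
  derivative of \<open>\<nu>\<close> has not yet been eliminated.
\<close>

locale stationary_pair =
  fixes f g :: "'a::field_char_0 fps"
  assumes f: "fps_deriv (fps_deriv f) \<noteq> 0" and g: "g \<noteq> 0"
    and A1: "fps_A f g 1 = 0" and A2: "fps_A f g 2 = 0" and A3: "fps_A f g 3 = 0"
begin

abbreviation D where "D \<equiv> fls_deriv"
abbreviation a where "a \<equiv> fps_to_fls (fps_deriv (fps_deriv f))"
definition \<eta> where "\<eta> = - D a / (6 * a)"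
definition \<kappa> where "\<kappa> = (D \<eta> + 2 * \<eta> ^ 2) / 2"
definition \<nu> where "\<nu> = D \<kappa> + 8 * \<eta> * \<kappa>"
definition \<rho> where "\<rho> = D (fps_to_fls g) / fps_to_fls g + \<eta>"
definition e where "e = logjet (- 6 * \<eta>)"
definition h where "h = logjet (\<rho> - \<eta>)"
definition \<phi> where "\<phi> = fps_nth (fps_Phi f)"
definition \<theta> where "\<theta> k = fps_nth (fps_halfpow (fps_Phi f) k)"

lemma a_nz: "a \<noteq> 0"
  using f by simp

lemma D_a: "D a = (- 6 * \<eta>) * a"
  using a_nz by (simp add: \<eta>_def)

lemma D_\<eta>: "D \<eta> = 2 * \<kappa> - 2 * \<eta> ^ 2"
  by (simp add: \<kappa>_def field_simps)

lemma D_\<kappa>: "D \<kappa> = \<nu> - 8 * \<eta> * \<kappa>"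
  by (simp add: \<nu>_def)

lemma \<phi>_eq: "\<phi> n = 2 / fact (n + 2) * e n"
proof -
  have "(fps_deriv ^^ (n + 2)) f = (fps_deriv ^^ n) (fps_deriv (fps_deriv f))"
    by (induction n) simp_all
  then have "fps_to_fls ((fps_deriv ^^ (n + 2)) f) = (D ^^ n) a"
    by (simp only: fls_deriv_funpow_fps_to_fls)
  also have "\<dots> = e n * a"
    unfolding e_def by (rule funpow_fls_deriv_logjet) (rule D_a)
  finally show ?thesis
    using a_nz by (simp add: \<phi>_def fps_Phi_def)
qed

lemma g_nth: "fps_nth (fps_shift_arg g) n = h n / fact n * fps_to_fls g"
proof -
  have "D (fps_to_fls g) = (\<rho> - \<eta>) * fps_to_fls g"
    using g by (simp add: \<rho>_def)
  then have "(D ^^ n) (fps_to_fls g) = h n * fps_to_fls g"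
    unfolding h_def by (rule funpow_fls_deriv_logjet)
  then show ?thesis
    by (simp add: fps_shift_arg_nth fls_deriv_funpow_fps_to_fls)
qed

lemma \<theta>_0: "\<theta> k 0 = 1"
  by (simp add: \<theta>_def fps_halfpow_def)

lemma \<theta>_rec: "0 < n \<Longrightarrow> \<theta> k n =
    (\<Sum>i\<le>n - 1. ((- of_nat k - 1/2) * of_nat (Suc i) - of_nat (n - 1 - i)) * \<phi> (Suc i) * \<theta> k (n - 1 - i)) / of_nat n"
  using fps_halfpow_recurrence[OF fps_Phi_nth_0[OF f], of "n - 1" k]
  by (simp add: \<theta>_def \<phi>_def eq_divide_eq mult.commute del: of_nat_Suc)

lemma A_imp:
  assumes "fps_A f g k = 0"
  shows "(\<Sum>i\<le>2*k. h i / fact i * \<theta> k (2 * k - i)) = 0"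
proof -
  have "fps_nth (fps_shift_arg g * fps_halfpow (fps_Phi f) k) (2 * k) = fps_to_fls g * (\<Sum>i\<le>2*k. h i / fact i * \<theta> k (2 * k - i))"
    by (simp add: fps_mult_nth g_nth \<theta>_def sum_distrib_left atLeast0AtMost mult_ac)
  then show ?thesis
    using assms g by (simp add: fps_A_eq_0_iff[OF f])
qed

lemma e_rec: "0 < n \<Longrightarrow> e n = D (e (n - 1)) - 6 * \<eta> * e (n - 1)"
  by (cases n) (simp_all add: e_def)

lemma h_rec: "0 < n \<Longrightarrow> h n = D (h (n - 1)) + (\<rho> - \<eta>) * h (n - 1)"
  by (cases n) (simp_all add: h_def)

lemma e_0: "e 0 = 1" and h_0: "h 0 = 1"
  by (simp_all add: e_def h_def)

lemmas D_rules = fls_deriv_power D_\<eta> D_\<kappa>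
lemmas sum_rules = atMost_nat_numeral fact_numeral numeral_2_eq_2[symmetric]

section \<open>Explicit coefficients for the conditions A_1 = A_2 = A_3 = 0\<close>

lemma e_1: "e (Suc 0) = - 6 * \<eta>"
  by (subst e_rec; (simp add: e_0 D_rules; algebra))

lemma e_2: "e 2 = 48 * \<eta> ^ 2 - 12 * \<kappa>"
  by (subst e_rec; (simp add: e_1 D_rules; algebra))

lemma e_3: "e 3 = - 480 * \<eta> ^ 3 + 360 * \<eta> * \<kappa> - 12 * \<nu>"
  by (subst e_rec; (simp add: e_2 D_rules; algebra))

lemma \<theta>_1_1: "\<theta> (Suc 0) (Suc 0) = 3 * \<eta>"
  by (subst \<theta>_rec; (simp add: \<theta>_0  \<phi>_eq e_1 sum_rules; algebra))

lemma \<theta>_1_2: "\<theta> (Suc 0) 2 = 3 / 2 * \<eta> ^ 2 + 3 / 2 * \<kappa>"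
  by (subst \<theta>_rec; (simp add: \<theta>_0 \<theta>_1_1 \<phi>_eq e_1 e_2 sum_rules; algebra))

lemma h_1: "h (Suc 0) = \<rho> - \<eta>"
  by (subst h_rec) (simp_all add: h_0)

text \<open>A_1 = 0 is linear of second order in g, hence a Riccati equation for the logarithmic
  derivative \<open>\<rho>\<close>. It makes \<open>D \<rho>\<close> a polynomial again, so all
  later \<open>h n\<close> are free of derivatives of \<open>\<rho>\<close>.\<close>

lemma D_\<rho>: "D \<rho> = - \<kappa> - \<rho> ^ 2 - 4 * \<eta> * \<rho>"
proof -
  have h2: "h 2 = D \<rho> - D \<eta> + (\<rho> - \<eta>) ^ 2"
    by (subst h_rec) (simp_all add: h_1 power2_eq_square)
  have "(\<Sum>i\<le>2*1. h i / fact i * \<theta> 1 (2 * 1 - i)) = (D \<rho> - (- \<kappa> - \<rho> ^ 2 - 4 * \<eta> * \<rho>)) / 2"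
    by (simp add: h_0 h_1 h2 \<theta>_0 \<theta>_1_1 \<theta>_1_2 D_rules sum_rules; algebra)
  then show ?thesis
    using A_imp[OF A1] by simp
qed

lemma h_2: "h 2 = 3 * \<eta> ^ 2 - 6 * \<eta> * \<rho> - 3 * \<kappa>"
  by (subst h_rec; (simp add: h_1 D_rules D_\<rho>; algebra))

lemma h_3: "h 3 = - 15 * \<eta> ^ 3 + 45 * \<eta> ^ 2 * \<rho> + 45 * \<eta> * \<kappa> - 15 * \<kappa> * \<rho> - 3 * \<nu>"
  by (subst h_rec; (simp add: h_2 D_rules D_\<rho>; algebra))

lemma h_4_raw: "h 4 = 105 * \<eta> ^ 4 - 420 * \<eta> ^ 3 * \<rho> - 630 * \<eta> ^ 2 * \<kappa> + 420 * \<eta> * \<kappa> * \<rho> + 48 * \<eta> * \<nu> + 105 * \<kappa> ^ 2 - 18 * \<nu> * \<rho> - 3 * D \<nu>"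
  by (subst h_rec; (simp add: h_3 D_rules D_\<rho>; algebra))

lemma e_4_raw: "e 4 = 5760 * \<eta> ^ 4 - 8640 * \<eta> ^ 2 * \<kappa> + 432 * \<eta> * \<nu> + 720 * \<kappa> ^ 2 - 12 * D \<nu>"
  by (subst e_rec; (simp add: e_3 D_rules; algebra))

lemma \<theta>_2_1: "\<theta> 2 (Suc 0) = 5 * \<eta>"
  by (subst \<theta>_rec; (simp add: \<theta>_0  \<phi>_eq e_1 sum_rules; algebra))

lemma \<theta>_2_2: "\<theta> 2 2 = 15 / 2 * \<eta> ^ 2 + 5 / 2 * \<kappa>"
  by (subst \<theta>_rec; (simp add: \<theta>_0 \<theta>_2_1 \<phi>_eq e_1 e_2 sum_rules; algebra))

lemma \<theta>_2_3: "\<theta> 2 3 = 5 / 2 * \<eta> ^ 3 + 5 / 2 * \<eta> * \<kappa> + 1 / 2 * \<nu>"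
  by (subst \<theta>_rec; (simp add: \<theta>_0 \<theta>_2_1 \<theta>_2_2 \<phi>_eq e_1 e_2 e_3 sum_rules; algebra))

lemma \<theta>_2_4_raw: "\<theta> 2 4 = - 5 / 8 * \<eta> ^ 4 - 5 / 4 * \<eta> ^ 2 * \<kappa> + 1 / 2 * \<eta> * \<nu> - 5 / 8 * \<kappa> ^ 2 + 1 / 12 * D \<nu>"
  by (subst \<theta>_rec; (simp add: \<theta>_0 \<theta>_2_1 \<theta>_2_2 \<theta>_2_3 \<phi>_eq e_1 e_2 e_3 e_4_raw sum_rules; simp add: field_simps power2_eq_square power3_eq_cube power4_eq_xxxx))

lemma D_\<nu>: "D \<nu> = - (6 * \<nu> * (\<rho> + 2 * \<eta>))"
proof -
  \<comment> \<open>The factor -1/24 is the coefficient of \<open>D \<nu>\<close>: 1/12 from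
    \<open>\<theta> 2 4\<close> and -3/24 from \<open>h 4 / fact 4\<close>.\<close>
  have "(\<Sum>i\<le>2*2. h i / fact i * \<theta> 2 (2 * 2 - i)) = (D \<nu> + 6 * \<nu> * (\<rho> + 2 * \<eta>)) * (- 1 / 24)"
    by (simp add: h_0 h_1 h_2 h_3 h_4_raw \<theta>_0 \<theta>_2_1 \<theta>_2_2 \<theta>_2_3 \<theta>_2_4_raw sum_rules; simp add: field_simps power2_eq_square power3_eq_cube power4_eq_xxxx)
  from trans[OF this[symmetric] A_imp[OF A2]]
  have "D \<nu> + 6 * \<nu> * (\<rho> + 2 * \<eta>) = 0 \<or> - 1 / 24 = (0 :: 'a fls)"
    by (simp only: mult_eq_0_iff)
  moreover have "- 1 / 24 \<noteq> (0 :: 'a fls)"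
    by simp
  ultimately have "D \<nu> + 6 * \<nu> * (\<rho> + 2 * \<eta>) = 0"
    by blast
  then show ?thesis
    by (simp only: eq_neg_iff_add_eq_0)
qed

lemma e_4: "e 4 = 5760 * \<eta> ^ 4 - 8640 * \<eta> ^ 2 * \<kappa> + 576 * \<eta> * \<nu> + 720 * \<kappa> ^ 2 + 72 * \<nu> * \<rho>"
  unfolding e_4_raw D_\<nu> by algebra

lemma h_4: "h 4 = 105 * \<eta> ^ 4 - 420 * \<eta> ^ 3 * \<rho> - 630 * \<eta> ^ 2 * \<kappa> + 420 * \<eta> * \<kappa> * \<rho> + 84 * \<eta> * \<nu> + 105 * \<kappa> ^ 2"
  unfolding h_4_raw D_\<nu> by algebra

lemma e_5: "e 5 = - 80640 * \<eta> ^ 5 + 201600 * \<eta> ^ 3 * \<kappa> - 20160 * \<eta> ^ 2 * \<nu> - 50400 * \<eta> * \<kappa> ^ 2 - 5040 * \<eta> * \<nu> * \<rho> + 2520 * \<kappa> * \<nu> - 504 * \<nu> * \<rho> ^ 2"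
  by (subst e_rec; (simp add: e_4 D_rules D_\<nu> D_\<rho>; algebra))

lemma e_6: "e 6 = 1290240 * \<eta> ^ 6 - 4838400 * \<eta> ^ 4 * \<kappa> + 645120 * \<eta> ^ 3 * \<nu> + 2419200 * \<eta> ^ 2 * \<kappa> ^ 2 + 241920 * \<eta> ^ 2 * \<nu> * \<rho> - 241920 * \<eta> * \<kappa> * \<nu> + 48384 * \<eta> * \<nu> * \<rho> ^ 2 - 100800 * \<kappa> ^ 3 - 24192 * \<kappa> * \<nu> * \<rho> + 2520 * \<nu> ^ 2 + 4032 * \<nu> * \<rho> ^ 3"
  by (subst e_rec; (simp add: e_5 D_rules D_\<nu> D_\<rho>; algebra))

lemma h_5: "h 5 = - 945 * \<eta> ^ 5 + 4725 * \<eta> ^ 4 * \<rho> + 9450 * \<eta> ^ 3 * \<kappa> - 9450 * \<eta> ^ 2 * \<kappa> * \<rho> - 1890 * \<eta> ^ 2 * \<nu> - 4725 * \<eta> * \<kappa> ^ 2 + 945 * \<kappa> ^ 2 * \<rho> + 378 * \<kappa> * \<nu>"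
  by (subst h_rec; (simp add: h_4 D_rules D_\<nu> D_\<rho>; algebra))

lemma h_6: "h 6 = 10395 * \<eta> ^ 6 - 62370 * \<eta> ^ 5 * \<rho> - 155925 * \<eta> ^ 4 * \<kappa> + 207900 * \<eta> ^ 3 * \<kappa> * \<rho> + 41580 * \<eta> ^ 3 * \<nu> + 155925 * \<eta> ^ 2 * \<kappa> ^ 2 - 62370 * \<eta> * \<kappa> ^ 2 * \<rho> - 24948 * \<eta> * \<kappa> * \<nu> - 10395 * \<kappa> ^ 3 + 378 * \<nu> ^ 2"
  by (subst h_rec; (simp add: h_5 D_rules D_\<nu> D_\<rho>; algebra))

lemma \<theta>_3_1: "\<theta> 3 (Suc 0) = 7 * \<eta>"
  by (subst \<theta>_rec; (simp add: \<theta>_0  \<phi>_eq e_1 sum_rules; algebra))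

lemma \<theta>_3_2: "\<theta> 3 2 = 35 / 2 * \<eta> ^ 2 + 7 / 2 * \<kappa>"
  by (subst \<theta>_rec; (simp add: \<theta>_0 \<theta>_3_1 \<phi>_eq e_1 e_2 sum_rules; algebra))

lemma \<theta>_3_3: "\<theta> 3 3 = 35 / 2 * \<eta> ^ 3 + 21 / 2 * \<eta> * \<kappa> + 7 / 10 * \<nu>"
  by (subst \<theta>_rec; (simp add: \<theta>_0 \<theta>_3_1 \<theta>_3_2 \<phi>_eq e_1 e_2 e_3 sum_rules; algebra))

lemma \<theta>_3_4: "\<theta> 3 4 = 35 / 8 * \<eta> ^ 4 + 21 / 4 * \<eta> ^ 2 * \<kappa> + 7 / 10 * \<eta> * \<nu> + 7 / 8 * \<kappa> ^ 2 - 7 / 10 * \<nu> * \<rho>"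
  by (subst \<theta>_rec; (simp add: \<theta>_0 \<theta>_3_1 \<theta>_3_2 \<theta>_3_3 \<phi>_eq e_1 e_2 e_3 e_4 sum_rules; algebra))

lemma \<theta>_3_5: "\<theta> 3 5 = - 7 / 8 * \<eta> ^ 5 - 7 / 4 * \<eta> ^ 3 * \<kappa> - 7 / 20 * \<eta> ^ 2 * \<nu> - 7 / 8 * \<eta> * \<kappa> ^ 2 + 7 / 10 * \<eta> * \<nu> * \<rho> - 7 / 20 * \<kappa> * \<nu> + 7 / 10 * \<nu> * \<rho> ^ 2"
  by (subst \<theta>_rec; (simp add: \<theta>_0 \<theta>_3_1 \<theta>_3_2 \<theta>_3_3 \<theta>_3_4 \<phi>_eq e_1 e_2 e_3 e_4 e_5 sum_rules; algebra))

lemma \<theta>_3_6: "\<theta> 3 6 = 7 / 16 * \<eta> ^ 6 + 21 / 16 * \<eta> ^ 4 * \<kappa> + 7 / 20 * \<eta> ^ 3 * \<nu> + 21 / 16 * \<eta> ^ 2 * \<kappa> ^ 2 - 21 / 20 * \<eta> ^ 2 * \<nu> * \<rho> + 21 / 20 * \<eta> * \<kappa> * \<nu> - 21 / 10 * \<eta> * \<nu> * \<rho> ^ 2 + 7 / 16 * \<kappa> ^ 3 + 21 / 20 * \<kappa> * \<nu> * \<rho> - 49 / 400 * \<nu> ^ 2 - 7 / 10 * \<nu> * \<rho> ^ 3"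
  by (subst \<theta>_rec; (simp add: \<theta>_0 \<theta>_3_1 \<theta>_3_2 \<theta>_3_3 \<theta>_3_4 \<theta>_3_5 \<phi>_eq e_1 e_2 e_3 e_4 e_5 e_6 sum_rules; algebra))

text \<open>Once \<open>D_\<nu>\<close> has been used, the terms linear in \<open>\<nu>\<close>
  cancel too. What A_3 leaves is a nonzero multiple of a square in a field. Equivalently z^3 z'' is
  constant for f'' = z^(-3).\<close>

theorem \<nu>_eq_0: "\<nu> = 0"
proof -
  have "(\<Sum>i\<le>2*3. h i / fact i * \<theta> 3 (2 * 3 - i)) = 21 / 400 * \<nu> ^ 2"
    by (simp add: h_0 h_1 h_2 h_3 h_4 h_5 h_6 \<theta>_0 \<theta>_3_1 \<theta>_3_2 \<theta>_3_3 \<theta>_3_4 \<theta>_3_5 \<theta>_3_6 sum_rules; algebra)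
  then show ?thesis
    using A_imp[OF A3] by simp
qed

end

section \<open>Half-integer powers of a series with constant term 1\<close>

lemma fps_binomial_compose_power:
  fixes h :: "'b::field_char_0 fps"
  assumes "fps_nth h 0 = 0"
  shows "(fps_binomial c oo h) ^ n = fps_binomial (of_nat n * c) oo h"
  using fps_compose_power[OF assms, of "fps_binomial c" n] by (simp add: fps_binomial_power)

lemma fps_binomial_minus_one_compose:
  fixes h :: "'b::field_char_0 fps"
  assumes "fps_nth h 0 = 1"
  shows "fps_binomial (- 1) oo (h - 1) = inverse h"
  using assms
  by (simp add: fps_binomial_minus_one fps_inverse_compose fps_compose_add_distrib)

lemma fps_halfpow_nth_0: "fps_nth (fps_halfpow h k) 0 = 1"
  by (simp add: fps_halfpow_def)

lemma fps_halfpow_0_square: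
  assumes "fps_nth h 0 = 1"
  shows "fps_halfpow h 0 ^ 2 = inverse h"
  using assms by (simp add: fps_halfpow_def fps_binomial_compose_power fps_binomial_minus_one_compose)

lemma fps_halfpow_eq:
  assumes "fps_nth h 0 = 1"
  shows "fps_halfpow h k = fps_halfpow h 0 * inverse h ^ k"
proof -
  have "fps_binomial (- of_nat k - 1/2 :: 'a) = fps_binomial (- 1/2) * fps_binomial (- 1) ^ k"
  proof -
    have "- of_nat k - 1/2 = (- 1/2 :: 'a) + of_nat k * (- 1)" by simp
    then show ?thesis by (simp only: fps_binomial_add_mult fps_binomial_power)
  qed
  then show ?thesis
    using assms fps_binomial_minus_one_compose[OF assms]
    by (simp add: fps_halfpow_def fps_compose_mult_distrib fps_compose_power[symmetric])
qed


section \<open>Solutions with quadratic \<open>f'' powr (- 2/3)\<close>\<close>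

text \<open>
  In the application \<open>r = z(t)\<close>, \<open>s = z(t + u)\<close>, \<open>y1 = y'(t)\<close>, \<open>y2 = y''/2\<close>, and \<open>\<Psi> = 1/\<Phi>\<close>. The identity
  \<open>s \<Psi>' = E \<Psi>\<close> with \<open>E = (s - r)/u\<close> replaces the explicit square root in most computations.
\<close>

locale conic_arc =
  fixes r y1 y2 :: "'b::field_char_0" and s :: "'b fps"
  assumes r: "r \<noteq> 0" and s0: "fps_nth s 0 = r"
    and s2: "s ^ 2 = fps_const (r ^ 2) + fps_const y1 * fps_X + fps_const y2 * fps_X ^ 2"
begin

abbreviation D where "D \<equiv> fps_deriv"

definition E where "E = fps_shift 1 (s - fps_const r)"
definition B where "B = fps_const (r ^ 2) + fps_const (y1 / 2) * fps_X"
text \<open>Put delta = r^2 y2 - y1^2/4. Since s^3 s'' = delta, integrating 2 r^3 / s^3 twice from u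
  = 0 gives u^2 \<open>\<Phi>\<close> = 2 r^2 (r s - B) / delta. As (r s - B)(r s + B) = delta u^2,
  this equals 2 r^2 u^2 / (B + r s), a form that also makes sense for delta = 0.\<close>

definition \<Psi> where "\<Psi> = fps_const (1 / (2 * r ^ 2)) * (B + fps_const r * s)"

lemma s_nz: "s \<noteq> 0"
  using s0 r by auto

lemma X_E: "s = fps_const r + fps_X * E"
proof -
  have "fps_X * E = s - fps_const r"
    using s0 by (intro fps_ext) (simp add: E_def)
  then show ?thesis by simp
qed

lemma E_quadratic: "2 * fps_const r * E + fps_X * E ^ 2 = fps_const y1 + fps_const y2 * fps_X"
proof -
  have "fps_X * (2 * fps_const r * E + fps_X * E ^ 2) = s ^ 2 - fps_const (r ^ 2)"
    by (subst X_E) (simp add: power2_eq_square algebra_simps flip: fps_const_mult)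
  also have "\<dots> = fps_X * (fps_const y1 + fps_const y2 * fps_X)"
    unfolding s2 by (simp add: power2_eq_square algebra_simps)
  finally show ?thesis
    by (metis fps_X_neq_zero mult_cancel_left)
qed

text \<open>Here r and u have disappeared, so y2 can be traded for E and its derivative in the
  computations with \<open>l\<close>.\<close>

lemma y2_eq: "fps_const y2 = 2 * s * D E + E ^ 2"
proof -
  have "2 * fps_const r * D E + E ^ 2 + 2 * fps_X * E * D E = fps_const y2"
    using arg_cong[OF E_quadratic, of D] by (simp add: power2_eq_square algebra_simps)
  then show ?thesis
    by (subst X_E) (simp add: algebra_simps power2_eq_square)
qed

lemma D_s: "2 * s * D s = fps_const y1 + 2 * fps_const y2 * fps_X"
  using arg_cong[OF s2, of D] by (simp add: power2_eq_square algebra_simps)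

lemma D_D_s: "D s ^ 2 + s * D (D s) = fps_const y2"
proof -
  have "2 * (D s ^ 2 + s * D (D s)) = 2 * fps_const y2"
    using arg_cong[OF D_s, of D] by (simp add: power2_eq_square algebra_simps)
  then show ?thesis by (simp only: mult_cancel_left) simp
qed

text \<open>The constant is minus a quarter of the discriminant of the quadratic s^2. That it does
  not depend on u expresses that s'' is a constant multiple of s^(-3).\<close>

lemma D_D_s_cube: "s ^ 3 * D (D s) = fps_const (r ^ 2 * y2 - y1 ^ 2 / 4)"
proof -
  have "4 * (s ^ 3 * D (D s)) = 4 * s ^ 2 * fps_const y2 - (2 * s * D s) ^ 2"
    unfolding D_D_s[symmetric] by (simp add: power2_eq_square power3_eq_cube algebra_simps)
  also have "\<dots> = fps_const (4 * r ^ 2 * y2 - y1 ^ 2)"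
    unfolding D_s s2 unfolding power2_eq_square fps_const_sub[symmetric] fps_const_mult[symmetric] numeral_fps_const[symmetric]
    by (simp only: algebra_simps) simp
  also have "\<dots> = 4 * fps_const (r ^ 2 * y2 - y1 ^ 2 / 4)"
    by (simp add: numeral_fps_const)
  finally show ?thesis by (simp only: mult_cancel_left) simp
qed

lemma \<Psi>_eq: "2 * fps_const (r ^ 2) * \<Psi> = B + fps_const r * s"
proof -
  have "2 * fps_const (r ^ 2) * fps_const (1 / (2 * r ^ 2)) = (1 :: 'b fps)"
    using r by (simp add: numeral_fps_const)
  then show ?thesis
    unfolding \<Psi>_def mult.assoc[symmetric] by simp
qed

lemma \<Psi>0: "fps_nth \<Psi> 0 = 1"
  using r by (simp add: \<Psi>_def B_def s0 power2_eq_square field_simps)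

lemma D_\<Psi>: "s * D \<Psi> = E * \<Psi>"
proof -
  have D\<Psi>: "2 * fps_const (r ^ 2) * D \<Psi> = fps_const (y1 / 2) + fps_const r * D s"
    using arg_cong[OF \<Psi>_eq, of D] by (simp add: B_def)
  have y: "fps_const y1 = 2 * fps_const (y1 / 2)"
    by (simp add: numeral_fps_const)
  have r2: "fps_const (r ^ 2) = fps_const r ^ 2"
    by simp
  \<comment> \<open>The factor X turns E into s - r, after which everything reduces by the equation
    for s^2.\<close>
  have "2 * fps_X * (s * (2 * fps_const (r ^ 2) * D \<Psi>)) = 2 * fps_X * (E * (2 * fps_const (r ^ 2) * \<Psi>))"
    unfolding D\<Psi> \<Psi>_eq B_def using X_E D_s s2 y unfolding r2 by algebra
  then show ?thesis
    using r by simp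
qed

text \<open>The series u^2 \<open>\<Phi>\<close> vanishes to order two at u = 0, so its second
  derivative determines it. Verifying the differential equation for u^2 / \<open>\<Psi>\<close>,
  instead of dividing by the discriminant, covers constant s and a double root at the same
  time.\<close>

lemma \<Phi>_unique:
  assumes "s ^ 3 * D (D (fps_X ^ 2 * \<Phi>)) = 2 * fps_const r ^ 3"
  shows "\<Phi> = inverse \<Psi>"
proof -
  define \<Phi>' where "\<Phi>' = inverse \<Psi>"
  define V where "V = fps_X ^ 2 * \<Phi>'"
  define U where "U = fps_X * \<Phi>' * (s + fps_const r)"
  have inv: "\<Phi>' * \<Psi> = 1"
    unfolding \<Phi>'_def by (rule inverse_mult_eq_1) (simp add: \<Psi>0)
  have XE: "fps_X * E = s - fps_const r"
    by (metis X_E add_diff_cancel_left')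
  have "s * D \<Phi>' = - (s * D \<Psi>) * \<Phi>' ^ 2"
    by (simp add: \<Phi>'_def fps_deriv_inverse_eq \<Psi>0)
  also have "\<dots> = - E * \<Phi>' * (\<Phi>' * \<Psi>)"
    unfolding D_\<Psi> by (simp add: power2_eq_square mult_ac)
  finally have D\<Phi>': "s * D \<Phi>' = - E * \<Phi>'"
    by (simp add: inv)
  have "s * D V = 2 * fps_X * s * \<Phi>' + fps_X ^ 2 * (s * D \<Phi>')"
    by (simp add: V_def power2_eq_square algebra_simps)
  also have "\<dots> = fps_X * \<Phi>' * (2 * s - fps_X * E)"
    unfolding D\<Phi>' by (simp add: power2_eq_square algebra_simps)
  finally have DV: "s * D V = U"
    unfolding XE U_def by (simp add: algebra_simps)
  have "s * D U = \<Phi>' * (s * (s + fps_const r) + fps_X * s * D s) + fps_X * (s * D \<Phi>') * (s + fps_const r)"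
    by (simp add: U_def algebra_simps)
  also have "\<dots> = \<Phi>' * (s * (s + fps_const r) + fps_X * s * D s - (fps_X * E) * (s + fps_const r))"
    unfolding D\<Phi>' by (simp add: algebra_simps)
  finally have DU: "s * D U = \<Phi>' * (fps_const r * (s + fps_const r) + fps_X * s * D s)"
    unfolding XE by (simp add: algebra_simps)
  have "D U = s * D (D V) + D s * D V"
    by (simp add: DV[symmetric])
  then have "s ^ 3 * D (D V) = s * (s * D U) - s * D s * (s * D V)"
    by (simp add: power3_eq_cube algebra_simps)
  also have "\<dots> = \<Phi>' * fps_const r * (s ^ 2 + fps_const r * s - fps_X * s * D s)"
    unfolding DV DU unfolding U_def by (simp add: power2_eq_square algebra_simps)
  also have "s ^ 2 + fps_const r * s - fps_X * s * D s = B + fps_const r * s"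
  proof -
    have "2 * (s ^ 2 - fps_X * s * D s) = 2 * s ^ 2 - fps_X * (2 * s * D s)"
      by (simp add: algebra_simps)
    also have "\<dots> = 2 * B"
      unfolding D_s s2 B_def by (simp add: algebra_simps power2_eq_square numeral_fps_const)
    finally have "s ^ 2 - fps_X * s * D s = B"
      by (simp only: mult_cancel_left) simp
    then show ?thesis by (simp add: algebra_simps)
  qed
  also have "\<Phi>' * fps_const r * (B + fps_const r * s) = 2 * fps_const r ^ 3 * (\<Phi>' * \<Psi>)"
    unfolding \<Psi>_eq[symmetric] fps_const_power[symmetric]
    by (simp only: power2_eq_square power3_eq_cube mult_ac)
  finally have "s ^ 3 * D (D V) = s ^ 3 * D (D (fps_X ^ 2 * \<Phi>))"
    unfolding inv assms by simp
  then have eq: "D (D V) = D (D (fps_X ^ 2 * \<Phi>))"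
    using s_nz by simp
  have "D V = D (fps_X ^ 2 * \<Phi>)"
    by (rule fps_eqI_deriv[OF eq]) (simp add: V_def power2_eq_square)
  then have "V = fps_X ^ 2 * \<Phi>"
    by (rule fps_eqI_deriv) (simp add: V_def power2_eq_square)
  then show ?thesis
    by (simp add: V_def \<Phi>'_def)
qed

end

locale conic_jet = conic_arc +
  fixes g :: "'a fps"
  assumes ode: "4 * s ^ 2 * D (D g) + 12 * s * D s * D g + 3 * fps_const y2 * g = 0"
begin

text \<open>\<open>fps_halfpow _ 0\<close> is the power -1/2, so this is the square root of
  \<open>\<Psi>\<close> with constant term 1.\<close>

definition W where "W = fps_halfpow (inverse \<Psi>) 0"
definition G where "G = g * W"
text \<open>This is 2 s^3 G' with the derivative of W eliminated by \<open>D_W\<close>. The linear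
  equation for g makes it linear in u, see \<open>D_D_l\<close>.\<close>

definition l where "l = W * (2 * s ^ 3 * D g + g * s ^ 2 * E)"
definition \<Psi>' where "\<Psi>' = fps_const (1 / (2 * r ^ 2)) * (B - fps_const r * s)"

lemma \<Phi>0: "fps_nth (inverse \<Psi>) 0 = 1"
  by (simp add: \<Psi>0)

lemma W_square: "W ^ 2 = \<Psi>"
  using \<Psi>0 by (simp add: W_def fps_halfpow_0_square \<Phi>0)

lemma W0: "fps_nth W 0 = 1"
  by (simp add: W_def fps_halfpow_nth_0)

lemma W_nz: "W \<noteq> 0"
  using W0 by auto

lemma D_W: "2 * s * D W = E * W"
proof -
  have "W * (2 * s * D W) = W * (E * W)"
    using D_\<Psi> unfolding W_square[symmetric] by (simp add: power2_eq_square algebra_simps)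
  then show ?thesis
    using W_nz by simp
qed

lemma D_G: "2 * s ^ 3 * D G = l"
proof -
  have "2 * s ^ 3 * D G = 2 * s ^ 3 * D g * W + g * s ^ 2 * (2 * s * D W)"
    by (simp add: G_def power2_eq_square power3_eq_cube algebra_simps)
  then show ?thesis
    unfolding D_W by (simp add: l_def algebra_simps)
qed

lemma D_l: "D l = W * (2 * s ^ 2 * E * D g + g * (2 * s * D s * E - fps_const y2 * s))"
proof -
  have "D l = D W * (2 * s ^ 3 * D g + g * s ^ 2 * E)
      + W * (6 * s ^ 2 * D s * D g + 2 * s ^ 3 * D (D g) + D g * s ^ 2 * E + g * (2 * s * D s * E + s ^ 2 * D E))"
    by (simp add: l_def power2_eq_square power3_eq_cube algebra_simps)
  then have "2 * s * D l = 2 * s * (W * (2 * s ^ 2 * E * D g + g * (2 * s * D s * E - fps_const y2 * s)))"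
    using D_W ode y2_eq by algebra
  then show ?thesis
    using s_nz by simp
qed

lemma D_D_l: "D (D l) = 0"
proof -
  have "D (D l) = D W * (2 * s ^ 2 * E * D g + g * (2 * s * D s * E - fps_const y2 * s))
      + W * (4 * s * D s * E * D g + 2 * s ^ 2 * D E * D g + 2 * s ^ 2 * E * D (D g)
         + D g * (2 * s * D s * E - fps_const y2 * s)
         + g * (2 * (D s ^ 2 + s * D (D s)) * E + 2 * s * D s * D E - fps_const y2 * D s))"
    by (simp add: D_l power2_eq_square algebra_simps)
  then have "2 * s * D (D l) = 0"
    unfolding D_D_s using D_W ode y2_eq by algebra
  then show ?thesis
    using s_nz by simp
qed

text \<open>Since 2 r^2 P_1 = g(t) B + r J with B linear, P_1 is linear exactly when J is.\<close>

definition J where "J = s * (2 * G - fps_const (fps_nth g 0))"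

text \<open>\<open>M\<close> is s^3 J''. Its derivative vanishes because s^3 s'' is constant, s^3 Q'
  = l for Q = 2 G - g(t), and l'' = 0. So only the value at u = 0 remains, where G = g(t) and the
  equation for g enters through \<open>D_l\<close>.\<close>

lemma D_D_J: "D (D J) = 0"
proof -
  let ?Q = "2 * G - fps_const (fps_nth g 0)" and ?\<kappa> = "fps_const (r ^ 2 * y2 - y1 ^ 2 / 4)"
  define M where "M = ?\<kappa> * ?Q + s * D l - D s * l"
  have DQ: "s ^ 3 * D ?Q = l"
    using D_G by (simp add: mult_ac)
  have "D l = s ^ 3 * D (D ?Q) + 3 * s ^ 2 * D s * D ?Q"
    by (simp only: DQ[symmetric]) (simp add: power2_eq_square power3_eq_cube algebra_simps)
  moreover have "D (D J) = D (D s) * ?Q + 2 * D s * D ?Q + s * D (D ?Q)"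
    by (simp add: J_def algebra_simps)
  ultimately have "s ^ 3 * D (D J) = M"
    unfolding M_def using D_D_s_cube DQ by algebra
  moreover have "D M = 0"
  proof -
    have "D M = ?\<kappa> * D ?Q - D (D s) * l"
      by (simp add: M_def D_D_l algebra_simps)
    then have "s ^ 3 * D M = 0"
      using DQ D_D_s_cube by algebra
    then show ?thesis using s_nz by simp
  qed
  moreover have "fps_nth M 0 = 0"
  proof -
    define e where "e = fps_nth (D s) 0"
    have E0: "fps_nth E 0 = e"
      by (simp add: E_def e_def)
    have G0: "fps_nth G 0 = fps_nth g 0"
      by (simp add: G_def W0)
    have y1: "2 * r * e = y1"
      using arg_cong[OF D_s, of "\<lambda>h. fps_nth h 0"] by (simp add: s0 e_def mult_ac)
    have l0: "fps_nth l 0 = 2 * r ^ 3 * fps_nth (D g) 0 + fps_nth g 0 * r ^ 2 * e"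
      by (simp add: l_def W0 s0 E0 fps_nth_power_0)
    have l1: "fps_nth (D l) 0 = 2 * r ^ 2 * e * fps_nth (D g) 0 + fps_nth g 0 * (2 * r * e ^ 2 - y2 * r)"
      unfolding D_l by (simp add: W0 s0 E0 fps_nth_power_0 e_def[symmetric] power2_eq_square del: fps_deriv_nth)
    have "fps_nth M 0 = (r ^ 2 * y2 - y1 ^ 2 / 4) * fps_nth g 0 + r * fps_nth (D l) 0 - e * fps_nth l 0"
      by (simp add: M_def G0 s0 e_def[symmetric] del: fps_deriv_nth)
    also have "\<dots> = (r ^ 2 * y2 - y1 ^ 2 / 4) * fps_nth g 0
        + r * (2 * r ^ 2 * e * fps_nth (D g) 0 + fps_nth g 0 * (2 * r * e ^ 2 - y2 * r))
        - e * (2 * r ^ 3 * fps_nth (D g) 0 + fps_nth g 0 * r ^ 2 * e)"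
      by (simp only: l0 l1)
    also have "\<dots> = 0"
      unfolding y1[symmetric] by (simp add: power2_eq_square power3_eq_cube algebra_simps)
    finally show ?thesis .
  qed
  ultimately show ?thesis
    using s_nz by (simp add: fps_deriv_eq_0_iff)
qed

definition P where "P k = G * \<Psi> ^ k + (fps_const (fps_nth g 0) - G) * \<Psi>' ^ k"

definition \<gamma> where "\<gamma> = (y1 ^ 2 / 4 - r ^ 2 * y2) / (4 * r ^ 4)"

lemma \<Psi>'_eq: "2 * fps_const (r ^ 2) * \<Psi>' = B - fps_const r * s"
proof -
  have "2 * fps_const (r ^ 2) * fps_const (1 / (2 * r ^ 2)) = (1 :: 'a fps)"
    using r by (simp add: numeral_fps_const)
  then show ?thesis
    unfolding \<Psi>'_def mult.assoc[symmetric] by simp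
qed

lemma \<Psi>_sum: "fps_const (r ^ 2) * (\<Psi> + \<Psi>') = B"
proof -
  have "2 * (fps_const (r ^ 2) * (\<Psi> + \<Psi>')) = 2 * fps_const (r ^ 2) * \<Psi> + 2 * fps_const (r ^ 2) * \<Psi>'"
    by (simp only: distrib_left mult.assoc)
  also have "\<dots> = 2 * B"
    unfolding \<Psi>_eq \<Psi>'_eq by simp
  finally show ?thesis by (simp only: mult_cancel_left) simp
qed

lemma \<Psi>_prod: "\<Psi> * \<Psi>' = fps_const \<gamma> * fps_X ^ 2"
proof -
  have "(2 * fps_const (r ^ 2) * \<Psi>) * (2 * fps_const (r ^ 2) * \<Psi>') = B ^ 2 - fps_const (r ^ 2) * s ^ 2"
    unfolding \<Psi>_eq \<Psi>'_eq by (simp add: power2_eq_square algebra_simps)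
  also have "\<dots> = fps_const (y1 ^ 2 / 4 - r ^ 2 * y2) * fps_X ^ 2"
    unfolding s2 B_def unfolding power2_eq_square fps_const_sub[symmetric]
    by (simp add: algebra_simps numeral_fps_const)
  also have "\<dots> = (2 * fps_const (r ^ 2)) * (2 * fps_const (r ^ 2)) * (fps_const \<gamma> * fps_X ^ 2)"
  proof -
    have "y1 ^ 2 / 4 - r ^ 2 * y2 = 2 * r ^ 2 * (2 * r ^ 2) * \<gamma>"
      using r by (simp add: \<gamma>_def power2_eq_square power4_eq_xxxx)
    then show ?thesis
      by (simp only: numeral_fps_const fps_const_mult mult.assoc[symmetric])
  qed
  finally have "((2 * fps_const (r ^ 2)) * (2 * fps_const (r ^ 2))) * (\<Psi> * \<Psi>')
      = (2 * fps_const (r ^ 2)) * (2 * fps_const (r ^ 2)) * (fps_const \<gamma> * fps_X ^ 2)"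
    by (simp only: mult_ac)
  then show ?thesis
    using r by (simp only: mult_cancel_left) simp
qed

lemma P_nth: "m > k \<Longrightarrow> fps_nth (P k) m = 0"
proof (induction k arbitrary: m rule: induct_nat_012)
  case 0
  then show ?case by (simp add: P_def)
next
  case 1
  have "2 * fps_const (r ^ 2) * P (Suc 0) = G * (2 * fps_const (r ^ 2) * \<Psi>)
      + (fps_const (fps_nth g 0) - G) * (2 * fps_const (r ^ 2) * \<Psi>')"
    by (simp only: P_def power_Suc0_right distrib_left mult_ac)
  also have "\<dots> = fps_const (fps_nth g 0) * B + fps_const r * J"
    unfolding \<Psi>_eq \<Psi>'_eq J_def by (simp add: algebra_simps)
  finally have "2 * fps_const (r ^ 2) * P (Suc 0) = fps_const (fps_nth g 0) * B + fps_const r * J" .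
  moreover have "D (D J) = 0" by (rule D_D_J)
  ultimately have "D (D (2 * fps_const (r ^ 2) * P (Suc 0))) = 0"
    by (simp add: B_def)
  then have "D (D (P (Suc 0))) = 0"
    using r by simp
  then have *: "fps_nth (D (D (P (Suc 0)))) (m - 2) = 0"
    by simp
  have "m = Suc (Suc (m - 2))"
    using 1 by simp
  then obtain n where "m = Suc (Suc n)" ..
  with * show ?case
    by (simp del: of_nat_Suc)
next
  case (ge2 k)
  have "m = Suc (Suc (m - 2))" "m - 2 > k"
    using ge2.prems by simp_all
  then obtain n where m: "m = Suc (Suc n)" "n > k"
    by blast
  have "P (Suc (Suc k)) = (\<Psi> + \<Psi>') * P (Suc k) - \<Psi> * \<Psi>' * P k"
    by (simp add: P_def algebra_simps)
  then have "fps_const (r ^ 2) * P (Suc (Suc k)) = B * P (Suc k) - fps_const (r ^ 2 * \<gamma>) * (fps_X ^ 2 * P k)"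
    unfolding \<Psi>_prod by (simp only: right_diff_distrib mult.assoc[symmetric] \<Psi>_sum) (simp add: mult_ac)
  moreover have "fps_nth (B * P (Suc k)) m = 0"
    unfolding B_def using ge2.IH(2) m by (simp add: distrib_right mult.assoc)
  moreover have "fps_nth (fps_X ^ 2 * P k) m = 0"
    using ge2.IH(1) m by (simp add: fps_X_power_mult_nth)
  ultimately have "fps_nth (fps_const (r ^ 2) * P (Suc (Suc k))) m = 0"
    by (simp only: fps_sub_nth fps_mult_left_const_nth) simp
  then show ?case
    using r by simp
qed

theorem coeff_eq_0:
  assumes "k \<ge> 1"
  shows "fps_nth (g * fps_halfpow (inverse \<Psi>) k) (2 * k) = 0"
proof -
  have "fps_nth \<Psi> 0 \<noteq> 0"
    by (simp add: \<Psi>0)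
  then have "\<Psi> * inverse \<Psi> = 1" 
    by (simp add: inverse_mult_eq_1')
  then have "\<Psi>' = fps_const \<gamma> * fps_X ^ 2 * inverse \<Psi>"
    using \<Psi>_prod by (metis mult.assoc mult.commute mult.left_neutral)
  then have eq: "(fps_const (fps_nth g 0) - G) * \<Psi>' ^ k
      = fps_X ^ (2 * k) * ((fps_const (fps_nth g 0) - G) * (fps_const \<gamma> * inverse \<Psi>) ^ k)"
    by (simp add: power_mult_distrib mult_ac flip: power_mult)
  \<comment> \<open>This zero supplies the one further factor u: the power u^(2k) coming from
    \<open>\<Psi>' ^ k\<close> alone would still reach the coefficient of u^(2k).\<close>
  have "fps_nth (fps_const (fps_nth g 0) - G) 0 = 0"
    by (simp add: G_def W0)
  then have "fps_nth ((fps_const (fps_nth g 0) - G) * \<Psi>' ^ k) (2 * k) = 0"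
    unfolding eq by (simp only: fps_X_power_mult_nth) simp
  moreover have "fps_nth (P k) (2 * k) = 0"
    using assms by (intro P_nth) simp
  ultimately have "fps_nth (G * \<Psi> ^ k) (2 * k) = 0"
    by (simp add: P_def)
  moreover have "g * fps_halfpow (inverse \<Psi>) k = G * \<Psi> ^ k"
    using \<Psi>0 by (simp add: fps_halfpow_eq[OF \<Phi>0, of k] G_def W_def mult_ac)
  ultimately show ?thesis by simp
qed

end

section \<open>Characterization of admissible formal pairs\<close>

text \<open>That is f'' = c z^(-3) with z^2 quadratic. Constant term 1 makes z unique for given f
  and obtainable from the binomial series, without roots of field elements.\<close>

definition fps_conic :: "'a::field_char_0 fps \<Rightarrow> 'a fps \<Rightarrow> 'a \<Rightarrow> 'a \<Rightarrow> 'a \<Rightarrow> bool" where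
  "fps_conic f z y1 y2 c \<longleftrightarrow> c \<noteq> 0 \<and> fps_nth z 0 = 1 \<and>
     z ^ 2 = 1 + fps_const y1 * fps_X + fps_const y2 * fps_X ^ 2 \<and>
     z ^ 3 * fps_deriv (fps_deriv f) = fps_const c"

definition fps_ode :: "'a::field_char_0 fps \<Rightarrow> 'a \<Rightarrow> 'a fps \<Rightarrow> bool" where
  "fps_ode z y2 g \<longleftrightarrow> 4 * z ^ 2 * fps_deriv (fps_deriv g) + 12 * z * fps_deriv z * fps_deriv g
     + 3 * fps_const y2 * g = 0"

lemma fps_shift_arg_X: "fps_shift_arg fps_X = fps_const fls_X + fps_X"
  by (rule fps_eqI_deriv) (simp_all add: fps_deriv_shift_arg)

lemma fps_shift_arg_numeral [simp]: "fps_shift_arg (numeral n) = numeral n"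
  using fps_shift_arg_const[of "numeral n"] by (simp add: numeral_fps_const)

text \<open>By construction f''(t) u^2 \<open>\<Phi>\<close> / 2 is f(t + u) minus its part of
  degree at most 1 in u, whose second u-derivative is f''(t + u).\<close>

lemma fps_deriv2_X_square_Phi:
  assumes "fps_deriv (fps_deriv f) \<noteq> 0"
  shows "fps_const (fps_to_fls (fps_deriv (fps_deriv f))) * fps_deriv (fps_deriv (fps_X ^ 2 * fps_Phi f))
    = 2 * fps_shift_arg (fps_deriv (fps_deriv f))"
proof (rule fps_ext)
  fix n
  let ?a = "fps_to_fls (fps_deriv (fps_deriv f))"
  have a: "?a \<noteq> 0" using assms by simp
  have d: "(fps_deriv ^^ (n + 2)) f = (fps_deriv ^^ n) (fps_deriv (fps_deriv f))"
    by (induction n) simp_all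
  have "fps_nth (fps_deriv (fps_deriv (fps_X ^ 2 * fps_Phi f))) n
      = of_nat (n + 1) * (of_nat (n + 2) * fps_nth (fps_Phi f) n)"
    by (simp only: fps_deriv_nth fps_X_power_mult_nth) simp
  also have "\<dots> = of_nat (n + 1) * of_nat (n + 2) / fact (n + 2) * (2 * fps_to_fls ((fps_deriv ^^ n) (fps_deriv (fps_deriv f))) / ?a)"
    by (simp add: fps_Phi_def d[simplified])
  also have "of_nat (n + 1) * of_nat (n + 2) / fact (n + 2) = (1 / fact n :: 'a fls)"
    by (simp add: divide_simps del: of_nat_Suc)
  finally show "fps_nth (fps_const ?a * fps_deriv (fps_deriv (fps_X ^ 2 * fps_Phi f))) n
    = fps_nth (2 * fps_shift_arg (fps_deriv (fps_deriv f))) n"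
    using a by (simp add: fps_shift_arg_nth numeral_fps_const)
qed

lemma fps_conic_imp_A_eq_0:
  assumes conic: "fps_conic f z y1 y2 c" and ode: "fps_ode z y2 g" and k: "k \<ge> 1"
  shows "fps_A f g k = 0"
proof -
  let ?T = fps_shift_arg and ?r = "fps_to_fls z" and ?f2 = "fps_deriv (fps_deriv f)"
  from conic have c: "c \<noteq> 0" and z0: "fps_nth z 0 = 1"
    and z2: "z ^ 2 = 1 + fps_const y1 * fps_X + fps_const y2 * fps_X ^ 2"
    and zf: "z ^ 3 * ?f2 = fps_const c"
    by (auto simp: fps_conic_def)
  have z: "z \<noteq> 0" using z0 by auto
  have f2: "?f2 \<noteq> 0"
    using zf c by auto
  \<comment> \<open>The scalars are Laurent series in t. The parameters are the Taylor coefficients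
    in u of the quadratic z^2 at t: its value, its derivative y1 + 2 y2 t and half its second
    derivative.\<close>
  interpret conic_jet ?r "fps_to_fls (fps_const y1 + 2 * fps_const y2 * fps_X)" "fls_const y2" "?T z" "?T g"
  proof
    show "?r \<noteq> 0" using z by simp
    show "fps_nth (?T z) 0 = ?r" by simp
    have "?r ^ 2 = fps_to_fls (1 + fps_const y1 * fps_X + fps_const y2 * fps_X ^ 2)"
      unfolding z2[symmetric] by (simp add: fps_to_fls_power)
    also have "\<dots> = 1 + fls_const y1 * fls_X + fls_const y2 * fls_X ^ 2"
      by (simp add: fls_times_fps_to_fls fps_to_fls_power)
    finally have r2: "?r ^ 2 = 1 + fls_const y1 * fls_X + fls_const y2 * fls_X ^ 2" .
    have "?T z ^ 2 = 1 + fps_const (fls_const y1) * (fps_const fls_X + fps_X)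
        + fps_const (fls_const y2) * (fps_const fls_X + fps_X) ^ 2"
      unfolding fps_shift_arg_power[symmetric] z2
      by (simp add: fps_shift_arg_add fps_shift_arg_mult fps_shift_arg_power fps_shift_arg_X)
    also have "\<dots> = (1 + fps_const (fls_const y1) * fps_const fls_X + fps_const (fls_const y2) * fps_const fls_X ^ 2)
        + (fps_const (fls_const y1) + 2 * fps_const (fls_const y2) * fps_const fls_X) * fps_X
        + fps_const (fls_const y2) * fps_X ^ 2"
    proof -
      have "1 + p * (t + x) + q * (t + x) ^ 2 = (1 + p * t + q * t ^ 2) + (p + 2 * q * t) * x + q * x ^ 2"
        for p q t x :: "'a fls fps"
        by (simp add: power2_eq_square algebra_simps)
      then show ?thesis .
    qed
    also have "1 + fps_const (fls_const y1) * fps_const fls_X + fps_const (fls_const y2) * fps_const fls_X ^ 2 = fps_const (?r ^ 2)"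
      unfolding r2 by (simp flip: fps_const_1_eq_1)
    also have "fps_const (fls_const y1) + 2 * fps_const (fls_const y2) * fps_const fls_X
        = fps_const (fps_to_fls (fps_const y1 + 2 * fps_const y2 * fps_X))"
    proof -
      have "fps_to_fls (fps_const y1 + 2 * fps_const y2 * fps_X) = fls_const y1 + 2 * fls_const y2 * fls_X"
        by (simp only: fps_to_fls_plus fls_times_fps_to_fls fps_to_fls_numeral fps_const_to_fls fps_X_to_fls)
      then show ?thesis
        by (simp add: numeral_fps_const)
    qed
    finally show "?T z ^ 2 = fps_const (?r ^ 2) + fps_const (fps_to_fls (fps_const y1 + 2 * fps_const y2 * fps_X)) * fps_X
        + fps_const (fls_const y2) * fps_X ^ 2" .
    show "4 * ?T z ^ 2 * fps_deriv (fps_deriv (?T g)) + 12 * ?T z * fps_deriv (?T z) * fps_deriv (?T g)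
        + 3 * fps_const (fls_const y2) * ?T g = 0"
      using arg_cong[OF ode[unfolded fps_ode_def], of ?T]
      by (simp add: fps_shift_arg_add fps_shift_arg_mult fps_shift_arg_power fps_deriv_shift_arg)
  qed
  have "fps_Phi f = inverse \<Psi>"
  proof (rule \<Phi>_unique)
    let ?a = "fps_to_fls ?f2"
    have ra: "?r ^ 3 * ?a = fls_const c"
      using arg_cong[OF zf, of fps_to_fls] by (simp add: fls_times_fps_to_fls fps_to_fls_power)
    have "?T z ^ 3 * ?T ?f2 = fps_const (fls_const c)"
      using arg_cong[OF zf, of ?T] by (simp add: fps_shift_arg_mult fps_shift_arg_power)
    then have eq: "?T z ^ 3 * (2 * ?T ?f2) = 2 * fps_const (fls_const c)"
      by simp
    have "fps_const ?a * (?T z ^ 3 * fps_deriv (fps_deriv (fps_X ^ 2 * fps_Phi f)))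
        = ?T z ^ 3 * (fps_const ?a * fps_deriv (fps_deriv (fps_X ^ 2 * fps_Phi f)))"
      by (simp only: mult_ac)
    also have "\<dots> = 2 * fps_const (fls_const c)"
      unfolding fps_deriv2_X_square_Phi[OF f2] by (rule eq)
    also have "\<dots> = fps_const ?a * (2 * fps_const ?r ^ 3)"
      unfolding ra[symmetric] fps_const_mult[symmetric] fps_const_power[symmetric]
      by (simp only: mult_ac)
    finally show "?T z ^ 3 * fps_deriv (fps_deriv (fps_X ^ 2 * fps_Phi f)) = 2 * fps_const ?r ^ 3"
      using f2 by simp
  qed
  then show ?thesis
    using coeff_eq_0[OF k] by (simp add: fps_A_eq_0_iff[OF f2])
qed

section \<open>From Monge's equation to the quadratic z^2 and the linear equation for g\<close>

lemma (in stationary_pair) monge: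
  defines "b \<equiv> fps_deriv (fps_deriv f)"
  shows "9 * b ^ 2 * fps_deriv (fps_deriv (fps_deriv b)) - 45 * b * fps_deriv b * fps_deriv (fps_deriv b)
    + 40 * fps_deriv b ^ 3 = 0"
proof -
  have D: "(D ^^ n) a = e n * a" for n
    unfolding e_def by (rule funpow_fls_deriv_logjet) (rule D_a)
  have D1: "D a = e 1 * a" and D2: "D (D a) = e 2 * a" and D3: "D (D (D a)) = e 3 * a"
    using D[of 1] D[of 2] D[of 3] by (simp_all add: eval_nat_numeral)
  have "9 * a ^ 2 * D (D (D a)) - 45 * a * D a * D (D a) + 40 * D a ^ 3 = (9 * e 3 - 45 * e 1 * e 2 + 40 * e 1 ^ 3) * a ^ 3"
    unfolding D3 unfolding D2 unfolding D1 by (simp add: power2_eq_square power3_eq_cube algebra_simps)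
  \<comment> \<open>Before \<open>\<nu>\<close> is set to 0, this combination equals -108
    \<open>\<nu>\<close>.\<close>
  also have "9 * e 3 - 45 * e 1 * e 2 + 40 * e 1 ^ 3 = 0"
    by (simp add: e_1 e_2 e_3 \<nu>_eq_0 power2_eq_square power3_eq_cube algebra_simps)
  finally have "fps_to_fls (9 * b ^ 2 * fps_deriv (fps_deriv (fps_deriv b)) - 45 * b * fps_deriv b * fps_deriv (fps_deriv b)
    + 40 * fps_deriv b ^ 3) = 0"
    by (simp add: b_def fls_times_fps_to_fls fps_to_fls_power fls_deriv_fps_to_fls)
  then show ?thesis by (simp only: fps_to_fls_eq_0_iff)
qed

lemma (in stationary_pair) g_eq:
  "D (D (fps_to_fls g)) + 6 * \<eta> * D (fps_to_fls g) + 3 * (\<eta> ^ 2 + \<kappa>) * fps_to_fls g = 0"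
proof -
  have h: "(D ^^ n) (fps_to_fls g) = h n * fps_to_fls g" for n
    unfolding h_def using g by (intro funpow_fls_deriv_logjet) (simp add: \<rho>_def)
  have h1: "D (fps_to_fls g) = h 1 * fps_to_fls g" and h2: "D (D (fps_to_fls g)) = h 2 * fps_to_fls g"
    using h[of 1] h[of 2] by (simp_all add: eval_nat_numeral)
  show ?thesis
    unfolding h2 unfolding h1 by (simp add: h_1 h_2 power2_eq_square algebra_simps)
qed

text \<open>If a vanished to order m, the lowest term of Monge's expression would carry the factor m
  (4 m^2 + 18 m + 18) = 2 m (2 m + 3) (m + 3), which is nonzero for m > 0. The roots -3/2 and -3 are
  the orders of y^(-3/2) at a simple and at a double zero of y.\<close>

lemma monge_nth_0_nonzero:
  fixes a :: "'a::field_char_0 fps"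
  assumes "a \<noteq> 0"
    and "9 * a ^ 2 * fps_deriv (fps_deriv (fps_deriv a)) - 45 * a * fps_deriv a * fps_deriv (fps_deriv a)
      + 40 * fps_deriv a ^ 3 = 0"
  shows "fps_nth a 0 \<noteq> 0"
proof -
  define m where "m = subdegree a"
  define M where "M = fps_const (of_nat m :: 'a)"
  obtain b where a: "a = fps_X ^ m * b" and b: "fps_nth b 0 \<noteq> 0"
  proof
    show "a = fps_X ^ m * fps_shift m a"
      unfolding m_def by (subst mult.commute) (rule subdegree_decompose)
    show "fps_nth (fps_shift m a) 0 \<noteq> 0"
      using assms(1) by (simp add: m_def)
  qed
  let ?X = "fps_X :: 'a fps" and ?D = fps_deriv
  have step: "?X * ?D (?X ^ m * h) = ?X ^ m * (M * h + ?X * ?D h)" for h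
  proof -
    have "?X * ?D (?X ^ n) = of_nat n * ?X ^ n" for n
    proof (induction n)
      case (Suc n)
      have "?X * ?D (?X ^ Suc n) = ?X * ?X ^ n + ?X * (?X * ?D (?X ^ n))"
        by (simp only: power_Suc fps_deriv_mult fps_deriv_fps_X distrib_left mult_1 mult.assoc) simp
      then show ?case
        unfolding Suc by (simp add: algebra_simps)
    qed simp
    then have "?X * ?D (?X ^ m) = M * ?X ^ m"
      by (simp only: M_def fps_of_nat)
    then show ?thesis
      by (simp add: algebra_simps)
  qed
  \<comment> \<open>X^i times the i-th derivative of a is X^m times b1, b2, b3. With these weights
    no exponent drops below m, so small m need no separate treatment.\<close>
  define b1 where "b1 = M * b + ?X * ?D b"
  define b2 where "b2 = M * b1 + ?X * ?D b1 - b1"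
  define b3 where "b3 = M * b2 + ?X * ?D b2 - 2 * b2"
  have a1: "?X * ?D a = ?X ^ m * b1"
    unfolding a step b1_def ..
  have "?X ^ 2 * ?D (?D a) = ?X * ?D (?X * ?D a) - ?X * ?D a"
    by (simp add: power2_eq_square algebra_simps)
  then have a2: "?X ^ 2 * ?D (?D a) = ?X ^ m * b2"
    unfolding a1 step b2_def by (simp add: algebra_simps)
  have "?X ^ 3 * ?D (?D (?D a)) = ?X * ?D (?X ^ 2 * ?D (?D a)) - 2 * (?X ^ 2 * ?D (?D a))"
    by (simp add: power2_eq_square power3_eq_cube algebra_simps)
  then have a3: "?X ^ 3 * ?D (?D (?D a)) = ?X ^ m * b3"
    unfolding a2 step b3_def by (simp add: algebra_simps)
  have "0 = ?X ^ 3 * (9 * a ^ 2 * ?D (?D (?D a)) - 45 * a * ?D a * ?D (?D a) + 40 * ?D a ^ 3)"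
    using assms(2) by simp
  also have "\<dots> = 9 * a ^ 2 * (?X ^ 3 * ?D (?D (?D a))) - 45 * a * (?X * ?D a) * (?X ^ 2 * ?D (?D a)) + 40 * (?X * ?D a) ^ 3"
    by (simp add: power2_eq_square power3_eq_cube algebra_simps)
  also have "\<dots> = (?X ^ m) ^ 3 * (9 * b ^ 2 * b3 - 45 * b * b1 * b2 + 40 * b1 ^ 3)"
    unfolding a1 a2 a3 unfolding a by (simp add: power2_eq_square power3_eq_cube algebra_simps)
  finally have "fps_nth (9 * b ^ 2 * b3 - 45 * b * b1 * b2 + 40 * b1 ^ 3) 0 = 0"
    by simp
  moreover define x where "x = (of_nat m :: 'a)"
  have "fps_nth b1 0 = x * fps_nth b 0" "fps_nth b2 0 = (x * x - x) * fps_nth b 0"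
    "fps_nth b3 0 = (x - 2) * (x * x - x) * fps_nth b 0"
    by (simp_all add: b1_def b2_def b3_def M_def x_def algebra_simps)
  ultimately have "fps_nth b 0 ^ 3 * (x * (4 * x * x + 18 * x + 18)) = 0"
    by (simp add: fps_nth_power_0 power2_eq_square power3_eq_cube algebra_simps)
  then have "x * (4 * x * x + 18 * x + 18) = 0"
    using b by simp
  then have "of_nat (m * (4 * m * m + 18 * m + 18)) = (0 :: 'a)"
    by (simp add: x_def)
  then have "m = 0"
    by (simp only: of_nat_eq_0_iff) simp
  then show ?thesis
    using a b by simp
qed

lemma monge_imp_quadratic:
  fixes a z :: "'a::field_char_0 fps"
  assumes monge: "9 * a ^ 2 * fps_deriv (fps_deriv (fps_deriv a)) - 45 * a * fps_deriv a * fps_deriv (fps_deriv a)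
      + 40 * fps_deriv a ^ 3 = 0"
    and za: "z ^ 3 * a = fps_const c" "c \<noteq> 0"
  shows "fps_deriv (fps_deriv (fps_deriv (z ^ 2))) = 0"
proof -
  let ?D = fps_deriv
  define y where "y = z ^ 2"
  have nz: "z \<noteq> 0" "a \<noteq> 0"
    using za by auto
  have "z ^ 2 * (3 * ?D z * a + z * ?D a) = 0"
    using arg_cong[OF za(1), of ?D] by (simp add: power2_eq_square power3_eq_cube algebra_simps)
  then have "3 * ?D z * a + z * ?D a = 0"
    using nz by simp
  then have "2 * z * (3 * ?D z * a + z * ?D a) = 0"
    by simp
  then have y1: "3 * a * ?D y + 2 * ?D a * y = 0"
    by (simp add: y_def power2_eq_square algebra_simps)
  from arg_cong[OF this, of ?D] have y2: "3 * a * ?D (?D y) + 5 * ?D a * ?D y + 2 * ?D (?D a) * y = 0"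
    by (simp add: algebra_simps)
  from arg_cong[OF this, of ?D]
  have y3: "3 * a * ?D (?D (?D y)) + 8 * ?D a * ?D (?D y) + 7 * ?D (?D a) * ?D y + 2 * ?D (?D (?D a)) * y = 0"
    by (simp add: algebra_simps)
  \<comment> \<open>The multipliers of the three relations are chosen to cancel y'' and y'. The
    remaining multiple of y is twice Monge's expression, which the last line removes.\<close>
  have "27 * a ^ 3 * ?D (?D (?D y)) =
      9 * a ^ 2 * (3 * a * ?D (?D (?D y)) + 8 * ?D a * ?D (?D y) + 7 * ?D (?D a) * ?D y + 2 * ?D (?D (?D a)) * y)
      - 24 * a * ?D a * (3 * a * ?D (?D y) + 5 * ?D a * ?D y + 2 * ?D (?D a) * y)
      + (40 * ?D a ^ 2 - 21 * a * ?D (?D a)) * (3 * a * ?D y + 2 * ?D a * y)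
      - 2 * y * (9 * a ^ 2 * ?D (?D (?D a)) - 45 * a * ?D a * ?D (?D a) + 40 * ?D a ^ 3)"
    by (simp add: power2_eq_square power3_eq_cube algebra_simps)
  also have "\<dots> = 0"
    unfolding y1 y2 y3 monge by simp
  finally show ?thesis
    using nz by (simp add: y_def)
qed

lemma fps_admissible_imp_conic:
  assumes "fps_admissible f g"
  obtains z y1 y2 c where "fps_conic f z y1 y2 c" "fps_ode z y2 g"
proof -
  interpret stationary_pair f g
    by standard (use assms in \<open>auto simp: fps_admissible_def\<close>)
  define b where "b = fps_deriv (fps_deriv f)"
  have b: "b \<noteq> 0" using f by (simp add: b_def)
  note monge = monge[folded b_def]
  have b0: "fps_nth b 0 \<noteq> 0"
    by (rule monge_nth_0_nonzero[OF b monge])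
  define c where "c = fps_nth b 0"
  define w where "w = fps_const (1 / c) * b"
  define z where "z = fps_binomial (- 1/3) oo (w - 1)"
  have w0: "fps_nth w 0 = 1"
    using b0 by (simp add: w_def c_def)
  have "z ^ 3 = inverse w"
    using w0 fps_binomial_minus_one_compose[OF w0] by (simp add: z_def fps_binomial_compose_power)
  moreover have "inverse w * w = 1"
    by (rule inverse_mult_eq_1) (simp add: w0)
  moreover have "b = fps_const c * w"
    using b0 by (simp add: w_def c_def mult.assoc[symmetric])
  ultimately have zb: "z ^ 3 * b = fps_const c"
    by (metis mult.assoc mult.commute mult_1)
  have c: "c \<noteq> 0" using b0 by (simp add: c_def)
  have z0: "fps_nth z 0 = 1" by (simp add: z_def)
  have z: "z \<noteq> 0" using z0 by auto
  define y1 where "y1 = fps_nth (z ^ 2) 1"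
  define y2 where "y2 = fps_nth (z ^ 2) 2"
  have D3: "fps_deriv (fps_deriv (fps_deriv (z ^ 2))) = 0"
    by (rule monge_imp_quadratic[OF monge zb c])
  have z2: "z ^ 2 = 1 + fps_const y1 * fps_X + fps_const y2 * fps_X ^ 2"
  proof (rule fps_ext)
    fix n :: nat
    have "n = 0 \<or> n = 1 \<or> n = 2 \<or> (\<exists>m. n = Suc (Suc (Suc m)))"
      by presburger
    then consider "n = 0" | "n = 1" | "n = 2" | m where "n = Suc (Suc (Suc m))"
      by blast
    then show "fps_nth (z ^ 2) n = fps_nth (1 + fps_const y1 * fps_X + fps_const y2 * fps_X ^ 2) n"
    proof cases
      case 4
      have "fps_nth (fps_deriv (fps_deriv (fps_deriv (z ^ 2)))) m = 0"
        unfolding D3 by simp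
      then have "fps_nth (z ^ 2) n = 0"
        unfolding fps_deriv_nth using 4 by (simp del: of_nat_Suc of_nat_add)
      then show ?thesis using 4 by (simp add: fps_X_power_iff)
    qed (simp_all add: fps_nth_power_0 z0 y1_def y2_def fps_X_power_iff)
  qed
  have conic: "fps_conic f z y1 y2 c"
    using c z0 z2 zb by (simp add: fps_conic_def b_def)
  have DDz: "fps_deriv z ^ 2 + z * fps_deriv (fps_deriv z) = fps_const y2"
  proof -
    have "2 * (fps_deriv z ^ 2 + z * fps_deriv (fps_deriv z)) = fps_deriv (fps_deriv (z ^ 2))"
      by (simp add: power2_eq_square algebra_simps)
    also have "\<dots> = 2 * fps_const y2"
      unfolding z2 by (simp add: power2_eq_square algebra_simps)
    finally show ?thesis
      by (simp only: mult_cancel_left) simp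
  qed
  let ?Z = "fps_to_fls z" and ?g = "fps_to_fls g"
  have DZ: "D ?Z = 2 * ?Z * \<eta>"
  proof -
    have za: "?Z ^ 3 * a = fls_const c"
      using arg_cong[OF zb, of fps_to_fls] by (simp add: b_def fls_times_fps_to_fls fps_to_fls_power)
    have "?Z ^ 2 * (3 * D ?Z * a + ?Z * D a) = 0"
      using arg_cong[OF za, of D] by (simp add: power2_eq_square power3_eq_cube algebra_simps)
    then have "3 * D ?Z * a + ?Z * D a = 0"
      using z by simp
    then have "(3 * a) * (D ?Z - 2 * ?Z * \<eta>) = 0"
      unfolding D_a by (simp add: algebra_simps)
    then show ?thesis
      using a_nz by simp
  qed
  have y2Z: "D ?Z ^ 2 + ?Z * D (D ?Z) = fls_const y2"
    using arg_cong[OF DDz, of fps_to_fls]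
    by (simp add: fls_times_fps_to_fls fps_to_fls_power fls_deriv_fps_to_fls)
  have "D (D ?Z) = 2 * D ?Z * \<eta> + 2 * ?Z * (2 * \<kappa> - 2 * \<eta> ^ 2)"
    using arg_cong[OF DZ, of D] by (simp add: D_\<eta> algebra_simps)
  \<comment> \<open>Together with \<open>DZ\<close> this identifies \<open>g_eq\<close> with
    \<open>fps_ode\<close>: 6 \<open>\<eta>\<close> is 3 z'/z, and \<open>\<eta>\<close>^2 +
    \<open>\<kappa>\<close> is y2 / (4 z^2).\<close>
  then have y2Z': "fls_const y2 = 4 * ?Z ^ 2 * (\<eta> ^ 2 + \<kappa>)"
    unfolding y2Z[symmetric] DZ by (simp add: power2_eq_square algebra_simps)
  have "4 * ?Z ^ 2 * D (D ?g) + 12 * ?Z * D ?Z * D ?g + 3 * fls_const y2 * ?g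
      = 4 * ?Z ^ 2 * (D (D ?g) + 6 * \<eta> * D ?g + 3 * (\<eta> ^ 2 + \<kappa>) * ?g)"
    unfolding y2Z' DZ by (simp add: power2_eq_square algebra_simps)
  also have "\<dots> = 0"
    unfolding g_eq by simp
  finally have "fps_to_fls (4 * z ^ 2 * fps_deriv (fps_deriv g) + 12 * z * fps_deriv z * fps_deriv g
     + 3 * fps_const y2 * g) = 0"
    by (simp add: fls_times_fps_to_fls fps_to_fls_power fls_deriv_fps_to_fls)
  then have "fps_ode z y2 g"
    by (simp only: fps_ode_def fps_to_fls_eq_0_iff)
  then show ?thesis
    using that conic by blast
qed

text \<open>Finitely many coefficients decide: A_1, A_2 and A_3 lead to the conic and the linear
  equation, and these make every A_k with k \<ge> 1 vanish.\<close>

theorem fps_admissible_iff: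
  "fps_admissible f g \<longleftrightarrow> g \<noteq> 0 \<and> (\<exists>z y1 y2 c. fps_conic f z y1 y2 c \<and> fps_ode z y2 g)"
proof
  assume "fps_admissible f g"
  then show "g \<noteq> 0 \<and> (\<exists>z y1 y2 c. fps_conic f z y1 y2 c \<and> fps_ode z y2 g)"
    by (metis fps_admissible_def fps_admissible_imp_conic)
next
  assume *: "g \<noteq> 0 \<and> (\<exists>z y1 y2 c. fps_conic f z y1 y2 c \<and> fps_ode z y2 g)"
  then have "fps_deriv (fps_deriv f) \<noteq> 0"
    by (auto simp: fps_conic_def)
  with * show "fps_admissible f g"
    by (auto simp: fps_admissible_def fps_conic_imp_A_eq_0)
qed

section \<open>The space of solutions\<close>

lemma fps_square_eqI:
  fixes p q :: "'a::field_char_0 fps"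
  assumes "p ^ 2 = q ^ 2" "fps_nth p 0 = fps_nth q 0" "fps_nth q 0 \<noteq> 0"
  shows "p = q"
proof -
  have "(p - q) * (p + q) = 0"
    using assms(1) by (simp add: power2_eq_square algebra_simps)
  moreover have "fps_nth (p + q) 0 \<noteq> 0"
    using assms by simp
  then have "p + q \<noteq> 0" by (metis fps_zero_nth)
  ultimately show ?thesis by simp
qed

lemma fps_cube_eqI:
  fixes p q :: "'a::field_char_0 fps"
  assumes "p ^ 3 = q ^ 3" "fps_nth p 0 = 1" "fps_nth q 0 = 1"
  shows "p = q"
proof -
  have "(p - q) * (p ^ 2 + p * q + q ^ 2) = 0"
    using assms(1) by (simp add: power2_eq_square power3_eq_cube algebra_simps)
  moreover have "fps_nth (p ^ 2 + p * q + q ^ 2) 0 \<noteq> 0"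
    using assms by (simp add: fps_nth_power_0)
  then have "p ^ 2 + p * q + q ^ 2 \<noteq> 0"
    by (metis fps_zero_nth)
  ultimately show ?thesis by simp
qed

text \<open>The equation involves z only through z^2 and is homogeneous in it, so any constant
  multiple of the quadratic serves. This lets the quadratics of the normal forms be used without
  scaling them to constant term 1.\<close>

lemma fps_ode_iff:
  assumes "z ^ 2 = fps_const k * Y" "k \<noteq> 0" "y2 = k * m"
  shows "fps_ode z y2 g \<longleftrightarrow> 4 * Y * fps_deriv (fps_deriv g) + 6 * fps_deriv Y * fps_deriv g
    + 3 * fps_const m * g = 0"
proof -
  have "2 * z * fps_deriv z = fps_const k * fps_deriv Y"
    using arg_cong[OF assms(1), of fps_deriv] by (simp add: power2_eq_square algebra_simps)
  moreover have "12 * z * fps_deriv z * fps_deriv g = 6 * (2 * z * fps_deriv z) * fps_deriv g"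
    by simp
  ultimately have d: "12 * z * fps_deriv z * fps_deriv g = 6 * (fps_const k * fps_deriv Y) * fps_deriv g"
    by (simp only:)
  have "4 * z ^ 2 * fps_deriv (fps_deriv g) + 12 * z * fps_deriv z * fps_deriv g + 3 * fps_const y2 * g
    = fps_const k * (4 * Y * fps_deriv (fps_deriv g) + 6 * fps_deriv Y * fps_deriv g + 3 * fps_const m * g)"
    unfolding d assms fps_const_mult[symmetric] by (simp add: algebra_simps del: fps_const_mult)
  then show ?thesis
    using assms(2) by (simp add: fps_ode_def)
qed

lemma fps_ode_add: "fps_ode z y2 g \<Longrightarrow> fps_ode z y2 h \<Longrightarrow> fps_ode z y2 (g + h)"
proof -
  assume "fps_ode z y2 g" "fps_ode z y2 h"
  then have "(4 * z ^ 2 * fps_deriv (fps_deriv g) + 12 * z * fps_deriv z * fps_deriv g + 3 * fps_const y2 * g)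
    + (4 * z ^ 2 * fps_deriv (fps_deriv h) + 12 * z * fps_deriv z * fps_deriv h + 3 * fps_const y2 * h) = 0"
    by (simp add: fps_ode_def)
  then show "fps_ode z y2 (g + h)"
    unfolding fps_ode_def by (simp add: algebra_simps)
qed

lemma fps_ode_scale: "fps_ode z y2 g \<Longrightarrow> fps_ode z y2 (fps_const c * g)"
proof -
  assume "fps_ode z y2 g"
  then have "fps_const c * (4 * z ^ 2 * fps_deriv (fps_deriv g) + 12 * z * fps_deriv z * fps_deriv g + 3 * fps_const y2 * g) = 0"
    by (simp add: fps_ode_def)
  then show "fps_ode z y2 (fps_const c * g)"
    unfolding fps_ode_def by (simp add: algebra_simps del: fps_const_mult)
qed

lemma fps_nth_X_mult_deriv: "fps_nth (fps_X * fps_deriv g) n = of_nat n * fps_nth g n"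
  by (simp add: fps_mult_fps_X_deriv_shift)

lemma fps_ode_iff_recurrence:
  fixes g :: "'a::field_char_0 fps"
  assumes z2: "z ^ 2 = 1 + fps_const y1 * fps_X + fps_const y2 * fps_X ^ 2"
  shows "fps_ode z y2 g \<longleftrightarrow> (\<forall>n. 4 * (of_nat n + 1) * (of_nat n + 2) * fps_nth g (n + 2) =
    - (y1 * (of_nat n + 1) * (4 * of_nat n + 6) * fps_nth g (n + 1) + y2 * (2 * of_nat n + 1) * (2 * of_nat n + 3) * fps_nth g n))"
proof -
  let ?X = "fps_X :: 'a fps" and ?D = fps_deriv
  have "fps_ode z y2 g \<longleftrightarrow> 4 * (1 + fps_const y1 * ?X + fps_const y2 * ?X ^ 2) * ?D (?D g)
     + 6 * ?D (1 + fps_const y1 * ?X + fps_const y2 * ?X ^ 2) * ?D g + 3 * fps_const y2 * g = 0"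
    by (rule fps_ode_iff[of z 1]) (simp_all add: z2)
  \<comment> \<open>Rewriting X^2 d^2/dX^2 through the Euler operator X d/dX makes it diagonal on
    coefficients. The y2-part becomes 4 n^2 + 8 n + 3 = (2 n + 1)(2 n + 3).\<close>
  also have "4 * (1 + fps_const y1 * ?X + fps_const y2 * ?X ^ 2) * ?D (?D g)
     + 6 * ?D (1 + fps_const y1 * ?X + fps_const y2 * ?X ^ 2) * ?D g + 3 * fps_const y2 * g
     = fps_const 4 * ?D (?D g) + fps_const y1 * (fps_const 4 * (?X * ?D (?D g)) + fps_const 6 * ?D g)
      + fps_const y2 * (fps_const 4 * (?X * ?D (?X * ?D g)) + fps_const 8 * (?X * ?D g) + fps_const 3 * g)"
    by (simp add: power2_eq_square algebra_simps flip: numeral_fps_const)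
  also have "\<dots> = 0 \<longleftrightarrow> (\<forall>n. fps_nth \<dots> n = 0)"
    by (simp only: fps_eq_iff fps_zero_nth)
  also have "\<dots> \<longleftrightarrow> (\<forall>n. 4 * (of_nat n + 1) * (of_nat n + 2) * fps_nth g (n + 2) =
    - (y1 * (of_nat n + 1) * (4 * of_nat n + 6) * fps_nth g (n + 1) + y2 * (2 * of_nat n + 1) * (2 * of_nat n + 3) * fps_nth g n))"
    unfolding eq_neg_iff_add_eq_0 fps_add_nth fps_mult_left_const_nth fps_nth_X_mult_deriv
    by (simp add: algebra_simps)
  finally show ?thesis .
qed

fun fps_ode_coeff :: "'a::field_char_0 \<Rightarrow> 'a \<Rightarrow> 'a \<Rightarrow> 'a \<Rightarrow> nat \<Rightarrow> 'a" where
  "fps_ode_coeff y1 y2 u v 0 = u"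
| "fps_ode_coeff y1 y2 u v (Suc 0) = v"
| "fps_ode_coeff y1 y2 u v (Suc (Suc n)) =
    - (y1 * (of_nat n + 1) * (4 * of_nat n + 6) * fps_ode_coeff y1 y2 u v (Suc n)
      + y2 * (2 * of_nat n + 1) * (2 * of_nat n + 3) * fps_ode_coeff y1 y2 u v n)
    / (4 * (of_nat n + 1) * (of_nat n + 2))"

lemma of_nat_add_pos_neq_0: "of_nat n + 1 \<noteq> (0::'a::field_char_0)" "of_nat n + 2 \<noteq> (0::'a)"
proof -
  have "of_nat (n + 1) \<noteq> (0::'a)" "of_nat (n + 2) \<noteq> (0::'a)"
    unfolding of_nat_eq_0_iff by simp_all
  then show "of_nat n + 1 \<noteq> (0::'a)" "of_nat n + 2 \<noteq> (0::'a)"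
    by (simp_all only: of_nat_add of_nat_1 of_nat_numeral) simp_all
qed

lemma fps_ode_iff_coeff:
  fixes g :: "'a::field_char_0 fps"
  assumes z2: "z ^ 2 = 1 + fps_const y1 * fps_X + fps_const y2 * fps_X ^ 2"
  shows "fps_ode z y2 g \<longleftrightarrow> g = Abs_fps (fps_ode_coeff y1 y2 (fps_nth g 0) (fps_nth g 1))"
proof
  assume "fps_ode z y2 g"
  then have eq: "4 * (of_nat n + 1) * (of_nat n + 2) * fps_nth g (Suc (Suc n)) =
    - (y1 * (of_nat n + 1) * (4 * of_nat n + 6) * fps_nth g (Suc n) + y2 * (2 * of_nat n + 1) * (2 * of_nat n + 3) * fps_nth g n)" for n
    unfolding fps_ode_iff_recurrence[OF z2] by (simp add: numeral_2_eq_2)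
  then have step: "fps_nth g (Suc (Suc n)) = - (y1 * (of_nat n + 1) * (4 * of_nat n + 6) * fps_nth g (Suc n)
      + y2 * (2 * of_nat n + 1) * (2 * of_nat n + 3) * fps_nth g n) / (4 * (of_nat n + 1) * (of_nat n + 2))" for n
  proof -
    have aux: "x = R / d" if "d * x = R" "d \<noteq> 0" for x R d :: 'a
      using that by (simp add: field_simps)
    show ?thesis
      by (rule aux[OF eq]) (simp only: mult_eq_0_iff of_nat_add_pos_neq_0, simp)
  qed
  have coeff: "fps_nth g n = fps_ode_coeff y1 y2 (fps_nth g 0) (fps_nth g 1) n" for n
  proof (induction n rule: induct_nat_012)
    case (ge2 n)
    then show ?case
      unfolding step fps_ode_coeff.simps by simp
  qed simp_all
  show "g = Abs_fps (fps_ode_coeff y1 y2 (fps_nth g 0) (fps_nth g 1))"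
    by (rule fps_ext) (simp only: fps_nth_Abs_fps, rule coeff)
next
  assume g: "g = Abs_fps (fps_ode_coeff y1 y2 (fps_nth g 0) (fps_nth g 1))"
  have nth: "fps_nth g n = fps_ode_coeff y1 y2 (fps_nth g 0) (fps_nth g 1) n" for n
    by (subst g) simp
  have "(4 * (of_nat n + 1) * (of_nat n + 2)) * fps_nth g (Suc (Suc n)) =
    - (y1 * (of_nat n + 1) * (4 * of_nat n + 6) * fps_nth g (Suc n) + y2 * (2 * of_nat n + 1) * (2 * of_nat n + 3) * fps_nth g n)" for n
  proof -
    have nz: "4 * (of_nat n + 1) * (of_nat n + 2) \<noteq> (0::'a)"
      by (simp only: mult_eq_0_iff of_nat_add_pos_neq_0) simp
    have "fps_nth g (Suc (Suc n)) = - (y1 * (of_nat n + 1) * (4 * of_nat n + 6) * fps_nth g (Suc n)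
      + y2 * (2 * of_nat n + 1) * (2 * of_nat n + 3) * fps_nth g n) / (4 * (of_nat n + 1) * (of_nat n + 2))"
      unfolding nth[of "Suc (Suc n)"] nth[of "Suc n"] nth[of n] by (simp only: fps_ode_coeff.simps)
    then show ?thesis
      using nz by (metis nonzero_mult_div_cancel_left times_divide_eq_right)
  qed
  then show "fps_ode z y2 g"
    unfolding fps_ode_iff_recurrence[OF z2] by (simp add: numeral_2_eq_2)
qed

lemma fps_ode_eqI:
  fixes g h :: "'a::field_char_0 fps"
  assumes "z ^ 2 = 1 + fps_const y1 * fps_X + fps_const y2 * fps_X ^ 2"
    and "fps_ode z y2 g" "fps_ode z y2 h" "fps_nth g 0 = fps_nth h 0" "fps_nth g 1 = fps_nth h 1"
  shows "g = h"
  using assms fps_ode_iff_coeff[OF assms(1)] by metis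

lemma fps_ode_ex:
  fixes u v :: "'a::field_char_0"
  assumes "z ^ 2 = 1 + fps_const y1 * fps_X + fps_const y2 * fps_X ^ 2"
  shows "\<exists>g. fps_ode z y2 g \<and> fps_nth g 0 = u \<and> fps_nth g 1 = v"
  by (rule exI[of _ "Abs_fps (fps_ode_coeff y1 y2 u v)"]) (simp add: fps_ode_iff_coeff[OF assms])

text \<open>Cramer's rule for the first two coefficients, which determine a solution;
  \<open>wr\<close> says that the Wronskian does not vanish at the base point.\<close>

lemma fps_ode_combination:
  fixes g u v :: "'a::field_char_0 fps"
  assumes z2: "z ^ 2 = 1 + fps_const y1 * fps_X + fps_const y2 * fps_X ^ 2"
    and g: "fps_ode z y2 g" and uv: "fps_ode z y2 u" "fps_ode z y2 v"
    and wr: "fps_nth u 0 * fps_nth v 1 - fps_nth u 1 * fps_nth v 0 \<noteq> 0"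
  obtains c1 c2 where "g = fps_const c1 * u + fps_const c2 * v"
proof -
  let ?w = "fps_nth u 0 * fps_nth v 1 - fps_nth u 1 * fps_nth v 0"
  define c1 where "c1 = (fps_nth g 0 * fps_nth v 1 - fps_nth g 1 * fps_nth v 0) / ?w"
  define c2 where "c2 = (fps_nth u 0 * fps_nth g 1 - fps_nth u 1 * fps_nth g 0) / ?w"
  have "g = fps_const c1 * u + fps_const c2 * v"
  proof (rule fps_ode_eqI[OF z2 g])
    show "fps_ode z y2 (fps_const c1 * u + fps_const c2 * v)"
      using uv by (intro fps_ode_add fps_ode_scale)
    have "?w * (c1 * fps_nth u i + c2 * fps_nth v i) = ?w * fps_nth g i" if "i = 0 \<or> i = 1" for i
    proof -
      have "?w * c1 = fps_nth g 0 * fps_nth v 1 - fps_nth g 1 * fps_nth v 0"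
        "?w * c2 = fps_nth u 0 * fps_nth g 1 - fps_nth u 1 * fps_nth g 0"
        using wr by (simp_all add: c1_def c2_def)
      moreover have "?w * (c1 * fps_nth u i + c2 * fps_nth v i) = (?w * c1) * fps_nth u i + (?w * c2) * fps_nth v i"
        by (simp only: distrib_left mult.assoc)
      ultimately have "?w * (c1 * fps_nth u i + c2 * fps_nth v i)
          = (fps_nth g 0 * fps_nth v 1 - fps_nth g 1 * fps_nth v 0) * fps_nth u i
          + (fps_nth u 0 * fps_nth g 1 - fps_nth u 1 * fps_nth g 0) * fps_nth v i"
        by (simp only:)
      then show ?thesis
        using that by (auto simp: algebra_simps)
    qed
    then show "fps_nth g 0 = fps_nth (fps_const c1 * u + fps_const c2 * v) 0"
      "fps_nth g 1 = fps_nth (fps_const c1 * u + fps_const c2 * v) 1"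
      using wr by simp_all
  qed
  then show ?thesis by (rule that)
qed

text \<open>The conic data depend on f alone: c is the value of f'' at the base point, z is the cube
  root of c / f'' with constant term 1, and y2 is read off z^2. Hence one linear equation describes
  all g.\<close>

lemma fps_V_eq:
  assumes "fps_conic f z y1 y2 c"
  shows "fps_V f = {g. fps_ode z y2 g}"
proof (intro set_eqI iffI CollectI)
  fix g assume g: "g \<in> fps_V f"
  show "fps_ode z y2 g"
  proof (cases "g = 0")
    case False
    with g have "fps_admissible f g" by (simp add: fps_V_def)
    then obtain z' y1' y2' c' where *: "fps_conic f z' y1' y2' c'" "fps_ode z' y2' g"
      by (rule fps_admissible_imp_conic)
    have c: "c = fps_nth (fps_deriv (fps_deriv f)) 0" if "fps_conic f z y1 y2 c" for z y1 y2 c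
    proof -
      have "c = fps_nth (z ^ 3 * fps_deriv (fps_deriv f)) 0"
        using that by (simp only: fps_conic_def) simp
      then show ?thesis
        using that by (simp add: fps_conic_def fps_nth_power_0 del: fps_deriv_nth)
    qed
    have "z' ^ 3 * fps_deriv (fps_deriv f) = z ^ 3 * fps_deriv (fps_deriv f)"
      using assms * c[OF assms] c[OF *(1)] by (simp add: fps_conic_def)
    moreover have "fps_deriv (fps_deriv f) \<noteq> 0"
      using assms by (auto simp: fps_conic_def)
    ultimately have z3: "z' ^ 3 = z ^ 3" by simp
    have z0: "fps_nth z' 0 = 1" "fps_nth z 0 = 1"
      using assms *(1) unfolding fps_conic_def by blast+
    have z: "z' = z"
      by (rule fps_cube_eqI[OF z3 z0])
    have y2: "fps_nth (z ^ 2) 2 = y2" if "fps_conic f z y1 y2 c" for z y1 y2 c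
    proof -
      have "z ^ 2 = 1 + fps_const y1 * fps_X + fps_const y2 * fps_X ^ 2"
        using that unfolding fps_conic_def by blast
      then show ?thesis
        by (simp only:) (simp add: fps_X_power_iff)
    qed
    have "y2' = y2"
      using y2[OF assms] y2[OF *(1)] unfolding z by (rule trans[OF sym, rotated])
    then show ?thesis
      using * z by simp
  qed (simp add: fps_ode_def)
next
  fix g assume "g \<in> {g. fps_ode z y2 g}"
  then show "g \<in> fps_V f"
    using assms by (auto simp: fps_V_def fps_admissible_iff)
qed

lemma fps_rank_eq_2:
  assumes conic: "fps_conic f z y1 y2 c"
  shows "fps_rank f = 2"
proof -
  have z2: "z ^ 2 = 1 + fps_const y1 * fps_X + fps_const y2 * fps_X ^ 2"
    using conic by (simp add: fps_conic_def)
  obtain u where u: "fps_ode z y2 u" "fps_nth u 0 = 1" "fps_nth u 1 = 0"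
    using fps_ode_ex[OF z2] by blast
  obtain v where v: "fps_ode z y2 v" "fps_nth v 0 = 0" "fps_nth v 1 = 1"
    using fps_ode_ex[OF z2] by blast
  have uv: "u \<noteq> v"
    using u v by auto
  show ?thesis
    unfolding fps_rank_def fps_V_eq[OF conic]
  proof (rule fps_vs.dim_unique)
    show "{u, v} \<subseteq> {g. fps_ode z y2 g}"
      using u v by simp
    show "{g. fps_ode z y2 g} \<subseteq> fps_vs.span {u, v}"
    proof (intro subsetI)
      fix g assume "g \<in> {g. fps_ode z y2 g}"
      then have g: "fps_ode z y2 g" by simp
      have wr: "fps_nth u 0 * fps_nth v 1 - fps_nth u 1 * fps_nth v 0 \<noteq> 0"
        unfolding u v by simp
      obtain c1 c2 where "g = fps_const c1 * u + fps_const c2 * v"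
        using fps_ode_combination[OF z2 g u(1) v(1) wr] .
      then show "g \<in> fps_vs.span {u, v}"
        by (simp only:) (intro fps_vs.span_add fps_vs.span_scale fps_vs.span_base insertI1 insertI2)
    qed
    show "fps_vs.independent {u, v}"
    proof (rule fps_vs.independent_if_scalars_zero)
      fix r h assume *: "(\<Sum>h\<in>{u, v}. fps_const (r h) * h) = 0" and h: "h \<in> {u, v}"
      have "fps_const (r u) * u + fps_const (r v) * v = 0"
        using * uv by simp
      then have "fps_nth (fps_const (r u) * u + fps_const (r v) * v) i = 0" for i
        by simp
      from this[of 0] this[of 1] show "r h = 0"
        using h u v by auto
    qed simp
    show "card {u, v} = 2"
      using uv by simp
  qed
qed

section \<open>The listed pairs are admissible\<close>

lemma fps_nth_coord [simp]:
  "fps_nth (fps_coord a) 0 = a" "fps_nth (fps_coord a) (Suc 0) = 1"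
  by (simp_all add: fps_coord_def)

lemma fps_deriv_coord [simp]: "fps_deriv (fps_coord (a :: 'a::field_char_0)) = 1"
  by (simp add: fps_coord_def)

text \<open>A square vanishes to even order, so p is invertible as soon as p^2 has at most a simple
  zero. The existence of the root germs therefore already keeps the base point away from the branch
  points.\<close>

lemma fps_square_nth_0_nonzero:
  fixes p :: "'a::field_char_0 fps"
  assumes "fps_nth (p ^ 2) 0 \<noteq> 0 \<or> fps_nth (p ^ 2) 1 \<noteq> 0"
  shows "fps_nth p 0 \<noteq> 0"
  using assms by (auto simp: power2_eq_square fps_mult_nth)

locale fps_linear_root =
  fixes p \<alpha> :: "'a::field_char_0 fps" and l :: 'a
  assumes p2: "p ^ 2 = \<alpha>" and D\<alpha>: "fps_deriv \<alpha> = fps_const l" and p0: "fps_nth p 0 \<noteq> 0"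
begin

abbreviation P where "P \<equiv> inverse p"

lemma P_p: "P * p = 1"
  using p0 by (rule inverse_mult_eq_1)

lemma D_P: "2 * fps_deriv P = - (fps_const l * P ^ 3)"
proof -
  have dp: "2 * p * fps_deriv p = fps_const l"
    using arg_cong[OF p2, of fps_deriv] D\<alpha> by (simp add: power2_eq_square algebra_simps)
  have "2 * fps_deriv P = - (2 * p * fps_deriv p) * P ^ 2 * P"
    using p0 P_p by (simp add: fps_deriv_inverse_eq mult_ac)
  then show ?thesis
    unfolding dp by (simp add: power2_eq_square power3_eq_cube mult_ac del: fps_const_neg)
qed

lemma D_D_P: "4 * fps_deriv (fps_deriv P) = 3 * fps_const l ^ 2 * P ^ 5"
proof -
  have "2 * (2 * fps_deriv (fps_deriv P)) = - (3 * fps_const l * P ^ 2 * (2 * fps_deriv P))"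
    using arg_cong[OF D_P, of fps_deriv] by (simp add: power3_eq_cube power2_eq_square algebra_simps)
  also have "\<dots> = 3 * fps_const l ^ 2 * P ^ 5"
    unfolding D_P by (simp add: eval_nat_numeral algebra_simps)
  finally show ?thesis by simp
qed

lemma \<alpha>_P: "\<alpha> * P ^ 2 = 1"
proof -
  have "\<alpha> * P ^ 2 = (P * p) ^ 2"
    by (simp add: p2[symmetric] power2_eq_square mult_ac)
  then show ?thesis by (simp add: P_p)
qed

text \<open>Each linear factor of the quadratic gives a solution, whatever the other factor is.
  Distinct factors give two; a double factor is complemented by \<open>ode_P_cube\<close>;
  \<open>\<beta>\<close> = 1 covers the linear case, where the constants are the other
  solutions.\<close>

lemma ode_P:
  assumes "fps_deriv \<beta> = fps_const m"
  shows "4 * (\<alpha> * \<beta>) * fps_deriv (fps_deriv P) + 6 * fps_deriv (\<alpha> * \<beta>) * fps_deriv P + 3 * fps_const (l * m) * P = 0"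
proof -
  have "4 * (\<alpha> * \<beta>) * fps_deriv (fps_deriv P) + 6 * fps_deriv (\<alpha> * \<beta>) * fps_deriv P + 3 * fps_const (l * m) * P
    = \<alpha> * \<beta> * (4 * fps_deriv (fps_deriv P)) + 3 * (\<alpha> * fps_const m + fps_const l * \<beta>) * (2 * fps_deriv P) + 3 * fps_const (l * m) * P"
    by (simp add: assms D\<alpha> algebra_simps del: fps_const_mult)
  also have "\<dots> = 3 * (\<alpha> * P ^ 2) * fps_const l ^ 2 * \<beta> * P ^ 3
    - 3 * (\<alpha> * P ^ 2) * fps_const m * fps_const l * P - 3 * fps_const l ^ 2 * \<beta> * P ^ 3
    + 3 * fps_const l * fps_const m * P"
    unfolding D_P D_D_P fps_const_mult[symmetric]
    by (simp add: eval_nat_numeral algebra_simps del: fps_const_mult)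
  also have "\<dots> = 0"
    unfolding \<alpha>_P by (simp add: algebra_simps del: fps_const_mult fps_const_power)
  finally show ?thesis .
qed

lemma ode_P_cube:
  "4 * (\<alpha> * \<alpha>) * fps_deriv (fps_deriv (P ^ 3)) + 6 * fps_deriv (\<alpha> * \<alpha>) * fps_deriv (P ^ 3) + 3 * fps_const (l * l) * P ^ 3 = 0"
proof -
  have D1: "2 * fps_deriv (P ^ 3) = - (3 * fps_const l * P ^ 5)"
  proof -
    have "2 * fps_deriv (P ^ 3) = 3 * P ^ 2 * (2 * fps_deriv P)"
      by (simp add: eval_nat_numeral algebra_simps)
    then show ?thesis
      unfolding D_P by (simp add: eval_nat_numeral algebra_simps)
  qed
  have D2: "4 * fps_deriv (fps_deriv (P ^ 3)) = 15 * fps_const l ^ 2 * P ^ 7"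
  proof -
    have "2 * (2 * fps_deriv (fps_deriv (P ^ 3))) = - (15 * fps_const l * P ^ 4 * (2 * fps_deriv P))"
      using arg_cong[OF D1, of fps_deriv] by (simp add: eval_nat_numeral algebra_simps)
    then show ?thesis
      unfolding D_P by (simp add: eval_nat_numeral algebra_simps)
  qed
  have "4 * (\<alpha> * \<alpha>) * fps_deriv (fps_deriv (P ^ 3)) + 6 * fps_deriv (\<alpha> * \<alpha>) * fps_deriv (P ^ 3) + 3 * fps_const (l * l) * P ^ 3
    = \<alpha> * \<alpha> * (4 * fps_deriv (fps_deriv (P ^ 3))) + 6 * \<alpha> * fps_const l * (2 * fps_deriv (P ^ 3)) + 3 * fps_const l ^ 2 * P ^ 3"
    by (simp add: D\<alpha> power2_eq_square algebra_simps)
  also have "\<dots> = 15 * (\<alpha> * P ^ 2) * (\<alpha> * P ^ 2) * fps_const l ^ 2 * P ^ 3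
    - 18 * (\<alpha> * P ^ 2) * fps_const l ^ 2 * P ^ 3 + 3 * fps_const l ^ 2 * P ^ 3"
    unfolding D1 D2 by (simp add: eval_nat_numeral algebra_simps)
  also have "\<dots> = 0"
    unfolding \<alpha>_P by (simp add: algebra_simps del: fps_const_power)
  finally show ?thesis .
qed

end

lemma fps_conic_of_root:
  assumes w2: "w ^ 2 = fps_const k + fps_const y1 * fps_X + fps_const y2 * fps_X ^ 2"
    and w0: "fps_nth w 0 \<noteq> 0"
    and wf: "w ^ 3 * fps_deriv (fps_deriv f) = fps_const c" and c: "c \<noteq> 0"
  shows "fps_conic f (fps_const (1 / fps_nth w 0) * w) (y1 / k) (y2 / k) (c / fps_nth w 0 ^ 3)"
    and "k \<noteq> 0"
    and "(fps_const (1 / fps_nth w 0) * w) ^ 2 = fps_const (1 / k) * w ^ 2"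
proof -
  let ?r = "fps_nth w 0"
  have k: "?r ^ 2 = k"
    using arg_cong[OF w2, of "\<lambda>h. fps_nth h 0"] by (simp add: fps_nth_power_0)
  show k0: "k \<noteq> 0"
    using k w0 by auto
  show z2: "(fps_const (1 / ?r) * w) ^ 2 = fps_const (1 / k) * w ^ 2"
    using k by (simp add: power_mult_distrib power_divide)
  have "fps_const (1 / k) * w ^ 2 = 1 + fps_const (y1 / k) * fps_X + fps_const (y2 / k) * fps_X ^ 2"
    unfolding w2 distrib_left mult.assoc[symmetric] fps_const_mult using k0 by simp
  moreover have "(fps_const (1 / ?r) * w) ^ 3 * fps_deriv (fps_deriv f) = fps_const (c / ?r ^ 3)"
  proof -
    have "(fps_const (1 / ?r) * w) ^ 3 * fps_deriv (fps_deriv f) = fps_const (1 / ?r ^ 3) * (w ^ 3 * fps_deriv (fps_deriv f))"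
      by (simp add: power_mult_distrib power_divide mult.assoc)
    then show ?thesis
      unfolding wf by simp
  qed
  ultimately show "fps_conic f (fps_const (1 / ?r) * w) (y1 / k) (y2 / k) (c / ?r ^ 3)"
    using c w0 z2 by (simp add: fps_conic_def)
qed

lemma fps_admissible_of_root:
  assumes w2: "w ^ 2 = Y" and Y: "Y = fps_const k + fps_const y1 * fps_X + fps_const y2 * fps_X ^ 2"
    and w0: "fps_nth w 0 \<noteq> 0"
    and wf: "w ^ 3 * fps_deriv (fps_deriv f) = fps_const c" "c \<noteq> 0"
    and u: "4 * Y * fps_deriv (fps_deriv u) + 6 * fps_deriv Y * fps_deriv u + 3 * fps_const y2 * u = 0"
    and v: "4 * Y * fps_deriv (fps_deriv v) + 6 * fps_deriv Y * fps_deriv v + 3 * fps_const y2 * v = 0"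
    and g: "g = fps_const c1 * u + fps_const c2 * v" "g \<noteq> 0"
  shows "fps_admissible f g"
proof -
  note * = fps_conic_of_root[OF w2[unfolded Y] w0 wf]
  have "fps_ode (fps_const (1 / fps_nth w 0) * w) (y2 / k) h \<longleftrightarrow>
    4 * Y * fps_deriv (fps_deriv h) + 6 * fps_deriv Y * fps_deriv h + 3 * fps_const y2 * h = 0" for h
    by (rule fps_ode_iff[of _ "1 / k"]) (use *(2,3) w2 in simp_all)
  then have "fps_ode (fps_const (1 / fps_nth w 0) * w) (y2 / k) g"
    unfolding g(1) using u v by (intro fps_ode_add fps_ode_scale) simp_all
  then show ?thesis
    using *(1) g(2) by (auto simp: fps_admissible_iff)
qed

lemma fps_coord_square: "fps_coord a ^ 2 = fps_const (a ^ 2) + fps_const (2 * a) * fps_X + fps_const 1 * fps_X ^ 2"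
  for a :: "'a::field_char_0"
  by (simp add: fps_coord_def power2_eq_square algebra_simps numeral_fps_const)

lemma fps_listed_imp_admissible:
  fixes a :: "'a::field_char_0"
  assumes "fps_listed a f g"
  shows "fps_admissible f g"
proof -
  obtain c1 c2 where c: "c1 \<noteq> 0 \<or> c2 \<noteq> 0" and
    "fps_pair1 c1 c2 a f g \<or> fps_pair2 c1 c2 a f g \<or> fps_pair3 c1 c2 a f g \<or> fps_pair4 c1 c2 a f g"
    using assms by (auto simp: fps_listed_def)
  then consider "fps_pair1 c1 c2 a f g" | "fps_pair2 c1 c2 a f g" | "fps_pair3 c1 c2 a f g" | "fps_pair4 c1 c2 a f g"
    by blast
  then show ?thesis
  proof cases
    case 1
    let ?x = "fps_coord a"
    from 1 obtain p q where f: "f ^ 2 = ?x ^ 2 - 1" and p: "p ^ 2 = ?x + 1" and q: "q ^ 2 = ?x - 1"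
      and g: "g = fps_const c1 * inverse p + fps_const c2 * inverse q"
      by (auto simp: fps_pair1_def)
    have p0: "fps_nth p 0 \<noteq> 0" and q0: "fps_nth q 0 \<noteq> 0"
      by (rule fps_square_nth_0_nonzero, simp add: p q)+
    have pq: "f ^ 2 = p ^ 2 * q ^ 2"
      unfolding f p q by (simp add: power2_eq_square algebra_simps)
    have f0: "fps_nth f 0 \<noteq> 0"
      by (rule fps_square_nth_0_nonzero) (simp add: pq p0 q0 fps_nth_power_0)
    interpret P: fps_linear_root p "?x + 1" 1
      by standard (simp_all add: p p0)
    interpret Q: fps_linear_root q "?x - 1" 1
      by standard (simp_all add: q q0)
    have Y: "(?x + 1) * (?x - 1) = ?x ^ 2 - 1"
      by (simp add: power2_eq_square algebra_simps)
    have D1: "f * fps_deriv f = ?x"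
    proof -
      have "2 * (f * fps_deriv f) = 2 * ?x"
        using arg_cong[OF f, of fps_deriv] by (simp add: power2_eq_square algebra_simps)
      then show ?thesis by (simp only: mult_cancel_left) simp
    qed
    have D2: "fps_deriv f ^ 2 + f * fps_deriv (fps_deriv f) = 1"
      using arg_cong[OF D1, of fps_deriv] by (simp add: power2_eq_square add.commute)
    have "f ^ 3 * fps_deriv (fps_deriv f) = f ^ 2 * (fps_deriv f ^ 2 + f * fps_deriv (fps_deriv f)) - (f * fps_deriv f) ^ 2"
      by (simp add: power2_eq_square power3_eq_cube algebra_simps)
    then have wf: "f ^ 3 * fps_deriv (fps_deriv f) = fps_const (- 1)"
      unfolding D1 D2 f by simp
    have "g \<noteq> 0"
    proof
      assume "g = 0"
      have "fps_const c1 * q + fps_const c2 * p = fps_const c1 * (inverse p * p) * q + fps_const c2 * (inverse q * q) * p"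
        by (simp add: P.P_p Q.P_p)
      also have "\<dots> = g * p * q"
        unfolding g by (simp add: algebra_simps)
      finally have "fps_const c1 * q = - (fps_const c2 * p)"
        using \<open>g = 0\<close> by (simp add: eq_neg_iff_add_eq_0)
      \<comment> \<open>Squaring removes the roots; the coefficients of the resulting linear
        polynomials force c1 = c2 = 0.\<close>
      then have "(fps_const c1 * q) ^ 2 = (fps_const c2 * p) ^ 2"
        by simp
      then have eq: "fps_const (c1 ^ 2) * (?x - 1) = fps_const (c2 ^ 2) * (?x + 1)"
        by (simp add: power_mult_distrib p q)
      have "c1 ^ 2 * (a - 1) = c2 ^ 2 * (a + 1)" "c1 ^ 2 = c2 ^ 2"
        using arg_cong[OF eq, of "\<lambda>h. fps_nth h 0"] arg_cong[OF eq, of "\<lambda>h. fps_nth h (Suc 0)"] by simp_all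
      then show False
        using c by (auto simp: algebra_simps)
    qed
    show ?thesis
    proof (rule fps_admissible_of_root[OF _ _ f0 wf])
      show "f ^ 2 = (?x + 1) * (?x - 1)"
        unfolding f Y ..
      show "(?x + 1) * (?x - 1) = fps_const (a ^ 2 - 1) + fps_const (2 * a) * fps_X + fps_const (1 * 1) * fps_X ^ 2"
        unfolding Y fps_coord_square fps_const_sub[symmetric] by simp
      show "4 * ((?x + 1) * (?x - 1)) * fps_deriv (fps_deriv (inverse p))
          + 6 * fps_deriv ((?x + 1) * (?x - 1)) * fps_deriv (inverse p) + 3 * fps_const (1 * 1) * inverse p = 0"
        by (rule P.ode_P) simp
      show "4 * ((?x + 1) * (?x - 1)) * fps_deriv (fps_deriv (inverse q))
          + 6 * fps_deriv ((?x + 1) * (?x - 1)) * fps_deriv (inverse q) + 3 * fps_const (1 * 1) * inverse q = 0"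
        unfolding mult.commute[of "?x + 1" "?x - 1"] by (rule Q.ode_P) simp
    qed (use g \<open>g \<noteq> 0\<close> in simp_all)
  next
    case 2
    let ?x = "fps_coord a"
    from 2 obtain s where a: "a \<noteq> 0" and f: "f = inverse ?x" and s: "s ^ 2 = ?x"
      and g: "g = fps_const c1 * inverse s + fps_const c2 * inverse (s ^ 3)"
      by (auto simp: fps_pair2_def)
    have s0: "fps_nth s 0 \<noteq> 0"
      by (rule fps_square_nth_0_nonzero) (simp add: s)
    interpret S: fps_linear_root s ?x 1
      by standard (simp_all add: s s0)
    have xx: "inverse ?x * ?x = 1"
      using a by (intro inverse_mult_eq_1) simp
    have "?x ^ 3 * fps_deriv (fps_deriv f) = 2 * (inverse ?x * ?x) ^ 3"
      using a by (simp add: f fps_deriv_inverse_eq power2_eq_square power3_eq_cube algebra_simps)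
    then have wf: "?x ^ 3 * fps_deriv (fps_deriv f) = fps_const 2"
      unfolding xx by (simp add: numeral_fps_const)
    have s3: "inverse (s ^ 3) = inverse s ^ 3"
      by (simp add: fps_inverse_power)
    have "g \<noteq> 0"
    proof
      assume "g = 0"
      have "fps_const c1 * s ^ 2 + fps_const c2 = fps_const c1 * s ^ 2 * (inverse s * s) + fps_const c2 * (inverse s * s) ^ 3"
        by (simp add: S.P_p)
      also have "\<dots> = g * s ^ 3"
        unfolding g s3 by (simp add: power2_eq_square power3_eq_cube algebra_simps)
      finally have eq: "fps_const c1 * ?x + fps_const c2 = 0"
        using \<open>g = 0\<close> s by simp
      show False
        using c arg_cong[OF eq, of "\<lambda>h. fps_nth h 0"] arg_cong[OF eq, of "\<lambda>h. fps_nth h (Suc 0)"] by simp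
    qed
    then show ?thesis
      using S.ode_P[of ?x 1] S.ode_P_cube a
      by (intro fps_admissible_of_root[OF _ fps_coord_square _ wf _ _ _ g[unfolded s3]])
        (simp_all add: power2_eq_square)
  next
    case 3
    let ?x = "fps_coord a"
    \<comment> \<open>The roots f and s may be opposite branches. Only f determines the conic, while
      s enters only the linear equation.\<close>
    from 3 obtain s where f: "f ^ 2 = ?x" and s: "s ^ 2 = ?x"
      and g: "g = fps_const c1 + fps_const c2 * inverse s"
      by (auto simp: fps_pair3_def)
    have s0: "fps_nth s 0 \<noteq> 0" and f0: "fps_nth f 0 \<noteq> 0"
      by (rule fps_square_nth_0_nonzero, simp add: s f)+
    interpret S: fps_linear_root s ?x 1
      by standard (simp_all add: s s0)
    have D1: "2 * (f * fps_deriv f) = 1"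
      using arg_cong[OF f, of fps_deriv] by (simp add: power2_eq_square algebra_simps)
    have "2 * (fps_deriv f ^ 2 + f * fps_deriv (fps_deriv f)) = 0"
      using arg_cong[OF D1, of fps_deriv] by (simp add: power2_eq_square algebra_simps)
    then have D2: "fps_deriv f ^ 2 + f * fps_deriv (fps_deriv f) = 0"
      by (simp only: mult_eq_0_iff) simp
    have "4 * (f ^ 3 * fps_deriv (fps_deriv f)) = 4 * f ^ 2 * (fps_deriv f ^ 2 + f * fps_deriv (fps_deriv f)) - (2 * (f * fps_deriv f)) ^ 2"
      by (simp add: power2_eq_square power3_eq_cube algebra_simps)
    also have "\<dots> = 4 * fps_const (- 1 / 4)"
      unfolding D1 D2 by (simp add: numeral_fps_const)
    finally have wf: "f ^ 3 * fps_deriv (fps_deriv f) = fps_const (- 1 / 4)"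
      by (simp only: mult_cancel_left) simp
    have "g \<noteq> 0"
    proof
      assume "g = 0"
      have "fps_const c1 * s + fps_const c2 = g * s"
        unfolding g using S.P_p by (simp add: algebra_simps)
      then have "fps_const c1 * s = - fps_const c2"
        using \<open>g = 0\<close> by (simp add: eq_neg_iff_add_eq_0 del: fps_const_neg)
      then have "(fps_const c1 * s) ^ 2 = (fps_const c2) ^ 2"
        by simp
      then have eq: "fps_const (c1 ^ 2) * ?x = fps_const (c2 ^ 2)"
        by (simp add: power_mult_distrib s)
      show False
        using c arg_cong[OF eq, of "\<lambda>h. fps_nth h 0"] arg_cong[OF eq, of "\<lambda>h. fps_nth h (Suc 0)"] by simp
    qed
    then show ?thesis
      using S.ode_P[of 1 0] f0 g
      by (intro fps_admissible_of_root[where u = 1 and v = "inverse s", OF f _ f0 wf, of a 1 0 g c1 c2])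
        (simp_all add: fps_coord_def)
  next
    case 4
    let ?x = "fps_coord a"
    from 4 have f: "f = ?x ^ 2" and g: "g = fps_const c1 + fps_const c2 * ?x"
      by (auto simp: fps_pair4_def)
    have "g \<noteq> 0"
    proof
      assume "g = 0"
      then have eq: "fps_const c1 + fps_const c2 * ?x = 0"
        using g by simp
      show False
        using c arg_cong[OF eq, of "\<lambda>h. fps_nth h 0"] arg_cong[OF eq, of "\<lambda>h. fps_nth h (Suc 0)"] by simp
    qed
    moreover have "fps_deriv (fps_deriv f) = fps_const 2"
      unfolding f by (simp add: power2_eq_square numeral_fps_const)
    ultimately show ?thesis
      using g by (intro fps_admissible_of_root[where w = 1 and Y = 1 and k = 1 and ?y1.0 = 0 and ?y2.0 = 0
            and u = 1 and v = ?x and ?c1.0 = c1 and ?c2.0 = c2 and c = 2]) simp_all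
  qed
qed

section \<open>Classification over an algebraically closed field\<close>

abbreviation fps_rescale :: "'a::field_char_0 \<Rightarrow> 'a fps \<Rightarrow> 'a fps" where
  "fps_rescale l h \<equiv> h oo (fps_const l * fps_X)"

lemma fps_rescale_inverse_rescale: "l \<noteq> 0 \<Longrightarrow> fps_rescale l (fps_rescale (1 / l) h) = h"
  by (intro fps_ext) (simp add: power_divide)

lemma fps_rescale_1 [simp]: "fps_rescale 1 h = h"
  by (intro fps_ext) (simp del: fps_const_1_eq_1)

lemma fps_rescale_coord: "fps_rescale l (fps_coord b) = fps_const b + fps_const l * fps_X"
  by (simp add: fps_coord_def fps_compose_add_distrib)

lemma fps_rescale_power: "fps_rescale l (h ^ n) = fps_rescale l h ^ n"
  by (simp add: fps_compose_power)

lemma fps_rescale_inverse: "fps_nth h 0 \<noteq> 0 \<Longrightarrow> fps_rescale l (inverse h) = inverse (fps_rescale l h)"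
  by (simp add: fps_inverse_compose)

lemma fps_sqrt_exists:
  fixes A :: "'a::{field_char_0, alg_closed_field} fps"
  assumes "fps_nth A 0 \<noteq> 0"
  obtains p where "p ^ 2 = A"
proof -
  obtain r where r: "r ^ 2 = fps_nth A 0"
    using nth_root_exists[of 2] by auto
  define B where "B = fps_const (1 / fps_nth A 0) * A"
  have B0: "fps_nth B 0 = 1"
    using assms by (simp add: B_def)
  have "(fps_const r * (fps_binomial (1/2) oo (B - 1))) ^ 2 = fps_const (fps_nth A 0) * (fps_binomial 1 oo (B - 1))"
    using B0 by (simp add: power_mult_distrib r fps_binomial_compose_power)
  also have "fps_binomial 1 oo (B - 1) = B"
    using B0 by (simp add: fps_binomial_1 fps_compose_add_distrib)
  also have "fps_const (fps_nth A 0) * B = A"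
    using assms by (simp add: B_def mult.assoc[symmetric])
  finally show ?thesis
    by (rule that)
qed

lemma fps_deriv2_eq_imp_affine:
  fixes f h :: "'a::field_char_0 fps"
  assumes "fps_deriv (fps_deriv f) = fps_deriv (fps_deriv h)"
  obtains m1 m2 where "f = h + fps_const m1 + fps_const m2 * fps_coord a"
proof -
  define m2 where "m2 = fps_nth f 1 - fps_nth h 1"
  define m1 where "m1 = fps_nth f 0 - fps_nth h 0 - m2 * a"
  have "fps_deriv f = fps_deriv (h + fps_const m1 + fps_const m2 * fps_coord a)"
    by (rule fps_eqI_deriv) (simp_all add: assms m2_def)
  then have "f = h + fps_const m1 + fps_const m2 * fps_coord a"
    by (rule fps_eqI_deriv) (simp add: m1_def)
  then show ?thesis by (rule that)
qed

text \<open>Comparing second derivatives suffices because m1 + m2 x absorbs the constants of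
  integration; the base points force l0 = b - l a.\<close>

lemma fps_equivI:
  fixes f :: "'a::field_char_0 fps"
  assumes l: "l \<noteq> 0" and m0: "m0 \<noteq> 0"
    and f: "fps_deriv (fps_deriv f) = fps_const m0 * fps_deriv (fps_deriv (fps_rescale l F))"
    and g: "g = fps_rescale l G"
  shows "fps_equiv a f g b F G"
proof -
  have "fps_deriv (fps_deriv f) = fps_deriv (fps_deriv (fps_const m0 * fps_rescale l F))"
    using f by simp
  then obtain m1 m2 where "f = fps_const m0 * fps_rescale l F + fps_const m1 + fps_const m2 * fps_coord a"
    by (rule fps_deriv2_eq_imp_affine)
  then show ?thesis
    unfolding fps_equiv_def using l m0 g
    by (intro exI[of _ "b - l * a"] exI[of _ l] exI[of _ m0] exI[of _ m1] exI[of _ m2]) simp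
qed

lemma fps_linear_root_nth_1:
  assumes "fps_linear_root p \<alpha> l"
  shows "2 * fps_nth (inverse p) 1 = - (l * inverse (fps_nth p 0) ^ 3)"
proof -
  interpret fps_linear_root p \<alpha> l by fact
  have "fps_nth (2 * fps_deriv P) 0 = fps_nth (- (fps_const l * P ^ 3)) 0"
    unfolding D_P ..
  then show ?thesis
    by (simp add: fps_nth_power_0 numeral_fps_const del: fps_const_neg)
qed

lemma fps_conic_imp_listed_equiv:
  fixes f g :: "'a::{field_char_0, alg_closed_field} fps"
  assumes conic: "fps_conic f z y1 y2 c" and ode: "fps_ode z y2 g" and g0: "g \<noteq> 0"
  shows "\<exists>b F G. fps_listed b F G \<and> fps_equiv a f g b F G"
proof -
  let ?X = "fps_X :: 'a fps" and ?D = fps_deriv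
  from conic have c: "c \<noteq> 0" and z0: "fps_nth z 0 = 1"
    and z2: "z ^ 2 = 1 + fps_const y1 * ?X + fps_const y2 * ?X ^ 2"
    and zf: "z ^ 3 * ?D (?D f) = fps_const c"
    by (auto simp: fps_conic_def)
  have z: "z \<noteq> 0" using z0 by auto
  \<comment> \<open>Now t is the base point itself: the scalars are field elements, r is the
    constant term 1 of z, and \<open>D_D_s_cube\<close> evaluates z^3 z''.\<close>
  interpret conic_arc 1 y1 y2 z
    by standard (simp_all add: z0 z2)
  define \<delta> where "\<delta> = y2 - y1 ^ 2 / 4"
  have zz: "z ^ 3 * ?D (?D z) = fps_const \<delta>"
    using D_D_s_cube by (simp add: \<delta>_def)
  \<comment> \<open>Both f'' and k'' are multiples of z^(-3), hence proportional. The series z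
    itself can play the role of k unless \<open>\<delta>\<close> = 0.\<close>
  have f_eq: "?D (?D f) = fps_const (c / (e * d)) * ?D (?D h)"
    if "h = fps_const e * k" "z ^ 3 * ?D (?D k) = fps_const d" "e \<noteq> 0" "d \<noteq> 0" for h k d e
  proof -
    have "z ^ 3 * (fps_const (c / (e * d)) * ?D (?D h)) = fps_const (c / (e * d) * e) * (z ^ 3 * ?D (?D k))"
      by (simp add: that(1) mult_ac)
    also have "\<dots> = z ^ 3 * ?D (?D f)"
      unfolding that(2) zf using that(3,4) by simp
    finally show ?thesis using z by simp
  qed
  consider "y2 = 0" "y1 = 0" | "y2 = 0" "y1 \<noteq> 0" | "y2 \<noteq> 0" "\<delta> = 0" | "y2 \<noteq> 0" "\<delta> \<noteq> 0"
    by blast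
  then show ?thesis
  proof cases
    case 1
    have z1: "z = 1"
      by (rule fps_square_eqI) (simp_all add: z0 z2 1)
    have "?D (?D g) = ?D (?D 0)"
      using ode 1 by (simp add: fps_ode_def z1)
    then obtain c1 c2 where g: "g = 0 + fps_const c1 + fps_const c2 * fps_coord a"
      by (rule fps_deriv2_eq_imp_affine)
    then have "c1 \<noteq> 0 \<or> c2 \<noteq> 0"
      using g0 by auto
    then have "fps_listed a (fps_coord a ^ 2) g"
      using g by (auto simp: fps_listed_def fps_pair4_def)
    moreover have "fps_equiv a f g a (fps_coord a ^ 2) g"
    proof (rule fps_equivI)
      have "?D (?D (fps_coord a ^ 2)) = 2"
        by (simp add: power2_eq_square)
      then show "?D (?D f) = fps_const (c / 2) * ?D (?D (fps_rescale 1 (fps_coord a ^ 2)))"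
        using zf by (simp add: z1 numeral_fps_const)
    qed (use c in simp_all)
    ultimately show ?thesis by blast
  next
    case 2
    \<comment> \<open>Rescaling by y1 turns 1 + y1 X into 1 + X, which is the coordinate x at the
      base point 1, so F is a germ of the root of x there.\<close>
    define F where "F = fps_rescale (1 / y1) z"
    have SF: "fps_rescale y1 F = z"
      unfolding F_def by (rule fps_rescale_inverse_rescale[OF 2(2)])
    have F2: "F ^ 2 = fps_coord 1"
      unfolding F_def fps_rescale_power[symmetric] z2 using 2
      by (simp add: fps_coord_def fps_compose_add_distrib fps_compose_mult_distrib mult.assoc[symmetric])
    have F0: "fps_nth F 0 = 1"
      by (simp add: F_def z0)
    interpret Z: fps_linear_root z "z ^ 2" y1
      by standard (simp_all add: z2 z0 2)
    have "fps_ode z y2 1"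
      by (simp add: fps_ode_def 2)
    moreover have "fps_ode z y2 (inverse z)"
      using Z.ode_P[of 1 0] by (subst fps_ode_iff[of _ 1 "z ^ 2" _ 0]) (simp_all add: 2)
    moreover have "fps_nth 1 0 * fps_nth (inverse z) 1 - fps_nth 1 1 * fps_nth (inverse z) 0 \<noteq> 0"
      using fps_linear_root_nth_1[OF Z.fps_linear_root_axioms] 2 by (auto simp: z0)
    ultimately obtain c1 c2 where g: "g = fps_const c1 * 1 + fps_const c2 * inverse z"
      using fps_ode_combination[OF z2 ode, of 1 "inverse z"] by blast
    have "c1 \<noteq> 0 \<or> c2 \<noteq> 0"
      using g0 g by auto
    then have "fps_listed 1 F (fps_const c1 + fps_const c2 * inverse F)"
      using F2 by (auto simp: fps_listed_def fps_pair3_def)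
    moreover have "fps_equiv a f g 1 F (fps_const c1 + fps_const c2 * inverse F)"
    proof (rule fps_equivI)
      show "?D (?D f) = fps_const (c / (1 * \<delta>)) * ?D (?D (fps_rescale y1 F))"
        unfolding SF by (rule f_eq) (use zz 2 in \<open>simp_all add: \<delta>_def\<close>)
      have "fps_rescale y1 (fps_const c1 + fps_const c2 * inverse F) = fps_const c1 + fps_const c2 * inverse (fps_rescale y1 F)"
        by (simp add: fps_compose_add_distrib fps_compose_mult_distrib fps_rescale_inverse F0)
      then show "g = fps_rescale y1 (fps_const c1 + fps_const c2 * inverse F)"
        unfolding SF g by simp
    qed (use c 2 in \<open>simp_all add: \<delta>_def\<close>)
    ultimately show ?thesis by blast
  next
    case 3
    \<comment> \<open>A double root makes z = 1 + h X affine, so z is the new coordinate x. Since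
      z'' = 0, f must be compared with 1/z instead of z.\<close>
    define h where "h = y1 / 2"
    have y: "y1 = 2 * h" "y2 = h * h"
      using 3 by (simp_all add: h_def \<delta>_def power2_eq_square)
    have h: "h \<noteq> 0"
      using 3 y by auto
    have zh: "z = 1 + fps_const h * ?X"
    proof (rule fps_square_eqI)
      show "z ^ 2 = (1 + fps_const h * ?X) ^ 2"
        unfolding z2 y by (simp add: power2_eq_square algebra_simps numeral_fps_const)
    qed (simp_all add: z0)
    have x0: "fps_nth (fps_coord (1::'a)) 0 \<noteq> 0"
      by simp
    define s where "s = (fps_binomial (1/2) :: 'a fps)"
    have s2: "s ^ 2 = fps_coord 1"
      by (simp add: s_def fps_binomial_power fps_binomial_1 fps_coord_def)
    have s0: "fps_nth s 0 = 1"
      by (simp add: s_def)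
    define t where "t = fps_rescale h s"
    have t2: "t ^ 2 = z"
      unfolding t_def fps_rescale_power[symmetric] s2 by (simp add: fps_rescale_coord zh)
    have t0: "fps_nth t 0 = 1"
      by (simp add: t_def s0)
    interpret T: fps_linear_root t z h
      by standard (simp_all add: t2 t0 zh)
    have ode_iff: "fps_ode z y2 k \<longleftrightarrow> 4 * (z * z) * ?D (?D k) + 6 * ?D (z * z) * ?D k + 3 * fps_const (h * h) * k = 0" for k
      by (rule fps_ode_iff[of _ 1]) (simp_all add: y power2_eq_square)
    have u: "fps_ode z y2 (inverse t)"
      unfolding ode_iff by (rule T.ode_P) (simp add: zh)
    have v: "fps_ode z y2 (inverse t ^ 3)"
      unfolding ode_iff by (rule T.ode_P_cube)
    have t1: "2 * fps_nth (inverse t) 1 = - h"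
      using fps_linear_root_nth_1[OF T.fps_linear_root_axioms] by (simp add: t0)
    have "fps_nth (inverse t ^ 3) 1 = 3 * fps_nth (inverse t) 1"
      by (simp add: power3_eq_cube fps_mult_nth t0)
    then have "fps_nth (inverse t) 0 * fps_nth (inverse t ^ 3) 1 - fps_nth (inverse t) 1 * fps_nth (inverse t ^ 3) 0 = - h"
      using t1 by (simp add: t0 fps_nth_power_0)
    then have "fps_nth (inverse t) 0 * fps_nth (inverse t ^ 3) 1 - fps_nth (inverse t) 1 * fps_nth (inverse t ^ 3) 0 \<noteq> 0"
      using h by simp
    then obtain c1 c2 where g: "g = fps_const c1 * inverse t + fps_const c2 * inverse t ^ 3"
      using fps_ode_combination[OF z2 ode u v] by blast
    have "c1 \<noteq> 0 \<or> c2 \<noteq> 0"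
      using g0 g by auto
    then have "fps_listed 1 (inverse (fps_coord 1)) (fps_const c1 * inverse s + fps_const c2 * inverse (s ^ 3))"
      using s2 by (auto simp: fps_listed_def fps_pair2_def)
    moreover have "fps_equiv a f g 1 (inverse (fps_coord 1)) (fps_const c1 * inverse s + fps_const c2 * inverse (s ^ 3))"
    proof (rule fps_equivI)
      have iz: "fps_rescale h (inverse (fps_coord 1)) = inverse z"
        by (simp add: fps_rescale_inverse fps_rescale_coord zh)
      have zi: "inverse z * z = 1"
        by (rule inverse_mult_eq_1) (simp add: z0)
      have "z ^ 3 * ?D (?D (inverse z)) = 2 * fps_const h ^ 2 * (inverse z * z) ^ 3"
      proof -
        have "?D (inverse z) = - (fps_const h * inverse z ^ 2)"
          by (simp add: fps_deriv_inverse_eq z0) (simp add: zh)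
        then have "?D (?D (inverse z)) = - (fps_const h * (2 * inverse z * ?D (inverse z)))"
          by (simp add: power2_eq_square algebra_simps)
        then have "?D (?D (inverse z)) = 2 * fps_const h ^ 2 * inverse z ^ 3"
          unfolding \<open>?D (inverse z) = _\<close> by (simp add: power2_eq_square power3_eq_cube algebra_simps)
        then show ?thesis
          by (simp add: power_mult_distrib mult_ac)
      qed
      then have "z ^ 3 * ?D (?D (inverse z)) = fps_const (2 * h ^ 2)"
        unfolding zi by (simp add: numeral_fps_const)
      then show "?D (?D f) = fps_const (c / (1 * (2 * h ^ 2))) * ?D (?D (fps_rescale h (inverse (fps_coord 1))))"
        unfolding iz by (intro f_eq) (use h in simp_all)
      have "fps_rescale h (fps_const c1 * inverse s + fps_const c2 * inverse (s ^ 3))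
          = fps_const c1 * inverse t + fps_const c2 * inverse (t ^ 3)"
        by (simp add: fps_compose_add_distrib fps_compose_mult_distrib fps_rescale_inverse s0 fps_nth_power_0 fps_rescale_power t_def)
      then show "g = fps_rescale h (fps_const c1 * inverse s + fps_const c2 * inverse (s ^ 3))"
        unfolding g by (simp add: fps_inverse_power)
    qed (use c h in simp_all)
    ultimately show ?thesis by blast
  next
    case 4
    \<comment> \<open>Completing the square gives z^2 = y2 ((X + h)^2 - d^2). The new coordinate is
      x = (X + h) / d, with value b at the base point, and z^2 = k (x^2 - 1) with k = y2
      d^2.\<close>
    obtain d where d: "d ^ 2 = (y1 ^ 2 - 4 * y2) / (4 * y2 ^ 2)"
      using nth_root_exists[of 2] by auto
    define h where "h = y1 / (2 * y2)"
    define b where "b = h / d"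
    have "y1 ^ 2 - 4 * y2 \<noteq> 0"
      using 4(2) by (auto simp: \<delta>_def)
    then have "d ^ 2 \<noteq> 0"
      unfolding d using 4(1) by simp
    then have dnz: "d \<noteq> 0" by simp
    have hd: "h ^ 2 - d ^ 2 = 1 / y2"
      unfolding d h_def using 4(1) by (simp add: power2_eq_square field_simps)
    have y1: "y1 = 2 * y2 * h"
      using 4(1) by (simp add: h_def)
    have b2: "b ^ 2 - 1 = 1 / (y2 * d ^ 2)"
    proof -
      have "b ^ 2 - 1 = (h ^ 2 - d ^ 2) / d ^ 2"
        using dnz by (simp add: b_def power_divide diff_divide_distrib)
      then show ?thesis
        unfolding hd by simp
    qed
    then have "(b + 1) * (b - 1) \<noteq> 0"
      using 4(1) dnz by (simp add: power2_eq_square algebra_simps)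
    then have b: "b + 1 \<noteq> 0" "b - 1 \<noteq> 0"
      by auto
    obtain p where p: "p ^ 2 = fps_coord b + 1"
      using fps_sqrt_exists[of "fps_coord b + 1"] b(1) by auto
    obtain q where q: "q ^ 2 = fps_coord b - 1"
      using fps_sqrt_exists[of "fps_coord b - 1"] b(2) by auto
    have p0: "fps_nth p 0 \<noteq> 0" and q0: "fps_nth q 0 \<noteq> 0"
      by (rule fps_square_nth_0_nonzero, use b in \<open>simp add: p q\<close>)+
    define l where "l = 1 / d"
    have l: "l \<noteq> 0" using dnz by (simp add: l_def)
    define P where "P = fps_rescale l p"
    define Q where "Q = fps_rescale l q"
    let ?x = "fps_const b + fps_const l * ?X"
    have P2: "P ^ 2 = ?x + 1" and Q2: "Q ^ 2 = ?x - 1"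
      unfolding P_def Q_def fps_rescale_power[symmetric] p q
      by (simp_all add: fps_compose_add_distrib fps_compose_sub_distrib fps_rescale_coord)
    have P0: "fps_nth P 0 = fps_nth p 0" and Q0: "fps_nth Q 0 = fps_nth q 0"
      by (simp_all add: P_def Q_def)
    interpret P: fps_linear_root P "?x + 1" l
      by standard (simp_all add: P2 P0 p0)
    interpret Q: fps_linear_root Q "?x - 1" l
      by standard (simp_all add: Q2 Q0 q0)
    define k where "k = y2 * d ^ 2"
    have k: "k \<noteq> 0" using dnz 4(1) by (simp add: k_def)
    have z2k: "z ^ 2 = fps_const k * ((?x + 1) * (?x - 1))"
    proof -
      have xx: "(?x + 1) * (?x - 1) = fps_const (b ^ 2 - 1) + fps_const (2 * b * l) * ?X + fps_const (l ^ 2) * ?X ^ 2"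
        by (simp add: power2_eq_square algebra_simps numeral_fps_const flip: fps_const_sub)
      have "fps_const k * ((?x + 1) * (?x - 1)) = fps_const (k * (b ^ 2 - 1)) + fps_const (k * (2 * b * l)) * ?X + fps_const (k * l ^ 2) * ?X ^ 2"
        unfolding xx distrib_left mult.assoc[symmetric] fps_const_mult ..
      moreover have "k * (b ^ 2 - 1) = 1"
        unfolding b2 k_def using dnz 4(1) by simp
      moreover have "k * (2 * b * l) = y1" "k * l ^ 2 = y2"
        using dnz by (simp_all add: k_def b_def l_def y1 power2_eq_square)
      ultimately show ?thesis
        by (simp add: z2)
    qed
    have ode_iff: "fps_ode z y2 w \<longleftrightarrow> 4 * ((?x + 1) * (?x - 1)) * ?D (?D w) + 6 * ?D ((?x + 1) * (?x - 1)) * ?D w + 3 * fps_const (l * l) * w = 0" for w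
      by (rule fps_ode_iff[OF z2k k]) (use dnz in \<open>simp add: k_def l_def power2_eq_square\<close>)
    have u: "fps_ode z y2 (inverse P)"
      unfolding ode_iff by (rule P.ode_P) simp
    have v: "fps_ode z y2 (inverse Q)"
      unfolding ode_iff mult.commute[of "?x + 1" "?x - 1"] by (rule Q.ode_P) simp
    have wr: "fps_nth (inverse P) 0 * fps_nth (inverse Q) 1 - fps_nth (inverse P) 1 * fps_nth (inverse Q) 0 \<noteq> 0"
    proof -
      let ?r = "inverse (fps_nth p 0)" and ?s = "inverse (fps_nth q 0)"
      have "fps_nth p 0 ^ 2 = b + 1" "fps_nth q 0 ^ 2 = b - 1"
        using arg_cong[OF p, of "\<lambda>h. fps_nth h 0"] arg_cong[OF q, of "\<lambda>h. fps_nth h 0"] by (simp_all add: fps_nth_power_0)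
      then have 2: "fps_nth p 0 ^ 2 - fps_nth q 0 ^ 2 = 2"
        by simp
      have "2 * (fps_nth (inverse P) 0 * fps_nth (inverse Q) 1 - fps_nth (inverse P) 1 * fps_nth (inverse Q) 0)
        = fps_nth (inverse P) 0 * (2 * fps_nth (inverse Q) 1) - (2 * fps_nth (inverse P) 1) * fps_nth (inverse Q) 0"
        by (simp add: algebra_simps)
      also have "\<dots> = - (l * (?r * ?s ^ 3)) + l * (?r ^ 3 * ?s)"
        unfolding fps_linear_root_nth_1[OF P.fps_linear_root_axioms] fps_linear_root_nth_1[OF Q.fps_linear_root_axioms]
        by (simp add: P0 Q0)
      also have "\<dots> = - l * ?r ^ 3 * ?s ^ 3 * (fps_nth p 0 ^ 2 - fps_nth q 0 ^ 2)"
        using p0 q0 by (simp add: power2_eq_square power3_eq_cube field_simps)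
      also have "\<dots> \<noteq> 0"
        unfolding 2 using l p0 q0 by simp
      finally show ?thesis by auto
    qed
    obtain c1 c2 where g: "g = fps_const c1 * inverse P + fps_const c2 * inverse Q"
      using fps_ode_combination[OF z2 ode u v wr] .
    have "c1 \<noteq> 0 \<or> c2 \<noteq> 0"
      using g0 g by auto
    moreover have "(p * q) ^ 2 = fps_coord b ^ 2 - 1"
      unfolding power_mult_distrib p q by (simp add: power2_eq_square algebra_simps)
    ultimately have "fps_listed b (p * q) (fps_const c1 * inverse p + fps_const c2 * inverse q)"
      using p q unfolding fps_listed_def fps_pair1_def by blast
    moreover have "fps_equiv a f g b (p * q) (fps_const c1 * inverse p + fps_const c2 * inverse q)"
    proof (rule fps_equivI)
      \<comment> \<open>P Q and z are roots of proportional quadratics; their ratio e is read off at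
        the base point, where z is 1.\<close>
      define e where "e = fps_nth p 0 * fps_nth q 0"
      have e: "e \<noteq> 0" using p0 q0 by (simp add: e_def)
      have "fps_const k * (P * Q) ^ 2 = z ^ 2"
        unfolding z2k power_mult_distrib P2 Q2 ..
      from arg_cong[OF this, of "\<lambda>h. fps_nth h 0"] have ke: "k * e ^ 2 = 1"
        by (simp add: fps_nth_power_0 P0 Q0 z0 e_def)
      have PQ: "P * Q = fps_const e * z"
      proof (rule fps_square_eqI)
        have "(fps_const e * z) ^ 2 = fps_const (k * e ^ 2) * (P * Q) ^ 2"
          unfolding power_mult_distrib[of _ z] z2k P2[symmetric] Q2[symmetric] power_mult_distrib
          by (simp add: mult_ac)
        then show "(P * Q) ^ 2 = (fps_const e * z) ^ 2"
          unfolding ke by simp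
      qed (use e in \<open>simp_all add: P0 Q0 z0 e_def\<close>)
      have "fps_rescale l (p * q) = fps_const e * z"
        unfolding PQ[symmetric] P_def Q_def by (simp add: fps_compose_mult_distrib)
      then show "?D (?D f) = fps_const (c / (e * \<delta>)) * ?D (?D (fps_rescale l (p * q)))"
        by (rule f_eq) (use zz e 4 in simp_all)
      show "c / (e * \<delta>) \<noteq> 0"
        using c e 4 by simp
      show "g = fps_rescale l (fps_const c1 * inverse p + fps_const c2 * inverse q)"
        unfolding g P_def Q_def
        by (simp add: fps_compose_add_distrib fps_compose_mult_distrib fps_rescale_inverse p0 q0)
    qed (rule l)
    ultimately show ?thesis by blast
  qed
qed

section \<open>Extension of scalars\<close>

context
  fixes \<phi> :: "'a::field_char_0 \<Rightarrow> 'b::field_char_0"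
  assumes \<phi>: "field_embedding \<phi>"
begin

lemma embedding_1: "\<phi> 1 = 1"
  and embedding_add: "\<phi> (x + y) = \<phi> x + \<phi> y"
  and embedding_mult: "\<phi> (x * y) = \<phi> x * \<phi> y"
  using \<phi> by (auto simp: field_embedding_def)

lemma embedding_0: "\<phi> 0 = 0"
  using embedding_add[of 0 0] by simp

lemma embedding_of_nat: "\<phi> (of_nat n) = of_nat n"
  by (induction n) (simp_all add: embedding_0 embedding_1 embedding_add)

lemma embedding_numeral: "\<phi> (numeral n) = numeral n"
  using embedding_of_nat[of "numeral n"] by simp

lemma embedding_sum: "\<phi> (sum h A) = (\<Sum>x\<in>A. \<phi> (h x))"
  by (induction A rule: infinite_finite_induct) (simp_all add: embedding_0 embedding_add)

lemma embedding_eq_0_iff: "\<phi> x = 0 \<longleftrightarrow> x = 0"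
proof
  assume "\<phi> x = 0"
  then have "x \<noteq> 0 \<Longrightarrow> \<phi> 1 = 0"
    using embedding_mult[of x "inverse x"] by simp
  then show "x = 0"
    using embedding_1 by auto
qed (simp add: embedding_0)

lemma fps_map_nth: "fps_nth (fps_map \<phi> h) n = \<phi> (fps_nth h n)"
  by (simp add: fps_map_def)

lemma fps_map_add: "fps_map \<phi> (g + h) = fps_map \<phi> g + fps_map \<phi> h"
  by (intro fps_ext) (simp add: fps_map_nth embedding_add)

lemma fps_map_mult: "fps_map \<phi> (g * h) = fps_map \<phi> g * fps_map \<phi> h"
  by (intro fps_ext) (simp add: fps_map_nth fps_mult_nth embedding_sum embedding_mult)

lemma fps_map_const: "fps_map \<phi> (fps_const c) = fps_const (\<phi> c)"
  by (intro fps_ext) (simp add: fps_map_nth embedding_0)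

lemma fps_map_1: "fps_map \<phi> 1 = 1"
  using fps_map_const[of 1] by (simp add: embedding_1)

lemma fps_map_numeral: "fps_map \<phi> (numeral n) = numeral n"
  by (simp add: numeral_fps_const fps_map_const embedding_numeral)

lemma fps_map_X: "fps_map \<phi> fps_X = fps_X"
  by (intro fps_ext) (simp add: fps_map_nth embedding_0 embedding_1 fps_X_def)

lemma fps_map_power: "fps_map \<phi> (h ^ n) = fps_map \<phi> h ^ n"
  by (induction n) (simp_all add: fps_map_1 fps_map_mult)

lemma fps_map_deriv: "fps_map \<phi> (fps_deriv h) = fps_deriv (fps_map \<phi> h)"
  by (intro fps_ext) (simp add: fps_map_nth embedding_mult embedding_of_nat embedding_add embedding_1)

lemma fps_map_eq_0_iff: "fps_map \<phi> h = 0 \<longleftrightarrow> h = 0"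
  by (simp add: fps_eq_iff fps_map_nth embedding_eq_0_iff)

lemmas fps_map_simps = fps_map_add fps_map_mult fps_map_const fps_map_1 fps_map_numeral fps_map_X
  fps_map_power fps_map_deriv

text \<open>Transporting this description, in place of admissibility, avoids extending
  \<open>\<phi>\<close> to the Laurent series in which A_k lives.\<close>

lemma fps_conic_map: "fps_conic f z y1 y2 c \<Longrightarrow> fps_conic (fps_map \<phi> f) (fps_map \<phi> z) (\<phi> y1) (\<phi> y2) (\<phi> c)"
proof -
  assume *: "fps_conic f z y1 y2 c"
  have "fps_map \<phi> (z ^ 2) = fps_map \<phi> (1 + fps_const y1 * fps_X + fps_const y2 * fps_X ^ 2)"
    "fps_map \<phi> (z ^ 3 * fps_deriv (fps_deriv f)) = fps_map \<phi> (fps_const c)"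
    using * by (simp_all only: fps_conic_def)
  then show ?thesis
    using * by (simp add: fps_conic_def fps_map_simps fps_map_nth embedding_1 embedding_eq_0_iff)
qed

lemma fps_ode_map: "fps_ode z y2 g \<Longrightarrow> fps_ode (fps_map \<phi> z) (\<phi> y2) (fps_map \<phi> g)"
proof -
  assume "fps_ode z y2 g"
  then have "fps_map \<phi> (4 * z ^ 2 * fps_deriv (fps_deriv g) + 12 * z * fps_deriv z * fps_deriv g + 3 * fps_const y2 * g)
    = fps_map \<phi> 0"
    by (simp only: fps_ode_def)
  then show ?thesis
    using fps_map_const[of 0] by (simp add: fps_ode_def fps_map_simps embedding_0)
qed

end

lemma fps_admissible_imp_listed_equiv:
  fixes \<phi> :: "'a::field_char_0 \<Rightarrow> 'b::{field_char_0, alg_closed_field}"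
  assumes "fps_admissible f g" and \<phi>: "field_embedding \<phi>"
  shows "\<exists>b F G. fps_listed b F G \<and> fps_equiv a (fps_map \<phi> f) (fps_map \<phi> g) b F G"
proof -
  obtain z y1 y2 c where *: "fps_conic f z y1 y2 c" "fps_ode z y2 g"
    using assms(1) by (rule fps_admissible_imp_conic)
  have "g \<noteq> 0"
    using assms(1) by (simp add: fps_admissible_def)
  then show ?thesis
    using fps_conic_imp_listed_equiv[OF fps_conic_map[OF \<phi> *(1)] fps_ode_map[OF \<phi> *(2)]]
    by (simp add: fps_map_eq_0_iff[OF \<phi>])
qed

section \<open>Germs of analytic functions and their Taylor series\<close>

definition germ_at :: "complex \<Rightarrow> (complex \<Rightarrow> complex) \<Rightarrow> complex fps \<Rightarrow> bool" where
  "germ_at a h w \<longleftrightarrow> (\<lambda>x. h (a + x)) has_fps_expansion w"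

lemma germ_at_expansion: "h analytic_on {a} \<Longrightarrow> germ_at a h (fps_expansion h a)"
  by (simp add: germ_at_def analytic_at_imp_has_fps_expansion)

lemma germ_at_imp_analytic: "germ_at a h w \<Longrightarrow> h analytic_on {a}"
  unfolding germ_at_def by (rule has_fps_expansion_imp_analytic)

lemma germ_at_unique: "germ_at a h w \<Longrightarrow> germ_at a h v \<Longrightarrow> w = v"
  unfolding germ_at_def by (rule fps_expansion_unique_complex)

lemma germ_at_imp_expansion: "germ_at a h w \<Longrightarrow> fps_expansion h a = w"
  using germ_at_unique germ_at_expansion germ_at_imp_analytic by blast

lemma eventually_nhds_shift:
  fixes a :: complex
  shows "(\<forall>\<^sub>F x in nhds 0. P (a + x)) \<longleftrightarrow> (\<forall>\<^sub>F x in nhds a. P x)"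
  using nhds_to_0[of a] by (simp add: eventually_filtermap add.commute)

lemma germ_at_0_iff: "germ_at a h 0 \<longleftrightarrow> (\<forall>\<^sub>F x in nhds a. h x = 0)"
  using eventually_nhds_shift[of "\<lambda>x. h x = 0"] by (simp add: germ_at_def has_fps_expansion_0_iff)

lemma germ_at_const [intro]: "germ_at a (\<lambda>_. c) (fps_const c)"
  and germ_at_ident [intro]: "germ_at a (\<lambda>x. x) (fps_coord a)"
  by (auto simp: germ_at_def fps_coord_def intro!: fps_expansion_intros)

lemma germ_at_add [intro]: "germ_at a g v \<Longrightarrow> germ_at a h w \<Longrightarrow> germ_at a (\<lambda>x. g x + h x) (v + w)"
  and germ_at_diff [intro]: "germ_at a g v \<Longrightarrow> germ_at a h w \<Longrightarrow> germ_at a (\<lambda>x. g x - h x) (v - w)"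
  and germ_at_mult [intro]: "germ_at a g v \<Longrightarrow> germ_at a h w \<Longrightarrow> germ_at a (\<lambda>x. g x * h x) (v * w)"
  and germ_at_power [intro]: "germ_at a g v \<Longrightarrow> germ_at a (\<lambda>x. g x ^ n) (v ^ n)"
  and germ_at_inverse: "germ_at a g v \<Longrightarrow> fps_nth v 0 \<noteq> 0 \<Longrightarrow> germ_at a (\<lambda>x. inverse (g x)) (inverse v)"
  by (auto simp: germ_at_def intro!: fps_expansion_intros)

lemma germ_at_sum [intro]:
  "(\<And>i. i \<in> I \<Longrightarrow> germ_at a (h i) (w i)) \<Longrightarrow> germ_at a (\<lambda>x. \<Sum>i\<in>I. h i x) (\<Sum>i\<in>I. w i)"
  by (auto simp: germ_at_def intro!: fps_expansion_intros)

lemma germ_at_nth_0: "germ_at a h w \<Longrightarrow> h a = fps_nth w 0"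
  unfolding germ_at_def by (drule has_fps_expansion_imp_0_eq_fps_nth_0) simp

lemma germ_at_cong: "\<forall>\<^sub>F x in nhds a. g x = h x \<Longrightarrow> germ_at a h w \<Longrightarrow> germ_at a g w"
  unfolding germ_at_def
  using eventually_nhds_shift[of "\<lambda>x. g x = h x" a]
  by (subst has_fps_expansion_cong[of _ "\<lambda>x. h (a + x)"]) simp_all

lemma germ_at_eq_iff:
  assumes "germ_at a g v" "germ_at a h w"
  shows "(\<forall>\<^sub>F x in nhds a. g x = h x) \<longleftrightarrow> v = w"
proof -
  have d: "germ_at a (\<lambda>x. g x - h x) (v - w)"
    using assms by auto
  have "(\<forall>\<^sub>F x in nhds a. g x = h x) \<longleftrightarrow> germ_at a (\<lambda>x. g x - h x) 0"
    by (simp add: germ_at_0_iff)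
  also have "\<dots> \<longleftrightarrow> v - w = 0"
    using germ_at_unique[OF d] d by metis
  finally show ?thesis by simp
qed

lemma deriv_shift: "deriv (\<lambda>x. h (a + x)) z = deriv h (a + z)" for h :: "complex \<Rightarrow> complex"
proof -
  have "deriv h (a + z) = deriv (h \<circ> (\<lambda>x. a + z + x)) 0"
    by (rule deriv_shift_0)
  also have "h \<circ> (\<lambda>x. a + z + x) = (\<lambda>x. h (a + x)) \<circ> (\<lambda>x. z + x)"
    by (simp add: o_def add.assoc)
  also have "deriv \<dots> 0 = deriv (\<lambda>x. h (a + x)) z"
    by (rule deriv_shift_0[symmetric])
  finally show ?thesis ..
qed

lemma germ_at_deriv [intro]: "germ_at a h w \<Longrightarrow> germ_at a (deriv h) (fps_deriv w)"
  unfolding germ_at_def by (drule has_fps_expansion_deriv) (simp add: deriv_shift[abs_def])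

lemma germ_at_higher_deriv: "germ_at a h w \<Longrightarrow> germ_at a ((deriv ^^ n) h) ((fps_deriv ^^ n) w)"
  by (induction n) auto

lemma germ_at_compose_linear:
  assumes "germ_at a h w" "a = l0 + l1 * b"
  shows "germ_at b (\<lambda>x. h (l0 + l1 * x)) (fps_rescale l1 w)"
proof -
  have "((\<lambda>x. h (a + x)) \<circ> (\<lambda>x. l1 * x)) has_fps_expansion (fps_rescale l1 w)"
    using assms(1) unfolding germ_at_def
    by (intro has_fps_expansion_compose) (auto intro!: fps_expansion_intros)
  then show ?thesis
    by (simp add: germ_at_def o_def assms(2) algebra_simps)
qed

lemma eventually_analytic:
  assumes "h analytic_on {a}"
  shows "\<forall>\<^sub>F t in nhds a. h analytic_on {t}"
proof -
  obtain S where "open S" "a \<in> S" "h holomorphic_on S"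
    using assms by (auto simp: analytic_at)
  then show ?thesis
    unfolding eventually_nhds by (auto simp: analytic_at)
qed


section \<open>Transfer of the coefficients\<close>

text \<open>
  A family \<open>H t\<close> of power series in \<open>u\<close> represents a formal series over Laurent series when each
  coefficient, as a function of \<open>t\<close>, has the corresponding germ.
\<close>

lemma fps_to_fls_sum: "fps_to_fls (sum h A) = (\<Sum>x\<in>A. fps_to_fls (h x))"
  by (induction A rule: infinite_finite_induct) simp_all

lemma fls_const_fact: "fls_const (fact n) = (fact n :: 'a::field_char_0 fls)"
  by (metis fls_of_nat of_nat_fact)

definition family_germ :: "complex \<Rightarrow> (complex \<Rightarrow> complex fps) \<Rightarrow> complex fls fps \<Rightarrow> bool" where
  "family_germ a H K \<longleftrightarrow> (\<forall>n. \<exists>w. germ_at a (\<lambda>t. fps_nth (H t) n) w \<and> fps_nth K n = fps_to_fls w)"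

lemma family_germ_mult:
  assumes "family_germ a H K" "family_germ a H' K'"
  shows "family_germ a (\<lambda>t. H t * H' t) (K * K')"
  unfolding family_germ_def
proof
  fix n
  obtain w where w: "\<And>n. germ_at a (\<lambda>t. fps_nth (H t) n) (w n)" "\<And>n. fps_nth K n = fps_to_fls (w n)"
    using assms(1) unfolding family_germ_def by metis
  obtain w' where w': "\<And>n. germ_at a (\<lambda>t. fps_nth (H' t) n) (w' n)" "\<And>n. fps_nth K' n = fps_to_fls (w' n)"
    using assms(2) unfolding family_germ_def by metis
  have "fps_nth (K * K') n = fps_to_fls (\<Sum>i=0..n. w i * w' (n - i))"
    by (simp add: fps_mult_nth w w' fls_times_fps_to_fls fps_to_fls_sum)
  moreover have "germ_at a (\<lambda>t. fps_nth (H t * H' t) n) (\<Sum>i=0..n. w i * w' (n - i))"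
    unfolding fps_mult_nth by (intro germ_at_sum germ_at_mult w w')
  ultimately show "\<exists>w. germ_at a (\<lambda>t. fps_nth (H t * H' t) n) w \<and> fps_nth (K * K') n = fps_to_fls w"
    by blast
qed

lemma family_germ_diff:
  assumes "family_germ a H K" "family_germ a H' K'"
  shows "family_germ a (\<lambda>t. H t - H' t) (K - K')"
  unfolding family_germ_def
proof
  fix n
  obtain w w' where "germ_at a (\<lambda>t. fps_nth (H t) n) w" "fps_nth K n = fps_to_fls w"
    "germ_at a (\<lambda>t. fps_nth (H' t) n) w'" "fps_nth K' n = fps_to_fls w'"
    using assms unfolding family_germ_def by metis
  then show "\<exists>w. germ_at a (\<lambda>t. fps_nth (H t - H' t) n) w \<and> fps_nth (K - K') n = fps_to_fls w"
    by (intro exI[of _ "w - w'"]) auto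
qed

lemma family_germ_const:
  assumes "germ_at a h w"
  shows "family_germ a (\<lambda>t. fps_const (h t)) (fps_const (fps_to_fls w))"
  unfolding family_germ_def
proof
  fix n
  show "\<exists>v. germ_at a (\<lambda>t. fps_nth (fps_const (h t)) n) v \<and> fps_nth (fps_const (fps_to_fls w)) n = fps_to_fls v"
    using assms germ_at_const[of a 0] by (cases n) auto
qed

lemma family_germ_X: "family_germ a (\<lambda>_. fps_X) fps_X"
  unfolding family_germ_def
proof
  fix n
  show "\<exists>w. germ_at a (\<lambda>t. fps_nth fps_X n) w \<and> fps_nth fps_X n = fps_to_fls w"
    using germ_at_const[of a 0] germ_at_const[of a 1]
    by (cases "n = 1") (auto intro: exI[of _ 0] exI[of _ 1])
qed

lemma family_germ_power:
  assumes "family_germ a H K"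
  shows "family_germ a (\<lambda>t. H t ^ n) (K ^ n)"
proof (induction n)
  case 0
  show ?case
    using family_germ_const[OF germ_at_const[of a 1]] by simp
next
  case (Suc n)
  then show ?case
    using family_germ_mult[OF assms Suc] by simp
qed

lemma family_germ_taylor:
  assumes "germ_at a h w"
  shows "family_germ a (\<lambda>t. fps_expansion h t) (fps_shift_arg w)"
  unfolding family_germ_def
proof
  fix n
  have "germ_at a (\<lambda>t. (deriv ^^ n) h t * (1 / fact n)) ((fps_deriv ^^ n) w * fps_const (1 / fact n))"
    using assms by (intro germ_at_mult germ_at_higher_deriv germ_at_const)
  moreover have "fps_nth (fps_shift_arg w) n = fps_to_fls ((fps_deriv ^^ n) w * fps_const (1 / fact n))"
  proof -
    have "fls_const (1 / fact n) = (1 / fact n :: complex fls)"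
      by (simp add: fls_const_fact flip: fls_const_divide_const)
    then show ?thesis
      by (simp add: fps_shift_arg_nth fls_times_fps_to_fls)
  qed
  ultimately show "\<exists>w'. germ_at a (\<lambda>t. fps_nth (fps_expansion h t) n) w' \<and> fps_nth (fps_shift_arg w) n = fps_to_fls w'"
    by (intro exI[of _ "(fps_deriv ^^ n) w * fps_const (1 / fact n)"]) (simp add: fps_expansion_def)
qed

definition fps_R_at :: "(complex \<Rightarrow> complex) \<Rightarrow> complex \<Rightarrow> complex fps" where
  "fps_R_at f t = fps_expansion f t - fps_const (f t) - fps_const (deriv f t) * fps_X
     - fps_const (deriv (deriv f) t * (1/2)) * fps_X ^ 2"

lemma family_germ_R:
  assumes "germ_at a f w"
  shows "family_germ a (fps_R_at f) (fps_R w)"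
proof -
  have "germ_at a (\<lambda>t. deriv (deriv f) t * (1/2)) (fps_deriv (fps_deriv w) * fps_const (1/2))"
    by (intro germ_at_mult germ_at_deriv germ_at_const assms)
  then have *: "family_germ a (\<lambda>t. fps_const (deriv (deriv f) t * (1/2))) (fps_const (fps_to_fls (fps_deriv (fps_deriv w) * fps_const (1/2))))"
    by (rule family_germ_const)
  have "fps_to_fls (fps_deriv (fps_deriv w) * fps_const (1/2)) = 1/2 * fps_to_fls (fps_deriv (fps_deriv w))"
    by (simp add: fls_times_fps_to_fls flip: fls_const_divide_const)
  with * have "family_germ a (\<lambda>t. fps_const (deriv (deriv f) t * (1/2))) (fps_const (1/2 * fps_to_fls (fps_deriv (fps_deriv w))))"
    by simp
  then show ?thesis
    unfolding fps_R_at_def[abs_def] fps_R_def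
    by (intro family_germ_diff family_germ_mult family_germ_power family_germ_taylor family_germ_const family_germ_X
        germ_at_deriv assms)
qed

lemma an_R_expansion:
  assumes "f analytic_on {t}"
  shows "(\<lambda>u. an_R f t u) has_fps_expansion fps_R_at f t"
proof -
  have "(\<lambda>u. f (t + u)) has_fps_expansion fps_expansion f t"
    using assms by (rule analytic_at_imp_has_fps_expansion)
  then have "(\<lambda>u. f (t + u) - f t - deriv f t * u - (deriv (deriv f) t * (1/2)) * u ^ 2) has_fps_expansion fps_R_at f t"
    unfolding fps_R_at_def by (intro fps_expansion_intros)
  then show ?thesis
    by (simp add: an_R_def)
qed

lemma an_Delta_funpow:
  assumes "h has_fps_expansion w"
  shows "(an_Delta f t ^^ n) h 0 = (- (1 / (2 * deriv (deriv f) t))) ^ n * fact (2 * n) * fps_nth w (2 * n)"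
proof -
  let ?c = "- (1 / (2 * deriv (deriv f) t))"
  have "(an_Delta f t ^^ n) h has_fps_expansion fps_const (?c ^ n) * (fps_deriv ^^ (2 * n)) w"
  proof (induction n)
    case 0
    show ?case using assms by simp
  next
    case (Suc n)
    have "(\<lambda>u. ?c * deriv (deriv ((an_Delta f t ^^ n) h)) u) has_fps_expansion
        fps_const ?c * fps_deriv (fps_deriv (fps_const (?c ^ n) * (fps_deriv ^^ (2 * n)) w))"
      by (intro has_fps_expansion_cmult_left has_fps_expansion_deriv Suc.IH)
    moreover have "fps_const ?c * fps_deriv (fps_deriv (fps_const (?c ^ n) * (fps_deriv ^^ (2 * n)) w))
        = fps_const (?c ^ Suc n) * (fps_deriv ^^ (2 * Suc n)) w"
      by (simp add: mult.assoc[symmetric])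
    ultimately show ?case
      by (simp add: an_Delta_def[of f t "(an_Delta f t ^^ n) h"])
  qed
  then show ?thesis
    by (drule_tac has_fps_expansion_imp_0_eq_fps_nth_0) (simp add: fps_deriv_funpow_nth_0 mult.assoc)
qed

lemma an_A_eq:
  assumes "f analytic_on {t}" "g analytic_on {t}"
  shows "an_A f g k t = (\<Sum>v\<le>2*k. 1 / (fact v * fact (k + v)) *
    ((- (1 / (2 * deriv (deriv f) t))) ^ (k + v) * fact (2 * (k + v)) *
     fps_nth (fps_expansion g t * fps_R_at f t ^ v) (2 * (k + v))))"
proof -
  have "(\<lambda>u. g (t + u) * an_R f t u ^ v) has_fps_expansion fps_expansion g t * fps_R_at f t ^ v" for v
    using assms by (intro fps_expansion_intros an_R_expansion analytic_at_imp_has_fps_expansion)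
  then show ?thesis
    unfolding an_A_def by (intro sum.cong refl arg_cong2[of _ _ _ _ "(*)"] an_Delta_funpow)
qed

text \<open>
  \<open>A\<^sub>k\<close> is multiplied by \<open>f''\<close> to the power \<open>3 k + 1\<close>, one more than needed to clear the
  denominators, so that the product also vanishes at the zeros of \<open>f''\<close>.
\<close>

definition an_A_cleared :: "(complex \<Rightarrow> complex) \<Rightarrow> (complex \<Rightarrow> complex) \<Rightarrow> nat \<Rightarrow> complex \<Rightarrow> complex" where
  "an_A_cleared f g k t = (\<Sum>v\<le>2*k. ((- (1/2)) ^ (k + v) * fact (2 * (k + v)) / (fact v * fact (k + v))) *
    (deriv (deriv f) t ^ (2 * k + 1 - v) * fps_nth (fps_expansion g t * fps_R_at f t ^ v) (2 * (k + v))))"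

lemma clear_denominator:
  fixes x :: "'a::field_char_0"
  assumes "x \<noteq> 0" "v \<le> 2 * k"
  shows "x ^ (3 * k + 1) * (- (1 / (2 * x))) ^ (k + v) = (- (1/2)) ^ (k + v) * x ^ (2 * k + 1 - v)"
proof -
  have "- (1 / (2 * x)) = - (1/2) * inverse x"
    using assms(1) by (simp add: field_simps)
  moreover have "3 * k + 1 = (2 * k + 1 - v) + (k + v)"
    using assms(2) by simp
  ultimately have "x ^ (3 * k + 1) * (- (1 / (2 * x))) ^ (k + v)
      = (- (1/2)) ^ (k + v) * x ^ (2 * k + 1 - v) * (x * inverse x) ^ (k + v)"
    by (simp only: power_add power_mult_distrib mult_ac)
  then show ?thesis
    using assms(1) by simp
qed

lemma an_A_cleared_eq:
  assumes "f analytic_on {t}" "g analytic_on {t}"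
  shows "an_A_cleared f g k t = (if deriv (deriv f) t = 0 then 0 else deriv (deriv f) t ^ (3 * k + 1) * an_A f g k t)"
proof (cases "deriv (deriv f) t = 0")
  case True
  then show ?thesis
    by (auto simp: an_A_cleared_def intro!: sum.neutral)
next
  case False
  let ?x = "deriv (deriv f) t"
  have "?x ^ (3 * k + 1) * an_A f g k t = (\<Sum>v\<le>2*k. fact (2 * (k + v)) / (fact v * fact (k + v)) *
      (?x ^ (3 * k + 1) * (- (1 / (2 * ?x))) ^ (k + v)) * fps_nth (fps_expansion g t * fps_R_at f t ^ v) (2 * (k + v)))"
    unfolding an_A_eq[OF assms] sum_distrib_left by (intro sum.cong refl) simp
  also have "\<dots> = an_A_cleared f g k t"
    unfolding an_A_cleared_def
  proof (intro sum.cong refl)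
    fix v assume "v \<in> {..2 * k}"
    then have *: "?x ^ (3 * k + 1) * (- (1 / (2 * ?x))) ^ (k + v) = (- (1/2)) ^ (k + v) * ?x ^ (2 * k + 1 - v)"
      using False by (intro clear_denominator) simp_all
    show "fact (2 * (k + v)) / (fact v * fact (k + v)) * (?x ^ (3 * k + 1) * (- (1 / (2 * ?x))) ^ (k + v))
        * fps_nth (fps_expansion g t * fps_R_at f t ^ v) (2 * (k + v))
      = (- (1/2)) ^ (k + v) * fact (2 * (k + v)) / (fact v * fact (k + v))
        * (?x ^ (2 * k + 1 - v) * fps_nth (fps_expansion g t * fps_R_at f t ^ v) (2 * (k + v)))"
      unfolding * by simp
  qed
  finally show ?thesis
    using False by simp
qed

text \<open>A_k may have a pole at a zero of f'', so it is the cleared product that has a germ at a.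
  The powers of f'' are nonzero Laurent series, hence vanishing of the product and of A_k are
  equivalent.\<close>

lemma germ_A_cleared:
  assumes f: "germ_at a f F" and g: "germ_at a g G" and F: "fps_deriv (fps_deriv F) \<noteq> 0"
  obtains w where "germ_at a (an_A_cleared f g k) w"
    "fps_to_fls w = fps_to_fls (fps_deriv (fps_deriv F)) ^ (3 * k + 1) * fps_A F G k"
proof -
  let ?x = "fps_to_fls (fps_deriv (fps_deriv F))"
  have "family_germ a (\<lambda>t. fps_expansion g t * fps_R_at f t ^ v) (fps_shift_arg G * fps_R F ^ v)" for v
    by (intro family_germ_mult family_germ_power family_germ_taylor family_germ_R f g)
  then obtain c where c: "\<And>v n. germ_at a (\<lambda>t. fps_nth (fps_expansion g t * fps_R_at f t ^ v) n) (c v n)"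
    "\<And>v n. fps_nth (fps_shift_arg G * fps_R F ^ v) n = fps_to_fls (c v n)"
    unfolding family_germ_def by metis
  define q where "q v = ((- (1/2)) ^ (k + v) * fact (2 * (k + v)) / (fact v * fact (k + v)) :: complex)" for v
  define w where "w = (\<Sum>v\<le>2*k. fps_const (q v) * (fps_deriv (fps_deriv F) ^ (2 * k + 1 - v) * c v (2 * (k + v))))"
  have "germ_at a (an_A_cleared f g k) w"
    unfolding an_A_cleared_def[abs_def] w_def q_def
    by (intro germ_at_sum germ_at_mult germ_at_const germ_at_power germ_at_deriv f c)
  moreover have "fps_to_fls w = ?x ^ (3 * k + 1) * fps_A F G k"
  proof -
    have q: "fls_const (q v) = (- (1/2)) ^ (k + v) * fact (2 * (k + v)) / (fact v * fact (k + v))" for v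
    proof -
      have "fls_const (- (1/2) :: complex) = - (1/2)"
        using fls_const_divide_const[of "- 1 :: complex" 2] fls_const_uminus[of "1 :: complex"] by simp
      then show ?thesis
        unfolding q_def
        by (simp add: fls_const_fact fls_const_power flip: fls_const_mult_const fls_const_divide_const)
    qed
    have "?x ^ (3 * k + 1) * fps_A F G k = (\<Sum>v\<le>2*k. fact (2 * (k + v)) / (fact v * fact (k + v)) *
      (?x ^ (3 * k + 1) * (- (1 / (2 * ?x))) ^ (k + v)) * fps_nth (fps_shift_arg G * fps_R F ^ v) (2 * (k + v)))"
      unfolding fps_A_def fps_Delta_funpow_nth_0 sum_distrib_left by (intro sum.cong refl) simp
    also have "\<dots> = (\<Sum>v\<le>2*k. fls_const (q v) * (?x ^ (2 * k + 1 - v) * fps_to_fls (c v (2 * (k + v)))))"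
    proof (intro sum.cong refl)
      fix v assume "v \<in> {..2 * k}"
      then have "?x ^ (3 * k + 1) * (- (1 / (2 * ?x))) ^ (k + v) = (- (1/2)) ^ (k + v) * ?x ^ (2 * k + 1 - v)"
        using F by (intro clear_denominator) simp_all
      then show "fact (2 * (k + v)) / (fact v * fact (k + v)) *
          (?x ^ (3 * k + 1) * (- (1 / (2 * ?x))) ^ (k + v)) * fps_nth (fps_shift_arg G * fps_R F ^ v) (2 * (k + v))
        = fls_const (q v) * (?x ^ (2 * k + 1 - v) * fps_to_fls (c v (2 * (k + v))))"
        by (simp only: c q) simp
    qed
    also have "\<dots> = fps_to_fls w"
      by (simp add: w_def fps_to_fls_sum fls_times_fps_to_fls fps_to_fls_power)
    finally show ?thesis ..
  qed
  ultimately show ?thesis by (rule that)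
qed

theorem an_admissible_iff:
  "an_admissible a f g \<longleftrightarrow> f analytic_on {a} \<and> g analytic_on {a} \<and>
     fps_admissible (fps_expansion f a) (fps_expansion g a)"
proof (cases "f analytic_on {a} \<and> g analytic_on {a}")
  case True
  then have f: "germ_at a f (fps_expansion f a)" and g: "germ_at a g (fps_expansion g a)"
    by (auto intro: germ_at_expansion)
  let ?F = "fps_expansion f a" and ?G = "fps_expansion g a"
  have F0: "(\<forall>\<^sub>F t in nhds a. deriv (deriv f) t = 0) \<longleftrightarrow> fps_deriv (fps_deriv ?F) = 0"
    using germ_at_eq_iff[OF germ_at_deriv[OF germ_at_deriv[OF f]] germ_at_const[of a 0]] by simp
  have G0: "(\<forall>\<^sub>F t in nhds a. g t = 0) \<longleftrightarrow> ?G = 0"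
    using germ_at_eq_iff[OF g germ_at_const[of a 0]] by simp
  have A: "(\<forall>\<^sub>F t in nhds a. deriv (deriv f) t \<noteq> 0 \<longrightarrow> an_A f g k t = 0) \<longleftrightarrow> fps_A ?F ?G k = 0"
    if F: "fps_deriv (fps_deriv ?F) \<noteq> 0" for k
  proof -
    obtain w where w: "germ_at a (an_A_cleared f g k) w"
      "fps_to_fls w = fps_to_fls (fps_deriv (fps_deriv ?F)) ^ (3 * k + 1) * fps_A ?F ?G k"
      using germ_A_cleared[OF f g F] .
    have "\<forall>\<^sub>F t in nhds a. f analytic_on {t} \<and> g analytic_on {t}"
      using True by (intro eventually_conj eventually_analytic) auto
    \<comment> \<open>Where f'' vanishes both conditions hold: the left one vacuously, the right one
      because every summand keeps a factor f''.\<close>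
    then have "\<forall>\<^sub>F t in nhds a. (deriv (deriv f) t \<noteq> 0 \<longrightarrow> an_A f g k t = 0) = (an_A_cleared f g k t = 0)"
      by eventually_elim (simp add: an_A_cleared_eq)
    then have "(\<forall>\<^sub>F t in nhds a. deriv (deriv f) t \<noteq> 0 \<longrightarrow> an_A f g k t = 0) \<longleftrightarrow>
        (\<forall>\<^sub>F t in nhds a. an_A_cleared f g k t = 0)"
      by (rule eventually_subst)
    also have "\<dots> \<longleftrightarrow> w = 0"
      using germ_at_eq_iff[OF w(1) germ_at_const[of a 0]] by simp
    also have "\<dots> \<longleftrightarrow> fps_to_fls w = 0"
      by simp
    also have "\<dots> \<longleftrightarrow> fps_A ?F ?G k = 0"
      unfolding w(2) using F by simp
    finally show ?thesis .
  qed
  show ?thesis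
    unfolding an_admissible_def fps_admissible_def F0 G0 using True A by blast
qed (auto simp: an_admissible_def)

section \<open>Analytic pairs\<close>

lemma germ_at_coord_add: "germ_at a (\<lambda>x. x + e) (fps_coord a + fps_const e)"
  by (intro germ_at_add germ_at_ident germ_at_const)

text \<open>A formal root of a linear function converges: dividing x + e by its value at b puts the
  argument of \<open>csqrt\<close> near 1, away from the cut, and the constant term of p selects the
  branch.\<close>

lemma germ_at_sqrt_exists:
  assumes p: "p ^ 2 = fps_coord b + fps_const e"
  obtains r where "germ_at b r p"
proof -
  have p0: "fps_nth p 0 \<noteq> 0"
    by (rule fps_square_nth_0_nonzero) (simp add: p)
  have p02: "fps_nth p 0 ^ 2 = b + e"
    using arg_cong[OF p, of "\<lambda>h. fps_nth h 0"] by (simp add: fps_nth_power_0)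
  then have be: "b + e \<noteq> 0"
    using p0 by auto
  define r where "r x = fps_nth p 0 * csqrt ((x + e) / (b + e))" for x
  have "r analytic_on {b}"
    unfolding r_def[abs_def] using be by (auto intro!: analytic_intros)
  then have g: "germ_at b r (fps_expansion r b)"
    by (rule germ_at_expansion)
  have "germ_at b (\<lambda>x. r x ^ 2) (fps_coord b + fps_const e)"
  proof -
    have "(\<lambda>x. r x ^ 2) = (\<lambda>x. x + e)"
      using be p02 by (auto simp: r_def power_mult_distrib)
    then show ?thesis
      using germ_at_coord_add by simp
  qed
  then have sq: "fps_expansion r b ^ 2 = p ^ 2"
    unfolding p using germ_at_unique[OF germ_at_power[OF g]] by blast
  have "fps_nth (fps_expansion r b) 0 = fps_nth p 0"
    using germ_at_nth_0[OF g] be by (simp add: r_def)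
  from fps_square_eqI[OF sq this p0] have "fps_expansion r b = p" .
  then show ?thesis
    using g that by simp
qed

lemma an_pair1_germ:
  assumes f: "germ_at a f F"
  shows "an_pair1 c1 c2 a f g \<longleftrightarrow> (\<exists>G. germ_at a g G \<and> fps_pair1 c1 c2 a F G)"
proof
  assume *: "an_pair1 c1 c2 a f g"
  then obtain p q where pq: "p analytic_on {a}" "q analytic_on {a}" and
    ev: "\<forall>\<^sub>F x in nhds a. p x ^ 2 = x + 1 \<and> q x ^ 2 = x - 1 \<and> g x = c1 / p x + c2 / q x"
    and f2: "\<forall>\<^sub>F x in nhds a. f x ^ 2 = x ^ 2 - 1"
    by (auto simp: an_pair1_def)
  define P Q where "P = fps_expansion p a" and "Q = fps_expansion q a"
  have P: "germ_at a p P" and Q: "germ_at a q Q"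
    using pq by (auto simp: P_def Q_def germ_at_expansion)
  have "\<forall>\<^sub>F x in nhds a. p x ^ 2 = x + 1" "\<forall>\<^sub>F x in nhds a. q x ^ 2 = x - 1"
    using ev by (auto elim: eventually_mono)
  then have P2: "P ^ 2 = fps_coord a + 1" and Q2: "Q ^ 2 = fps_coord a - 1"
    using germ_at_eq_iff[OF germ_at_power[OF P] germ_at_add[OF germ_at_ident germ_at_const], of 2 1]
      germ_at_eq_iff[OF germ_at_power[OF Q] germ_at_diff[OF germ_at_ident germ_at_const], of 2 1]
    by simp_all
  have "fps_nth P 0 \<noteq> 0" "fps_nth Q 0 \<noteq> 0"
    by (rule fps_square_nth_0_nonzero, simp add: P2 Q2)+
  then have "germ_at a (\<lambda>x. c1 * inverse (p x) + c2 * inverse (q x)) (fps_const c1 * inverse P + fps_const c2 * inverse Q)"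
    by (intro germ_at_add germ_at_mult germ_at_const germ_at_inverse P Q)
  then have "germ_at a g (fps_const c1 * inverse P + fps_const c2 * inverse Q)"
    by (rule germ_at_cong[rotated]) (use ev in \<open>auto simp: divide_inverse elim: eventually_mono\<close>)
  moreover have "F ^ 2 = fps_coord a ^ 2 - 1"
    using germ_at_eq_iff[OF germ_at_power[OF f] germ_at_diff[OF germ_at_power[OF germ_at_ident] germ_at_const], of 2 2 1] f2
    by simp
  ultimately show "\<exists>G. germ_at a g G \<and> fps_pair1 c1 c2 a F G"
    using P2 Q2 by (auto simp: fps_pair1_def)
next
  assume "\<exists>G. germ_at a g G \<and> fps_pair1 c1 c2 a F G"
  then obtain G P Q where g: "germ_at a g G" and F2: "F ^ 2 = fps_coord a ^ 2 - 1"
    and P2: "P ^ 2 = fps_coord a + 1" and Q2: "Q ^ 2 = fps_coord a - 1"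
    and G: "G = fps_const c1 * inverse P + fps_const c2 * inverse Q"
    by (auto simp: fps_pair1_def)
  obtain p where P: "germ_at a p P"
    using germ_at_sqrt_exists[of P a 1] P2 by auto
  obtain q where Q: "germ_at a q Q"
    using germ_at_sqrt_exists[of Q a "- 1"] Q2 by (auto simp flip: fps_const_neg)
  have "fps_nth P 0 \<noteq> 0" "fps_nth Q 0 \<noteq> 0"
    by (rule fps_square_nth_0_nonzero, simp add: P2 Q2)+
  then have "germ_at a (\<lambda>x. c1 * inverse (p x) + c2 * inverse (q x)) G"
    unfolding G by (intro germ_at_add germ_at_mult germ_at_const germ_at_inverse P Q)
  then have "\<forall>\<^sub>F x in nhds a. g x = c1 * inverse (p x) + c2 * inverse (q x)"
    using germ_at_eq_iff[OF g] by blast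
  moreover have "\<forall>\<^sub>F x in nhds a. p x ^ 2 = x + 1" "\<forall>\<^sub>F x in nhds a. q x ^ 2 = x - 1"
    using germ_at_eq_iff[OF germ_at_power[OF P] germ_at_add[OF germ_at_ident germ_at_const], of 2 1]
      germ_at_eq_iff[OF germ_at_power[OF Q] germ_at_diff[OF germ_at_ident germ_at_const], of 2 1] P2 Q2
    by simp_all
  ultimately have "\<forall>\<^sub>F x in nhds a. p x ^ 2 = x + 1 \<and> q x ^ 2 = x - 1 \<and> g x = c1 / p x + c2 / q x"
    by eventually_elim (simp add: divide_inverse)
  moreover have "\<forall>\<^sub>F x in nhds a. f x ^ 2 = x ^ 2 - 1"
    using germ_at_eq_iff[OF germ_at_power[OF f] germ_at_diff[OF germ_at_power[OF germ_at_ident] germ_at_const], of 2 2 1] F2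
    by simp
  moreover have "f analytic_on {a}" "p analytic_on {a}" "q analytic_on {a}"
    using f P Q by (auto intro: germ_at_imp_analytic)
  ultimately show "an_pair1 c1 c2 a f g"
    unfolding an_pair1_def by blast
qed

lemma an_pair2_germ:
  assumes f: "germ_at a f F"
  shows "an_pair2 c1 c2 a f g \<longleftrightarrow> (\<exists>G. germ_at a g G \<and> fps_pair2 c1 c2 a F G)"
proof -
  have f_iff: "(\<forall>\<^sub>F x in nhds a. f x = 1 / x) \<longleftrightarrow> F = inverse (fps_coord a)" if "a \<noteq> 0"
    using germ_at_eq_iff[OF f germ_at_inverse[OF germ_at_ident]] that by (simp add: divide_inverse)
  have s_iff: "(\<forall>\<^sub>F x in nhds a. s x ^ 2 = x) \<longleftrightarrow> S ^ 2 = fps_coord a" if "germ_at a s S" for s S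
    by (rule germ_at_eq_iff[OF germ_at_power[OF that] germ_at_ident])
  have g_germ: "germ_at a (\<lambda>x. c1 / s x + c2 / s x ^ 3) (fps_const c1 * inverse S + fps_const c2 * inverse (S ^ 3))"
    if s: "germ_at a s S" and S: "S ^ 2 = fps_coord a" for s S
  proof -
    have "fps_nth S 0 \<noteq> 0"
      by (rule fps_square_nth_0_nonzero) (simp add: S)
    then show ?thesis
      unfolding divide_inverse
      by (intro germ_at_add germ_at_mult germ_at_const germ_at_inverse germ_at_power s) (simp_all add: fps_nth_power_0)
  qed
  show ?thesis
  proof
    assume *: "an_pair2 c1 c2 a f g"
    then obtain s where a: "a \<noteq> 0" and s: "s analytic_on {a}" and
      ev: "\<forall>\<^sub>F x in nhds a. s x ^ 2 = x \<and> g x = c1 / s x + c2 / s x ^ 3"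
      and fe: "\<forall>\<^sub>F x in nhds a. f x = 1 / x"
      by (auto simp: an_pair2_def)
    have S: "germ_at a s (fps_expansion s a)"
      using s by (rule germ_at_expansion)
    have S2: "fps_expansion s a ^ 2 = fps_coord a"
      using s_iff[OF S] ev unfolding eventually_conj_iff by blast
    have "germ_at a g (fps_const c1 * inverse (fps_expansion s a) + fps_const c2 * inverse (fps_expansion s a ^ 3))"
      by (rule germ_at_cong[OF _ g_germ[OF S S2]]) (use ev in \<open>auto elim: eventually_mono\<close>)
    then show "\<exists>G. germ_at a g G \<and> fps_pair2 c1 c2 a F G"
      using a S2 f_iff[OF a] fe unfolding fps_pair2_def by blast
  next
    assume "\<exists>G. germ_at a g G \<and> fps_pair2 c1 c2 a F G"
    then obtain G S where g: "germ_at a g G" and a: "a \<noteq> 0" and F: "F = inverse (fps_coord a)"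
      and S2: "S ^ 2 = fps_coord a" and G: "G = fps_const c1 * inverse S + fps_const c2 * inverse (S ^ 3)"
      by (auto simp: fps_pair2_def)
    obtain s where s: "germ_at a s S"
      using germ_at_sqrt_exists[of S a 0] S2 by auto
    have "\<forall>\<^sub>F x in nhds a. g x = c1 / s x + c2 / s x ^ 3"
      using germ_at_eq_iff[OF g g_germ[OF s S2]] G by blast
    moreover have "\<forall>\<^sub>F x in nhds a. s x ^ 2 = x"
      using s_iff[OF s] S2 by blast
    ultimately have "\<forall>\<^sub>F x in nhds a. s x ^ 2 = x \<and> g x = c1 / s x + c2 / s x ^ 3"
      by eventually_elim simp
    then show "an_pair2 c1 c2 a f g"
      using a f_iff[OF a] F germ_at_imp_analytic[OF s] unfolding an_pair2_def by blast
  qed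
qed

lemma an_pair3_germ:
  assumes f: "germ_at a f F"
  shows "an_pair3 c1 c2 a f g \<longleftrightarrow> (\<exists>G. germ_at a g G \<and> fps_pair3 c1 c2 a F G)"
proof -
  have s_iff: "(\<forall>\<^sub>F x in nhds a. s x ^ 2 = x) \<longleftrightarrow> S ^ 2 = fps_coord a" if "germ_at a s S" for s S
    by (rule germ_at_eq_iff[OF germ_at_power[OF that] germ_at_ident])
  have g_germ: "germ_at a (\<lambda>x. c1 + c2 / s x) (fps_const c1 + fps_const c2 * inverse S)"
    if s: "germ_at a s S" and S: "S ^ 2 = fps_coord a" for s S
  proof -
    have "fps_nth S 0 \<noteq> 0"
      by (rule fps_square_nth_0_nonzero) (simp add: S)
    then show ?thesis
      unfolding divide_inverse by (intro germ_at_add germ_at_mult germ_at_const germ_at_inverse s)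
  qed
  show ?thesis
  proof
    assume *: "an_pair3 c1 c2 a f g"
    then obtain s where s: "s analytic_on {a}" and
      ev: "\<forall>\<^sub>F x in nhds a. s x ^ 2 = x \<and> g x = c1 + c2 / s x"
      and fe: "\<forall>\<^sub>F x in nhds a. f x ^ 2 = x"
      by (auto simp: an_pair3_def)
    have S: "germ_at a s (fps_expansion s a)"
      using s by (rule germ_at_expansion)
    have S2: "fps_expansion s a ^ 2 = fps_coord a"
      using s_iff[OF S] ev unfolding eventually_conj_iff by blast
    have "germ_at a g (fps_const c1 + fps_const c2 * inverse (fps_expansion s a))"
      by (rule germ_at_cong[OF _ g_germ[OF S S2]]) (use ev in \<open>auto elim: eventually_mono\<close>)
    then show "\<exists>G. germ_at a g G \<and> fps_pair3 c1 c2 a F G"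
      using S2 s_iff[OF f] fe unfolding fps_pair3_def by blast
  next
    assume "\<exists>G. germ_at a g G \<and> fps_pair3 c1 c2 a F G"
    then obtain G S where g: "germ_at a g G" and F: "F ^ 2 = fps_coord a"
      and S2: "S ^ 2 = fps_coord a" and G: "G = fps_const c1 + fps_const c2 * inverse S"
      by (auto simp: fps_pair3_def)
    obtain s where s: "germ_at a s S"
      using germ_at_sqrt_exists[of S a 0] S2 by auto
    have "\<forall>\<^sub>F x in nhds a. g x = c1 + c2 / s x"
      using germ_at_eq_iff[OF g g_germ[OF s S2]] G by blast
    moreover have "\<forall>\<^sub>F x in nhds a. s x ^ 2 = x"
      using s_iff[OF s] S2 by blast
    ultimately have "\<forall>\<^sub>F x in nhds a. s x ^ 2 = x \<and> g x = c1 + c2 / s x"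
      by eventually_elim simp
    then show "an_pair3 c1 c2 a f g"
      using s_iff[OF f] F germ_at_imp_analytic[OF s] germ_at_imp_analytic[OF f] unfolding an_pair3_def by blast
  qed
qed

lemma an_pair4_germ:
  assumes f: "germ_at a f F"
  shows "an_pair4 c1 c2 a f g \<longleftrightarrow> (\<exists>G. germ_at a g G \<and> fps_pair4 c1 c2 a F G)"
proof -
  have f_iff: "(\<forall>\<^sub>F x in nhds a. f x = x ^ 2) \<longleftrightarrow> F = fps_coord a ^ 2"
    by (rule germ_at_eq_iff[OF f germ_at_power[OF germ_at_ident]])
  have G: "germ_at a (\<lambda>x. c1 + c2 * x) (fps_const c1 + fps_const c2 * fps_coord a)"
    by (intro germ_at_add germ_at_mult germ_at_const germ_at_ident)
  have "(\<forall>\<^sub>F x in nhds a. g x = c1 + c2 * x) \<longleftrightarrow> germ_at a g (fps_const c1 + fps_const c2 * fps_coord a)"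
    using germ_at_cong[OF _ G] germ_at_eq_iff[OF _ G] by blast
  then show ?thesis
    by (auto simp: an_pair4_def fps_pair4_def eventually_conj_iff f_iff)
qed

lemma an_listed_germ:
  assumes "germ_at a f F"
  shows "an_listed a f g \<longleftrightarrow> (\<exists>G. germ_at a g G \<and> fps_listed a F G)"
  unfolding an_listed_def fps_listed_def
    an_pair1_germ[OF assms] an_pair2_germ[OF assms] an_pair3_germ[OF assms] an_pair4_germ[OF assms]
  by blast

lemma an_listed_imp_analytic:
  assumes "an_listed a f g"
  shows "f analytic_on {a}"
proof -
  from assms obtain c1 c2 where "an_pair1 c1 c2 a f g \<or> an_pair2 c1 c2 a f g \<or> an_pair3 c1 c2 a f g \<or> an_pair4 c1 c2 a f g"
    by (auto simp: an_listed_def)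
  then consider "f analytic_on {a}" | "a \<noteq> 0" "\<forall>\<^sub>F x in nhds a. f x = 1 / x" | "\<forall>\<^sub>F x in nhds a. f x = x ^ 2"
    by (auto simp: an_pair1_def an_pair2_def an_pair3_def an_pair4_def eventually_conj_iff)
  then show ?thesis
  proof cases
    case 2
    have "germ_at a (\<lambda>x. 1 / x) (inverse (fps_coord a))"
      using germ_at_inverse[OF germ_at_ident] 2(1) by (simp add: divide_inverse)
    then show ?thesis
      using germ_at_cong[OF 2(2)] germ_at_imp_analytic by blast
  next
    case 3
    then show ?thesis
      using germ_at_cong[OF 3 germ_at_power[OF germ_at_ident]] germ_at_imp_analytic by blast
  qed
qed

lemma an_listed_imp_admissible:
  assumes "an_listed a f g"
  shows "an_admissible a f g"
proof -
  have f: "f analytic_on {a}"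
    using assms by (rule an_listed_imp_analytic)
  then obtain G where G: "germ_at a g G" "fps_listed a (fps_expansion f a) G"
    using an_listed_germ[OF germ_at_expansion] assms by blast
  then show ?thesis
    using f by (simp add: an_admissible_iff germ_at_imp_analytic germ_at_imp_expansion fps_listed_imp_admissible)
qed

lemma an_admissible_imp_listed_equiv:
  assumes "an_admissible a f g"
  shows "\<exists>b F G. an_listed b F G \<and> an_equiv a f g b F G"
proof -
  let ?f = "fps_expansion f a" and ?g = "fps_expansion g a"
  have f: "germ_at a f ?f" and g: "germ_at a g ?g" and adm: "fps_admissible ?f ?g"
    using assms by (auto simp: an_admissible_iff germ_at_expansion)
  have id: "fps_map (\<lambda>x. x) h = h" for h :: "complex fps"
    by (intro fps_ext) (simp add: fps_map_def)
  have "field_embedding (\<lambda>x :: complex. x)"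
    by (simp add: field_embedding_def)
  from fps_admissible_imp_listed_equiv[OF adm this, of a]
  obtain b F G where listed: "fps_listed b F G" and "fps_equiv a ?f ?g b F G"
    by (auto simp: id)
  then obtain l0 l1 m0 m1 m2 where l1: "l1 \<noteq> 0" and m0: "m0 \<noteq> 0" and b: "b = l0 + l1 * a"
    and fF: "?f = fps_const m0 * fps_rescale l1 F + fps_const m1 + fps_const m2 * fps_coord a"
    and gG: "?g = fps_rescale l1 G"
    by (auto simp: fps_equiv_def)
  \<comment> \<open>The analytic F and G arise from f and g by undoing the substitution, so they
    inherit convergence.\<close>
  define h where "h x = (f x - m1 - m2 * x) * (1 / m0)" for x
  define j where "j y = - l0 / l1 + (1 / l1) * y" for y
  have a: "a = - l0 / l1 + (1 / l1) * b"
    using l1 by (simp add: b field_simps)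
  have j: "j (l0 + l1 * x) = x" for x
    using l1 by (simp add: j_def field_simps)
  have unscale: "fps_rescale (1 / l1) (fps_rescale l1 H) = H" for H :: "complex fps"
    using fps_rescale_inverse_rescale[of "1 / l1" H] l1 by simp
  have "germ_at a h ((?f - fps_const m1 - fps_const m2 * fps_coord a) * fps_const (1 / m0))"
    unfolding h_def[abs_def] by (intro germ_at_mult germ_at_diff germ_at_const germ_at_ident f)
  also have "(?f - fps_const m1 - fps_const m2 * fps_coord a) * fps_const (1 / m0) = fps_rescale l1 F"
    unfolding fF using m0 by (simp add: mult.commute mult.assoc[symmetric])
  finally have "germ_at b (\<lambda>y. h (j y)) (fps_rescale (1 / l1) (fps_rescale l1 F))"
    unfolding j_def by (rule germ_at_compose_linear[OF _ a])
  then have hF: "germ_at b (\<lambda>y. h (j y)) F"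
    by (simp only: unscale)
  have "germ_at b (\<lambda>y. g (j y)) (fps_rescale (1 / l1) (fps_rescale l1 G))"
    unfolding j_def using g unfolding gG by (rule germ_at_compose_linear[OF _ a])
  then have "germ_at b (\<lambda>y. g (j y)) G"
    by (simp only: unscale)
  then have "an_listed b (\<lambda>y. h (j y)) (\<lambda>y. g (j y))"
    using an_listed_germ[OF hF] listed by blast
  moreover have "an_equiv a f g b (\<lambda>y. h (j y)) (\<lambda>y. g (j y))"
    unfolding an_equiv_def j using l1 m0 b
    by (intro exI[of _ l0] exI[of _ l1] exI[of _ m0] exI[of _ m1] exI[of _ m2]) (simp add: h_def j)
  ultimately show ?thesis by blast
qed

text \<open>The ratio 1 + 2 |y1| + |y2| works because (n + 1)(4 n + 6) is at most twice, and (2 n +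
  1)(2 n + 3) at most once, the leading factor 4 (n + 1)(n + 2). The summand 1 makes the ratio at
  least 1, so the bound at index n also holds with exponent n + 1.\<close>

lemma fps_ode_coeff_bound:
  fixes y1 y2 u v :: complex
  shows "norm (fps_ode_coeff y1 y2 u v n) \<le> (norm u + norm v) * (1 + 2 * norm y1 + norm y2) ^ n"
proof -
  define M where "M = 1 + 2 * norm y1 + norm y2"
  define C where "C = norm u + norm v"
  have M: "M \<ge> 1" and C: "C \<ge> 0"
    by (simp_all add: M_def C_def)
  have "norm (fps_ode_coeff y1 y2 u v n) \<le> C * M ^ n"
  proof (induction n rule: induct_nat_012)
    case 0
    show ?case by (simp add: C_def)
  next
    case 1
    have "norm v \<le> C * 1" by (simp add: C_def)
    also have "\<dots> \<le> C * M"
      using M C by (intro mult_left_mono)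
    finally show ?case by simp
  next
    case (ge2 n)
    let ?x = "real n"
    let ?d = "4 * (?x + 1) * (?x + 2)"
    let ?p = "fps_ode_coeff y1 y2 u v (Suc n)" and ?q = "fps_ode_coeff y1 y2 u v n"
    have d: "?d > 0" by simp
    have nd: "norm (4 * (of_nat n + 1) * (of_nat n + 2) :: complex) = ?d"
      "norm ((of_nat n + 1) * (4 * of_nat n + 6) :: complex) = (?x + 1) * (4 * ?x + 6)"
      "norm ((2 * of_nat n + 1) * (2 * of_nat n + 3) :: complex) = (2 * ?x + 1) * (2 * ?x + 3)"
    proof -
      have "norm (of_nat m :: complex) = real m" for m by simp
      from this[of "4 * (n + 1) * (n + 2)"] this[of "(n + 1) * (4 * n + 6)"] this[of "(2 * n + 1) * (2 * n + 3)"]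
      show "norm (4 * (of_nat n + 1) * (of_nat n + 2) :: complex) = ?d"
        "norm ((of_nat n + 1) * (4 * of_nat n + 6) :: complex) = (?x + 1) * (4 * ?x + 6)"
        "norm ((2 * of_nat n + 1) * (2 * of_nat n + 3) :: complex) = (2 * ?x + 1) * (2 * ?x + 3)"
        by (simp_all only: of_nat_mult of_nat_add of_nat_numeral of_nat_1)
    qed
    have "norm (fps_ode_coeff y1 y2 u v (Suc (Suc n))) =
      norm (y1 * ((of_nat n + 1) * (4 * of_nat n + 6)) * ?p + y2 * ((2 * of_nat n + 1) * (2 * of_nat n + 3)) * ?q) / ?d"
      unfolding fps_ode_coeff.simps norm_divide norm_minus_cancel nd by (simp only: mult.assoc)
    also have "\<dots> \<le> (norm y1 * ((?x + 1) * (4 * ?x + 6)) * norm ?p + norm y2 * ((2 * ?x + 1) * (2 * ?x + 3)) * norm ?q) / ?d"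
    proof (intro divide_right_mono order_trans[OF norm_triangle_ineq])
      have n: "norm (x * K * w) = norm x * norm K * norm w" for x K w :: complex
        by (simp add: norm_mult)
      show "norm (y1 * ((of_nat n + 1) * (4 * of_nat n + 6)) * ?p) + norm (y2 * ((2 * of_nat n + 1) * (2 * of_nat n + 3)) * ?q)
        \<le> norm y1 * ((?x + 1) * (4 * ?x + 6)) * norm ?p + norm y2 * ((2 * ?x + 1) * (2 * ?x + 3)) * norm ?q"
        unfolding n nd ..
    qed (use d in simp)
    also have "\<dots> \<le> (norm y1 * (2 * ?d) * norm ?p + norm y2 * ?d * norm ?q) / ?d"
      using d by (intro divide_right_mono add_mono mult_right_mono mult_left_mono) (auto simp: algebra_simps)
    also have "\<dots> = 2 * norm y1 * norm ?p + norm y2 * norm ?q"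
      using d by (simp add: field_simps)
    also have "\<dots> \<le> 2 * norm y1 * (C * M ^ Suc n) + norm y2 * (C * M ^ Suc n)"
    proof -
      have "norm ?q \<le> C * M ^ n" by (rule ge2)
      also have "\<dots> \<le> C * M ^ Suc n"
        using M C by (intro mult_left_mono power_increasing) auto
      finally show ?thesis
        using ge2 by (intro add_mono mult_left_mono) auto
    qed
    also have "\<dots> = (2 * norm y1 + norm y2) * (C * M ^ Suc n)"
      by (simp add: algebra_simps)
    also have "\<dots> \<le> M * (C * M ^ Suc n)"
      using M C by (intro mult_right_mono) (auto simp: M_def)
    finally show ?case by (simp add: mult_ac)
  qed
  then show ?thesis by (simp add: C_def M_def)
qed

text \<open>Every formal solution is thus the expansion of an analytic germ, so the analytic V_f is
  as large as the formal one and the rank carries over.\<close>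

lemma fps_ode_conv_radius_pos:
  fixes g :: "complex fps"
  assumes z2: "z ^ 2 = 1 + fps_const y1 * fps_X + fps_const y2 * fps_X ^ 2" and ode: "fps_ode z y2 g"
  shows "fps_conv_radius g > 0"
proof -
  define M where "M = 1 + 2 * norm y1 + norm y2"
  define C where "C = norm (fps_nth g 0) + norm (fps_nth g 1)"
  have M: "M \<ge> 1" by (simp add: M_def)
  have bound: "norm (fps_nth g n) \<le> C * M ^ n" for n
  proof -
    have "fps_nth g n = fps_ode_coeff y1 y2 (fps_nth g 0) (fps_nth g 1) n"
      using ode unfolding fps_ode_iff_coeff[OF z2] by (metis fps_nth_Abs_fps)
    then show ?thesis
      unfolding C_def M_def using fps_ode_coeff_bound[of y1 y2 "fps_nth g 0" "fps_nth g 1" n] by simp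
  qed
  define x where "x = complex_of_real (1 / (2 * M))"
  have "summable (\<lambda>n. fps_nth g n * x ^ n)"
  proof (rule summable_comparison_test')
    show "summable (\<lambda>n. C * (1/2) ^ n)"
      by (intro summable_mult summable_geometric) simp
    fix n :: nat assume "n \<ge> 0"
    have "norm (fps_nth g n * x ^ n) = norm (fps_nth g n) * (1 / (2 * M)) ^ n"
      using M by (simp add: norm_mult norm_power x_def norm_divide)
    also have "\<dots> \<le> C * M ^ n * (1 / (2 * M)) ^ n"
      using bound M by (intro mult_right_mono) auto
    also have "\<dots> = C * (1/2) ^ n"
      using M by (simp add: power_divide power_mult_distrib)
    finally show "norm (fps_nth g n * x ^ n) \<le> C * (1/2) ^ n" .
  qed
  then have "fps_conv_radius g \<ge> norm x"
    unfolding fps_conv_radius_def by (rule conv_radius_geI)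
  moreover have "norm x > 0"
    using M by (simp add: x_def)
  ultimately show ?thesis
    by (metis ereal_less(2) less_le_trans)
qed

lemma an_rank_eq_2:
  assumes "an_admissible a f g"
  shows "an_rank a f = 2"
proof -
  let ?f = "fps_expansion f a"
  have f: "f analytic_on {a}" and adm: "fps_admissible ?f (fps_expansion g a)"
    using assms by (auto simp: an_admissible_iff)
  obtain z y1 y2 c where conic: "fps_conic ?f z y1 y2 c"
    using adm by (rule fps_admissible_imp_conic)
  have z2: "z ^ 2 = 1 + fps_const y1 * fps_X + fps_const y2 * fps_X ^ 2"
    using conic by (simp add: fps_conic_def)
  have "(\<lambda>g. fps_expansion g a) ` an_V a f = fps_V ?f"
  proof (intro equalityI subsetI)
    fix G assume "G \<in> (\<lambda>g. fps_expansion g a) ` an_V a f"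
    then obtain h where G: "G = fps_expansion h a" and "an_admissible a f h \<or> (\<forall>\<^sub>F t in nhds a. h t = 0)"
      by (auto simp: an_V_def)
    then show "G \<in> fps_V ?f"
      by (auto simp: an_admissible_iff fps_V_def germ_at_0_iff[symmetric] dest: germ_at_imp_expansion)
  next
    fix G assume G: "G \<in> fps_V ?f"
    then have "fps_conv_radius G > 0"
      unfolding fps_V_eq[OF conic] by (intro fps_ode_conv_radius_pos[OF z2]) simp
    then have "germ_at a (\<lambda>x. eval_fps G (x - a)) G"
      by (simp add: germ_at_def eval_fps_has_fps_expansion)
    then obtain h where h: "germ_at a h G" by blast
    then have "h analytic_on {a}" "fps_expansion h a = G"
      by (auto intro: germ_at_imp_analytic germ_at_imp_expansion)
    moreover from this have "h \<in> an_V a f"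
      using G f h by (auto simp: an_V_def fps_V_def an_admissible_iff germ_at_0_iff)
    ultimately show "G \<in> (\<lambda>g. fps_expansion g a) ` an_V a f"
      by blast
  qed
  then show ?thesis
    using fps_rank_eq_2[OF conic] by (simp add: an_rank_def fps_rank_def)
qed

theorem theorem6p1:
  shows
    "(\<forall>(a::'k::field_char_0) f g. fps_listed a f g \<longrightarrow> fps_admissible f g) \<and>
     (\<forall>(a::'k) f g (\<phi> :: 'k \<Rightarrow> 'l::{field_char_0, alg_closed_field}).
        fps_admissible f g \<longrightarrow> field_embedding \<phi> \<longrightarrow>
        (\<exists>b F G. fps_listed b F G \<and>
           fps_equiv (\<phi> a) (fps_map \<phi> f) (fps_map \<phi> g) b F G)) \<and>
     (\<forall>f g :: 'k fps. fps_admissible f g \<longrightarrow> fps_rank f = 2) \<and>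
     (\<forall>a f g. an_listed a f g \<longrightarrow> an_admissible a f g) \<and>
     (\<forall>a f g. an_admissible a f g \<longrightarrow>
        (\<exists>b F G. an_listed b F G \<and> an_equiv a f g b F G)) \<and>
     (\<forall>a f g. an_admissible a f g \<longrightarrow> an_rank a f = 2)"
proof (intro conjI allI impI)
  fix f g :: "'k fps" assume "fps_admissible f g"
  then show "fps_rank f = 2"
    by (metis fps_admissible_imp_conic fps_rank_eq_2)
qed (fact fps_listed_imp_admissible fps_admissible_imp_listed_equiv an_listed_imp_admissible
    an_admissible_imp_listed_equiv an_rank_eq_2)+

end
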